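(* Let $\mathcal{L}$ be an infinitary Lawvere theory. Then $\mathrm{Mod}(\mathcal{L})$ is cocomplete, and for every cocomplete category $\mathcal{C}$ we have an equivalence of categories $$\mathrm{Hom}_{\mathrm{c}}(\mathrm{Mod}(\mathcal{L}),\mathcal{C}) \simeq \mathrm{Mod}_{\mathcal{C}}(\mathcal{L}^{\mathrm{op}}).$$
   Context: Conventions: categories are locally small unless otherwise stated; limits and colimits are small. $\mathrm{Hom}_{\mathrm{c}}$ denotes the (not necessarily locally small) category of cocontinuous functors (those preserving small colimits) and natural transformations. An infinitary Lawvere theory $(\mathcal{L},X)$, abbreviated $\mathcal{L}$, is a (locally small) category $\mathcal{L}$ with a distinguished object $X$ such that for every set $I$ a power $X^I$ exists in $\mathcal{L}$ and every object of $\mathcal{L}$ is isomorphic to such a power. $\mathrm{Mod}(\mathcal{L})$ is the category of models of $\mathcal{L}$: functors $M:\mathcal{L}\to\mathsf{Set}$ such that for every set $I$ the cone $(M(\mathrm{pr}_i):M(X^I)\to M(X))_{i\in I}$ is a product cone (equivalently, functors preserving all small products), with natural transformations as morphisms. $\mathrm{Mod}_{\mathcal{C}}(\mathcal{L}^{\mathrm{op}})$ is the category of functors $N:\mathcal{L}^{\mathrm{op}}\to\mathcal{C}$ such that for every set $I$ the cocone $(N(\mathrm{pr}_i):N(X)\to N(X^I))_{i\in I}$ is a coproduct cocone in $\mathcal{C}$, with natural transformations as morphisms. *)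

theory Defs
  imports Main "HOL-Library.FuncSet"
begin

unbundle cardinal_syntax

section \<open>Size\<close>

text \<open>
  The universe of sets is represented by a type \<open>'u\<close>: a set, of whatever type, is small if it has
  fewer elements than \<open>'u\<close>, and \<open>'u\<close> is required to make the small sets closed under power sets
  and small unions, i.e. its cardinality is a regular strong limit (hence infinite). For
  uncountable \<open>'u\<close> this says that the cardinality of \<open>'u\<close> is strongly inaccessible, i.e.
  that the small subsets of \<open>'u\<close> are, up to bijection, the elements of a Grothendieck universe.
  As in SGA 4, the countable case is not excluded: there \<open>small\<close> means \<open>finite\<close>.

  An arbitrary set of objects or arrows plays the role of a class, so categories that are not
  locally small need no separate treatment. Every small set is in bijection with a
  subset of \<open>'u\<close>, so it suffices to let index sets and small categories range over \<open>'u\<close>.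
\<close>

definition small :: "'u itself \<Rightarrow> 'b set \<Rightarrow> bool" where
  "small U A \<longleftrightarrow> |A| <o |UNIV :: 'u set|"

definition universe :: "'u itself \<Rightarrow> bool" where
  "universe U \<longleftrightarrow>
     (\<forall>A :: 'u set. small U A \<longrightarrow> small U (Pow A)) \<and>
     (\<forall>(I :: 'u set) (A :: 'u \<Rightarrow> 'u set).
        small U I \<longrightarrow> (\<forall>i\<in>I. small U (A i)) \<longrightarrow> small U (\<Union>i\<in>I. A i))"

lemma small_nat_iff: "small TYPE(nat) A \<longleftrightarrow> finite A"
  using ordLess_ordIso_trans[of "|A|", OF _ card_of_nat]
    ordLess_ordIso_trans[of "|A|", OF _ ordIso_symmetric[OF card_of_nat]]
  by (auto simp: small_def finite_iff_ordLess_natLeq)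

lemma universe_nat: "universe TYPE(nat)"
  by (simp add: universe_def small_nat_iff)


section \<open>Categories, functors, natural transformations\<close>

record ('o, 'a) cat =
  Obj :: "'o set"
  Arr :: "'a set"
  Dom :: "'a \<Rightarrow> 'o"
  Cod :: "'a \<Rightarrow> 'o"
  Idn :: "'o \<Rightarrow> 'a"
  Cmp :: "'a \<Rightarrow> 'a \<Rightarrow> 'a"  \<comment> \<open>\<open>Cmp C g f\<close> is \<open>g\<close> after \<open>f\<close>\<close>

definition hom :: "('o, 'a) cat \<Rightarrow> 'o \<Rightarrow> 'o \<Rightarrow> 'a set" where
  "hom C a b = {f \<in> Arr C. Dom C f = a \<and> Cod C f = b}"

locale category =
  fixes C :: "('o, 'a) cat"
  assumes Dom_Obj: "f \<in> Arr C \<Longrightarrow> Dom C f \<in> Obj C"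
    and Cod_Obj: "f \<in> Arr C \<Longrightarrow> Cod C f \<in> Obj C"
    and Idn_hom: "a \<in> Obj C \<Longrightarrow> Idn C a \<in> hom C a a"
    and Cmp_hom: "f \<in> hom C a b \<Longrightarrow> g \<in> hom C b c \<Longrightarrow> Cmp C g f \<in> hom C a c"
    and Cmp_Idn: "f \<in> hom C a b \<Longrightarrow> Cmp C f (Idn C a) = f"
    and Idn_Cmp: "f \<in> hom C a b \<Longrightarrow> Cmp C (Idn C b) f = f"
    and Cmp_assoc: "f \<in> hom C a b \<Longrightarrow> g \<in> hom C b c \<Longrightarrow> h \<in> hom C c d \<Longrightarrow>
      Cmp C (Cmp C h g) f = Cmp C h (Cmp C g f)"

definition locally_small :: "'u itself \<Rightarrow> ('o, 'a) cat \<Rightarrow> bool" where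
  "locally_small U C \<longleftrightarrow> (\<forall>a\<in>Obj C. \<forall>b\<in>Obj C. small U (hom C a b))"

definition small_category :: "'u itself \<Rightarrow> ('o, 'a) cat \<Rightarrow> bool" where
  "small_category U C \<longleftrightarrow> category C \<and> small U (Obj C) \<and> small U (Arr C)"

definition iso :: "('o, 'a) cat \<Rightarrow> 'a \<Rightarrow> bool" where
  "iso C f \<longleftrightarrow> f \<in> Arr C \<and> (\<exists>g \<in> hom C (Cod C f) (Dom C f).
     Cmp C g f = Idn C (Dom C f) \<and> Cmp C f g = Idn C (Cod C f))"

definition isomorphic :: "('o, 'a) cat \<Rightarrow> 'o \<Rightarrow> 'o \<Rightarrow> bool" where
  "isomorphic C a b \<longleftrightarrow> (\<exists>f \<in> hom C a b. iso C f)"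

definition op_cat :: "('o, 'a) cat \<Rightarrow> ('o, 'a) cat" where
  "op_cat C = \<lparr>Obj = Obj C, Arr = Arr C, Dom = Cod C, Cod = Dom C, Idn = Idn C,
     Cmp = (\<lambda>g f. Cmp C f g)\<rparr>"

definition full_subcategory :: "('o, 'a) cat \<Rightarrow> ('o \<Rightarrow> bool) \<Rightarrow> ('o, 'a) cat" where
  "full_subcategory C P = \<lparr>Obj = {a \<in> Obj C. P a},
     Arr = {f \<in> Arr C. P (Dom C f) \<and> P (Cod C f)},
     Dom = Dom C, Cod = Cod C, Idn = Idn C, Cmp = Cmp C\<rparr>"

record ('o, 'a, 'p, 'b) fnctr =
  FObj :: "'o \<Rightarrow> 'p"
  FArr :: "'a \<Rightarrow> 'b"

definition is_functor :: "('o, 'a) cat \<Rightarrow> ('p, 'b) cat \<Rightarrow> ('o, 'a, 'p, 'b) fnctr \<Rightarrow> bool" where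
  "is_functor A B F \<longleftrightarrow>
     (\<forall>a\<in>Obj A. FObj F a \<in> Obj B) \<and>
     (\<forall>f\<in>Arr A. FArr F f \<in> hom B (FObj F (Dom A f)) (FObj F (Cod A f))) \<and>
     (\<forall>a\<in>Obj A. FArr F (Idn A a) = Idn B (FObj F a)) \<and>
     (\<forall>f\<in>Arr A. \<forall>g\<in>Arr A. Dom A g = Cod A f \<longrightarrow>
        FArr F (Cmp A g f) = Cmp B (FArr F g) (FArr F f))"

definition id_functor :: "('o, 'a, 'o, 'a) fnctr" where
  "id_functor = \<lparr>FObj = (\<lambda>a. a), FArr = (\<lambda>f. f)\<rparr>"

definition comp_functor ::
  "('p, 'b, 'q, 'c) fnctr \<Rightarrow> ('o, 'a, 'p, 'b) fnctr \<Rightarrow> ('o, 'a, 'q, 'c) fnctr" where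
  "comp_functor G F = \<lparr>FObj = FObj G \<circ> FObj F, FArr = FArr G \<circ> FArr F\<rparr>"

definition nat_trans :: "('o, 'a) cat \<Rightarrow> ('p, 'b) cat \<Rightarrow>
    ('o, 'a, 'p, 'b) fnctr \<Rightarrow> ('o, 'a, 'p, 'b) fnctr \<Rightarrow> ('o \<Rightarrow> 'b) \<Rightarrow> bool" where
  "nat_trans A B F G t \<longleftrightarrow>
     (\<forall>a\<in>Obj A. t a \<in> hom B (FObj F a) (FObj G a)) \<and>
     (\<forall>f\<in>Arr A. Cmp B (t (Cod A f)) (FArr F f) = Cmp B (FArr G f) (t (Dom A f)))"

definition naturally_isomorphic :: "('o, 'a) cat \<Rightarrow> ('p, 'b) cat \<Rightarrow>
    ('o, 'a, 'p, 'b) fnctr \<Rightarrow> ('o, 'a, 'p, 'b) fnctr \<Rightarrow> bool" where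
  "naturally_isomorphic A B F G \<longleftrightarrow>
     (\<exists>t. nat_trans A B F G t \<and> (\<forall>a\<in>Obj A. iso B (t a)))"

definition equivalent_categories :: "('o, 'a) cat \<Rightarrow> ('p, 'b) cat \<Rightarrow> bool" where
  "equivalent_categories A B \<longleftrightarrow> category A \<and> category B \<and>
     (\<exists>F G. is_functor A B F \<and> is_functor B A G \<and>
        naturally_isomorphic A A id_functor (comp_functor G F) \<and>
        naturally_isomorphic B B (comp_functor F G) id_functor)"

text \<open>
  In the functor category, functors and transformations are \<open>extensional\<close>, so that they are
  determined by their values on actual objects and arrows.
\<close>

type_synonym ('o, 'a, 'p, 'b) nt =
  "('o, 'a, 'p, 'b) fnctr \<times> ('o, 'a, 'p, 'b) fnctr \<times> ('o \<Rightarrow> 'b)"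

definition functor_objects :: "('o, 'a) cat \<Rightarrow> ('p, 'b) cat \<Rightarrow> ('o, 'a, 'p, 'b) fnctr set" where
  "functor_objects A B = {F. is_functor A B F \<and>
     FObj F \<in> extensional (Obj A) \<and> FArr F \<in> extensional (Arr A)}"

definition functor_category ::
  "('o, 'a) cat \<Rightarrow> ('p, 'b) cat \<Rightarrow> (('o, 'a, 'p, 'b) fnctr, ('o, 'a, 'p, 'b) nt) cat" where
  "functor_category A B = \<lparr>
     Obj = functor_objects A B,
     Arr = {(F, G, t). F \<in> functor_objects A B \<and> G \<in> functor_objects A B \<and>
              nat_trans A B F G t \<and> t \<in> extensional (Obj A)},
     Dom = (\<lambda>(F, G, t). F),
     Cod = (\<lambda>(F, G, t). G),
     Idn = (\<lambda>F. (F, F, \<lambda>a\<in>Obj A. Idn B (FObj F a))),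
     Cmp = (\<lambda>(G, H, s) (F, G', t). (F, H, \<lambda>a\<in>Obj A. Cmp B (s a) (t a)))\<rparr>"


section \<open>Products, coproducts, colimits\<close>

definition is_product :: "('o, 'a) cat \<Rightarrow> 'i set \<Rightarrow> ('i \<Rightarrow> 'o) \<Rightarrow> 'o \<Rightarrow> ('i \<Rightarrow> 'a) \<Rightarrow> bool" where
  "is_product C I A P pr \<longleftrightarrow>
     P \<in> Obj C \<and> (\<forall>i\<in>I. pr i \<in> hom C P (A i)) \<and>
     (\<forall>Q\<in>Obj C. \<forall>q. (\<forall>i\<in>I. q i \<in> hom C Q (A i)) \<longrightarrow>
        (\<exists>!h. h \<in> hom C Q P \<and> (\<forall>i\<in>I. Cmp C (pr i) h = q i)))"

definition is_coproduct :: "('o, 'a) cat \<Rightarrow> 'i set \<Rightarrow> ('i \<Rightarrow> 'o) \<Rightarrow> 'o \<Rightarrow> ('i \<Rightarrow> 'a) \<Rightarrow> bool" where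
  "is_coproduct C I A P inc \<longleftrightarrow>
     P \<in> Obj C \<and> (\<forall>i\<in>I. inc i \<in> hom C (A i) P) \<and>
     (\<forall>Q\<in>Obj C. \<forall>q. (\<forall>i\<in>I. q i \<in> hom C (A i) Q) \<longrightarrow>
        (\<exists>!h. h \<in> hom C P Q \<and> (\<forall>i\<in>I. Cmp C h (inc i) = q i)))"

definition is_cocone :: "('j, 'k) cat \<Rightarrow> ('o, 'a) cat \<Rightarrow> ('j, 'k, 'o, 'a) fnctr \<Rightarrow>
    'o \<Rightarrow> ('j \<Rightarrow> 'a) \<Rightarrow> bool" where
  "is_cocone J C D c t \<longleftrightarrow> c \<in> Obj C \<and>
     (\<forall>j\<in>Obj J. t j \<in> hom C (FObj D j) c) \<and>
     (\<forall>f\<in>Arr J. Cmp C (t (Cod J f)) (FArr D f) = t (Dom J f))"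

definition is_colimit :: "('j, 'k) cat \<Rightarrow> ('o, 'a) cat \<Rightarrow> ('j, 'k, 'o, 'a) fnctr \<Rightarrow>
    'o \<Rightarrow> ('j \<Rightarrow> 'a) \<Rightarrow> bool" where
  "is_colimit J C D c t \<longleftrightarrow> is_cocone J C D c t \<and>
     (\<forall>d s. is_cocone J C D d s \<longrightarrow>
        (\<exists>!h. h \<in> hom C c d \<and> (\<forall>j\<in>Obj J. Cmp C h (t j) = s j)))"

definition cocomplete_category :: "'u itself \<Rightarrow> ('o, 'a) cat \<Rightarrow> bool" where
  "cocomplete_category U C \<longleftrightarrow> category C \<and> locally_small U C \<and>
     (\<forall>(J :: ('u, 'u) cat) D. small_category U J \<and> is_functor J C D \<longrightarrow>
        (\<exists>c t. is_colimit J C D c t))"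

definition cocontinuous :: "'u itself \<Rightarrow> ('o, 'a) cat \<Rightarrow> ('p, 'b) cat \<Rightarrow>
    ('o, 'a, 'p, 'b) fnctr \<Rightarrow> bool" where
  "cocontinuous U A B F \<longleftrightarrow>
     (\<forall>(J :: ('u, 'u) cat) D c t.
        small_category U J \<and> is_functor J A D \<and> is_colimit J A D c t \<longrightarrow>
        is_colimit J B (comp_functor F D) (FObj F c) (\<lambda>j. FArr F (t j)))"

definition Hom_c :: "'u itself \<Rightarrow> ('o, 'a) cat \<Rightarrow> ('p, 'b) cat \<Rightarrow>
    (('o, 'a, 'p, 'b) fnctr, ('o, 'a, 'p, 'b) nt) cat" where
  "Hom_c U A B = full_subcategory (functor_category A B) (cocontinuous U A B)"


section \<open>The category of small sets\<close>

type_synonym 'u set_arr = "'u set \<times> 'u set \<times> ('u \<Rightarrow> 'u)"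

definition Set_cat :: "'u itself \<Rightarrow> ('u set, 'u set_arr) cat" where
  "Set_cat U = \<lparr>
     Obj = {A. small U A},
     Arr = {(A, B, f). small U A \<and> small U B \<and> f \<in> A \<rightarrow>\<^sub>E B},
     Dom = (\<lambda>(A, B, f). A),
     Cod = (\<lambda>(A, B, f). B),
     Idn = (\<lambda>A. (A, A, \<lambda>x\<in>A. x)),
     Cmp = (\<lambda>(B, C, g) (A, B', f). (A, C, compose A g f))\<rparr>"


section \<open>Infinitary Lawvere theories and their models\<close>

locale infinitary_Lawvere_theory = category L
  for U :: "'u itself" and L :: "('o, 'a) cat" and X :: 'o +
  assumes locally_small: "locally_small U L"
    and X_Obj: "X \<in> Obj L"
    and power_exists: "\<And>I :: 'u set. small U I \<Longrightarrow> \<exists>P pr. is_product L I (\<lambda>_. X) P pr"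
    and iso_power: "\<And>a. a \<in> Obj L \<Longrightarrow>
      \<exists>(I :: 'u set) P pr. small U I \<and> is_product L I (\<lambda>_. X) P pr \<and> isomorphic L a P"

text \<open>
  Powers are not chosen, so the conditions below range over every power cone \<open>(P, pr)\<close> of \<open>X\<close>;
  since such a cone is unique up to isomorphism, this is the same as for one choice per \<open>I\<close>.
\<close>

definition is_model :: "'u itself \<Rightarrow> ('o, 'a) cat \<Rightarrow> 'o \<Rightarrow>
    ('o, 'a, 'u set, 'u set_arr) fnctr \<Rightarrow> bool" where
  "is_model U L X M \<longleftrightarrow>
     (\<forall>(I :: 'u set) P pr. small U I \<and> is_product L I (\<lambda>_. X) P pr \<longrightarrow>
        is_product (Set_cat U) I (\<lambda>_. FObj M X) (FObj M P) (\<lambda>i. FArr M (pr i)))"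

definition Mod :: "'u itself \<Rightarrow> ('o, 'a) cat \<Rightarrow> 'o \<Rightarrow>
    (('o, 'a, 'u set, 'u set_arr) fnctr, ('o, 'a, 'u set, 'u set_arr) nt) cat" where
  "Mod U L X = full_subcategory (functor_category L (Set_cat U)) (is_model U L X)"

definition is_comodel :: "'u itself \<Rightarrow> ('o, 'a) cat \<Rightarrow> 'o \<Rightarrow> ('p, 'b) cat \<Rightarrow>
    ('o, 'a, 'p, 'b) fnctr \<Rightarrow> bool" where
  "is_comodel U L X C N \<longleftrightarrow>
     (\<forall>(I :: 'u set) P pr. small U I \<and> is_product L I (\<lambda>_. X) P pr \<longrightarrow>
        is_coproduct C I (\<lambda>_. FObj N X) (FObj N P) (\<lambda>i. FArr N (pr i)))"

definition Mod_op :: "'u itself \<Rightarrow> ('p, 'b) cat \<Rightarrow> ('o, 'a) cat \<Rightarrow> 'o \<Rightarrow>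
    (('o, 'a, 'p, 'b) fnctr, ('o, 'a, 'p, 'b) nt) cat" where
  "Mod_op U C L X = full_subcategory (functor_category (op_cat L) C) (is_comodel U L X C)"

end

theory Submission
  imports Defs
begin

text \<open>
  Every model is the coequalizer of two homomorphisms between free models, and the free models are
  the representables \<open>hom L a\<close>, because every object of a Lawvere theory is a power of \<open>X\<close>. A
  cocontinuous functor is therefore determined by its restriction along the Yoneda embedding
  \<open>rep\<close>, and this restriction is a comodel since \<open>rep\<close> turns powers of \<open>X\<close> into coproducts.
  Conversely a comodel \<open>N\<close> in \<open>C\<close> extends to the functor sending \<open>M\<close> to the colimit of \<open>N\<close>
  weighted by \<open>M\<close>.
  
  The category \<open>L\<close> is in general not small, so the existence of weighted colimits and their
  preservation have to be reduced to small diagrams. This is what presentations are for: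
  for each model \<open>M\<close> there are arrows \<open>u, v\<close> from \<open>P\<close> to \<open>Q\<close> in \<open>L\<close> and an element
  \<open>m\<close> of \<open>M P\<close> such that \<open>m\<close> generates \<open>M\<close> and the relation \<open>u m = v m\<close> implies all others
  (\<open>presentation_exists\<close>). For every comodel \<open>N\<close>, whatever its target, the colimit of \<open>N\<close>
  weighted by \<open>M\<close> is then the same as a coequalizer of \<open>N u\<close> and \<open>N v\<close>
  (\<open>wcolimit_iff_coequalizer\<close>). Applied to \<open>rep\<close> itself, whose weighted colimit is \<open>M\<close> by the
  Yoneda lemma, this shows that a cocontinuous functor \<open>G\<close> sends \<open>M\<close> to the colimit of its
  restriction weighted by \<open>M\<close> (\<open>wcolimit_restr\<close>), whence restriction is fully faithful.
  Applied to an arbitrary comodel it yields the extension.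
  
  The extension is cocontinuous because it has a right adjoint, which sends \<open>d\<close> to the
  model \<open>C(N -, d)\<close>, which is a model precisely because \<open>N\<close> is a comodel. Restricting
  the extension gives back \<open>N\<close> by the Yoneda lemma, so restriction is essentially surjective.
  
  Cocompleteness of the category of models is proved without constructing coequalizers and
  coproducts separately. The colimit of a small diagram is the image of the free model on the disjoint
  union of its underlying sets in the product of the vertices of all cocones. That product is indexed
  by a proper class, but the image is small, and its universal property holds by construction.
\<close>

section \<open>Small sets\<close>

lemma small_subset: "small U A \<Longrightarrow> B \<subseteq> A \<Longrightarrow> small U B"
  unfolding small_def by (meson card_of_mono1 ordLeq_ordLess_trans)

lemma small_image: "small U A \<Longrightarrow> small U (f ` A)"
  unfolding small_def by (meson card_of_image ordLeq_ordLess_trans)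

lemma small_inj_on:
  assumes "inj_on f A" and "f ` A \<subseteq> B" and "small U B"
  shows "small U A"
  using assms card_of_ordLeq[of A B] ordLeq_ordLess_trans unfolding small_def by blast

lemma small_embeds:
  assumes "small (U :: 'u itself) A"
  shows "\<exists>g :: 'b \<Rightarrow> 'u. inj_on g A"
  using assms card_of_ordLeq[of A "UNIV :: 'u set"] ordLess_imp_ordLeq
  unfolding small_def by blast

lemma small_iff_no_embedding:
  "small (U :: 'u itself) A \<longleftrightarrow> \<not> (\<exists>f :: 'u \<Rightarrow> _. inj f \<and> range f \<subseteq> A)"
  unfolding small_def card_of_ordLeq not_ordLess_iff_ordLeq[OF card_of_Well_order card_of_Well_order, symmetric]
  by simp

locale small_universe =
  fixes U :: "'u itself"
  assumes universe: "universe U"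
begin

lemma small_Pow_UN:
  shows "small U A \<Longrightarrow> small U (Pow (A :: 'u set))"
    and "small U (I :: 'u set) \<Longrightarrow> (\<And>i. i \<in> I \<Longrightarrow> small U (B i :: 'u set)) \<Longrightarrow> small U (\<Union>i\<in>I. B i)"
  using universe unfolding universe_def by auto

text \<open>
  Removing one point from a finite universe would leave a small set with at least as many subsets as
  the universe has elements.
\<close>

lemma infinite_universe: "infinite (UNIV :: 'u set)"
proof
  assume fin: "finite (UNIV :: 'u set)"
  fix x :: 'u
  let ?A = "UNIV - {x} :: 'u set"
  have "x \<notin> ?A" by simp
  then have "\<not> range f \<subseteq> ?A" if "inj f" for f :: "'u \<Rightarrow> 'u"
    using finite_UNIV_inj_surj[OF fin that] by (metis UNIV_I subsetD)
  then have "small U ?A" unfolding small_iff_no_embedding by simp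
  then have "small U (Pow ?A)" by (rule small_Pow_UN)
  \<comment> \<open>The removed point is sent to the empty set, every other point to its singleton.\<close>
  moreover have "inj (\<lambda>y. {y} - {x})" by (auto simp: inj_def)
  moreover have "range (\<lambda>y. {y} - {x}) \<subseteq> Pow ?A" by auto
  ultimately show False unfolding small_iff_no_embedding by meson
qed

lemma small_finite:
  assumes "finite A" shows "small U A"
proof -
  have False if "inj f" "range f \<subseteq> A" for f :: "'u \<Rightarrow> _"
    using finite_subset[OF that(2) assms] finite_imageD[OF _ that(1)] infinite_universe by simp
  then show ?thesis unfolding small_iff_no_embedding by meson
qed

text \<open>
  The fibres are copied into \<open>'u\<close>, made disjoint by a pairing function on the infinite type
  \<open>'u\<close>; their union is then small by the second universe axiom.
\<close>

lemma small_Sigma: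
  assumes "small U A" and "\<And>a. a \<in> A \<Longrightarrow> small U (B a)"
  shows "small U (Sigma A B)"
proof -
  obtain g where g: "inj_on (g :: _ \<Rightarrow> 'u) A" using small_embeds[OF assms(1)] by blast
  have "\<forall>a\<in>A. \<exists>h :: _ \<Rightarrow> 'u. inj_on h (B a)" using small_embeds[OF assms(2)] by blast
  then obtain h where h: "\<And>a. a \<in> A \<Longrightarrow> inj_on (h a :: _ \<Rightarrow> 'u) (B a)" by metis
  have "|(UNIV :: 'u set) \<times> (UNIV :: 'u set)| \<le>o |UNIV :: 'u set|"
    using card_of_Times_same_infinite[OF infinite_universe] ordIso_iff_ordLeq by blast
  then obtain p where p: "inj (p :: 'u \<times> 'u \<Rightarrow> 'u)"
    unfolding card_of_ordLeq[symmetric] by auto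
  define S where "S i = (let a = the_inv_into A g i in (\<lambda>b. p (i, h a b)) ` B a)" for i
  have S: "S (g a) = (\<lambda>b. p (g a, h a b)) ` B a" if "a \<in> A" for a
    using that g by (simp add: S_def the_inv_into_f_f)
  have "small U (\<Union>i\<in>g ` A. S i)"
    using assms by (intro small_Pow_UN(2)) (auto simp: S intro!: small_image)
  moreover have "inj_on (\<lambda>(a, b). p (g a, h a b)) (Sigma A B)"
    using g h by (auto simp: inj_on_def inj_eq[OF p])
  ultimately show ?thesis
    by (elim small_inj_on[rotated 2]) (auto simp: S)
qed

text \<open>
  A function is determined by its graph, and the graphs lie in the power set of a small set.
\<close>

lemma small_PiE:
  assumes "small U A" and "small U B"
  shows "small U (A \<rightarrow>\<^sub>E B)"
proof -
  have AB: "small U (A \<times> B)" using assms by (rule small_Sigma)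
  obtain g where g: "inj_on (g :: _ \<Rightarrow> 'u) (A \<times> B)"
    using small_embeds[OF AB] by blast
  have "small U (Pow (g ` (A \<times> B)))"
    using small_Pow_UN(1) small_image[OF AB] by blast
  moreover have "inj_on (\<lambda>f. g ` ((\<lambda>a. (a, f a)) ` A)) (A \<rightarrow>\<^sub>E B)"
  proof (rule inj_onI)
    fix f f' assume f: "f \<in> A \<rightarrow>\<^sub>E B" "f' \<in> A \<rightarrow>\<^sub>E B"
      and eq: "g ` ((\<lambda>a. (a, f a)) ` A) = g ` ((\<lambda>a. (a, f' a)) ` A)"
    have "(\<lambda>a. (a, f a)) ` A = (\<lambda>a. (a, f' a)) ` A"
      using eq f by (subst (asm) inj_on_image_eq_iff[OF g]) auto
    then have "f a = f' a" if "a \<in> A" for a using that by (auto simp: set_eq_iff image_iff)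
    then show "f = f'" using f by (intro PiE_ext) auto
  qed
  ultimately show ?thesis
    by (elim small_inj_on[rotated 2]) (auto simp: PiE_iff)
qed

text \<open>
  Small sets of arbitrary type are moved into \<open>'u\<close> along a chosen injection, so that sets of arrows
  and the like can serve as values of functors into \<open>Set_cat\<close>.
\<close>

definition enc :: "'z set \<Rightarrow> 'z \<Rightarrow> 'u" where
  "enc A = (SOME g. inj_on g A)"

definition dec :: "'z set \<Rightarrow> 'u \<Rightarrow> 'z" where
  "dec A = the_inv_into A (enc A)"

lemma inj_enc: "small U A \<Longrightarrow> inj_on (enc A) A"
  unfolding enc_def by (rule someI_ex[OF small_embeds])

lemma dec_enc: "small U A \<Longrightarrow> z \<in> A \<Longrightarrow> dec A (enc A z) = z"
  unfolding dec_def by (intro the_inv_into_f_f inj_enc)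

end

section \<open>Functor categories and equivalences\<close>

lemma hom_Arr: "f \<in> hom C a b \<Longrightarrow> f \<in> Arr C"
  and hom_Dom: "f \<in> hom C a b \<Longrightarrow> Dom C f = a"
  and hom_Cod: "f \<in> hom C a b \<Longrightarrow> Cod C f = b"
  and Arr_hom: "f \<in> Arr C \<Longrightarrow> f \<in> hom C (Dom C f) (Cod C f)"
  by (auto simp: hom_def)

lemma (in category) hom_Obj: "f \<in> hom C a b \<Longrightarrow> a \<in> Obj C" "f \<in> hom C a b \<Longrightarrow> b \<in> Obj C"
  using Dom_Obj Cod_Obj by (auto simp: hom_def)

lemma is_functorD:
  assumes "is_functor A B F"
  shows "a \<in> Obj A \<Longrightarrow> FObj F a \<in> Obj B"
    and "f \<in> hom A a b \<Longrightarrow> FArr F f \<in> hom B (FObj F a) (FObj F b)"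
    and "a \<in> Obj A \<Longrightarrow> FArr F (Idn A a) = Idn B (FObj F a)"
    and "f \<in> hom A a b \<Longrightarrow> g \<in> hom A b c \<Longrightarrow> FArr F (Cmp A g f) = Cmp B (FArr F g) (FArr F f)"
  using assms by (auto simp: is_functor_def hom_def)

lemma is_functorI:
  assumes "\<And>a. a \<in> Obj A \<Longrightarrow> FObj F a \<in> Obj B"
    and "\<And>f a b. f \<in> hom A a b \<Longrightarrow> FArr F f \<in> hom B (FObj F a) (FObj F b)"
    and "\<And>a. a \<in> Obj A \<Longrightarrow> FArr F (Idn A a) = Idn B (FObj F a)"
    and "\<And>f g a b c. f \<in> hom A a b \<Longrightarrow> g \<in> hom A b c \<Longrightarrow>
      FArr F (Cmp A g f) = Cmp B (FArr F g) (FArr F f)"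
  shows "is_functor A B F"
  unfolding is_functor_def
proof (intro conjI ballI impI)
  fix f g assume fg: "f \<in> Arr A" "g \<in> Arr A" "Dom A g = Cod A f"
  then show "FArr F (Cmp A g f) = Cmp B (FArr F g) (FArr F f)"
    using assms(4)[of f "Dom A f" "Cod A f" g "Cod A g"] by (simp add: hom_def)
qed (simp_all add: assms(1,3) assms(2)[OF Arr_hom])

lemma nat_transD:
  assumes "nat_trans A B F G t"
  shows "a \<in> Obj A \<Longrightarrow> t a \<in> hom B (FObj F a) (FObj G a)"
    and "f \<in> hom A a b \<Longrightarrow> Cmp B (t b) (FArr F f) = Cmp B (FArr G f) (t a)"
  using assms by (auto simp: nat_trans_def hom_def)

lemma nat_transI:
  assumes "\<And>a. a \<in> Obj A \<Longrightarrow> t a \<in> hom B (FObj F a) (FObj G a)"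
    and "\<And>f a b. f \<in> hom A a b \<Longrightarrow> Cmp B (t b) (FArr F f) = Cmp B (FArr G f) (t a)"
  shows "nat_trans A B F G t"
  by (simp add: nat_trans_def assms(1) assms(2)[OF Arr_hom])

lemma op_cat_simps [simp]:
  "Obj (op_cat C) = Obj C" "Arr (op_cat C) = Arr C" "Dom (op_cat C) = Cod C"
  "Cod (op_cat C) = Dom C" "Idn (op_cat C) = Idn C" "Cmp (op_cat C) g f = Cmp C f g"
  "hom (op_cat C) a b = hom C b a"
  by (auto simp: op_cat_def hom_def)

lemma category_op:
  assumes "category C" shows "category (op_cat C)"
proof -
  interpret category C by fact
  show ?thesis
    by unfold_locales
      (auto simp: Dom_Obj Cod_Obj Idn_hom intro: Cmp_hom Cmp_Idn Idn_Cmp Cmp_assoc[symmetric])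
qed

lemma full_subcategory_simps [simp]:
  "Obj (full_subcategory C P) = {a \<in> Obj C. P a}"
  "Dom (full_subcategory C P) = Dom C" "Cod (full_subcategory C P) = Cod C"
  "Idn (full_subcategory C P) = Idn C" "Cmp (full_subcategory C P) = Cmp C"
  by (auto simp: full_subcategory_def)

lemma hom_full_subcategory_iff:
  "f \<in> hom (full_subcategory C P) a b \<longleftrightarrow> f \<in> hom C a b \<and> P a \<and> P b"
  by (auto simp: full_subcategory_def hom_def)

lemma category_full_subcategory:
  assumes "category C" shows "category (full_subcategory C P)"
proof -
  interpret category C by fact
  show ?thesis
  proof
    fix f assume "f \<in> Arr (full_subcategory C P)"
    then show "Dom (full_subcategory C P) f \<in> Obj (full_subcategory C P)"
      "Cod (full_subcategory C P) f \<in> Obj (full_subcategory C P)"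
      by (simp_all add: full_subcategory_def Dom_Obj Cod_Obj)
  qed (auto simp: hom_full_subcategory_iff Idn_hom intro: Cmp_hom Cmp_Idn Idn_Cmp Cmp_assoc)
qed

lemma functor_category_simps:
  "Obj (functor_category A B) = functor_objects A B"
  "Dom (functor_category A B) (F, G, t) = F" "Cod (functor_category A B) (F, G, t) = G"
  "Idn (functor_category A B) F = (F, F, \<lambda>a\<in>Obj A. Idn B (FObj F a))"
  "Cmp (functor_category A B) (G', H, s) (F, G, t) = (F, H, \<lambda>a\<in>Obj A. Cmp B (s a) (t a))"
  by (auto simp: functor_category_def)

lemma hom_functor_category:
  "\<alpha> \<in> hom (functor_category A B) F G \<longleftrightarrow>
     F \<in> functor_objects A B \<and> G \<in> functor_objects A B \<and>
     (\<exists>t. \<alpha> = (F, G, t) \<and> nat_trans A B F G t \<and> t \<in> extensional (Obj A))"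
  by (auto simp: functor_category_def hom_def)

lemma nat_trans_Idn:
  assumes "category B" and "is_functor A B F"
  shows "nat_trans A B F F (\<lambda>a. Idn B (FObj F a))"
proof -
  interpret B: category B by fact
  show ?thesis
  proof (rule nat_transI)
    fix f a b assume "f \<in> hom A a b"
    from is_functorD(2)[OF assms(2) this]
    show "Cmp B (Idn B (FObj F b)) (FArr F f) = Cmp B (FArr F f) (Idn B (FObj F a))"
      by (simp add: B.Idn_Cmp B.Cmp_Idn)
  qed (simp add: B.Idn_hom is_functorD(1)[OF assms(2)])
qed

lemma nat_trans_Cmp:
  assumes "category A" "category B" and t: "nat_trans A B F G t" and s: "nat_trans A B G H s"
    and F: "is_functor A B F" and G: "is_functor A B G" and H: "is_functor A B H"
  shows "nat_trans A B F H (\<lambda>a. Cmp B (s a) (t a))"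
proof -
  interpret A: category A by fact
  interpret B: category B by fact
  show ?thesis
  proof (rule nat_transI)
    fix f a b assume f: "f \<in> hom A a b"
    note ab = A.hom_Obj[OF f]
    note h = is_functorD(2)[OF F f] is_functorD(2)[OF G f] is_functorD(2)[OF H f]
      nat_transD(1)[OF t ab(1)] nat_transD(1)[OF t ab(2)]
      nat_transD(1)[OF s ab(1)] nat_transD(1)[OF s ab(2)]
    show "Cmp B (Cmp B (s b) (t b)) (FArr F f) = Cmp B (FArr H f) (Cmp B (s a) (t a))"
      using B.Cmp_assoc[OF h(1,5,7)] B.Cmp_assoc[OF h(4,2,7)] B.Cmp_assoc[OF h(4,6,3)]
        nat_transD(2)[OF t f] nat_transD(2)[OF s f] by simp
  qed (use nat_transD(1)[OF t] nat_transD(1)[OF s] in \<open>auto intro: B.Cmp_hom\<close>)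
qed

lemma nat_trans_restrict:
  "category A \<Longrightarrow> nat_trans A B F G (restrict t (Obj A)) \<longleftrightarrow> nat_trans A B F G t"
  by (auto simp: nat_trans_def category.Dom_Obj category.Cod_Obj)

lemma is_functor_object: "F \<in> functor_objects A B \<Longrightarrow> is_functor A B F"
  by (simp add: functor_objects_def)

lemma category_functor_category:
  assumes "category A" "category B" shows "category (functor_category A B)"
proof -
  interpret A: category A by fact
  interpret B: category B by fact
  note [simp] = hom_functor_category functor_category_simps nat_trans_restrict[OF assms(1)]
  have fo: "is_functor A B F" if "F \<in> functor_objects A B" for F
    using that by (simp add: functor_objects_def)
  show ?thesis
  proof
    fix f assume "f \<in> Arr (functor_category A B)"
    then show "Dom (functor_category A B) f \<in> Obj (functor_category A B)"
      "Cod (functor_category A B) f \<in> Obj (functor_category A B)"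
      by (auto simp: functor_category_def)
  next
    fix a assume "a \<in> Obj (functor_category A B)"
    then show "Idn (functor_category A B) a \<in> hom (functor_category A B) a a"
      by (auto intro: nat_trans_Idn assms fo)
  next
    fix f g a b c assume "f \<in> hom (functor_category A B) a b" "g \<in> hom (functor_category A B) b c"
    then show "Cmp (functor_category A B) g f \<in> hom (functor_category A B) a c"
      by auto (rule nat_trans_Cmp[OF assms, where G = b]; simp add: fo)
  next
    fix f a b assume "f \<in> hom (functor_category A B) a b"
    then obtain t where f: "f = (a, b, t)" and t: "nat_trans A B a b t" "t \<in> extensional (Obj A)"
      by auto
    show "Cmp (functor_category A B) f (Idn (functor_category A B) a) = f"
      "Cmp (functor_category A B) (Idn (functor_category A B) b) f = f"
      using B.Cmp_Idn[OF nat_transD(1)[OF t(1)]] B.Idn_Cmp[OF nat_transD(1)[OF t(1)]] t(2)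
      by (auto simp: f intro!: extensionalityI[of _ "Obj A"])
  next
    fix f g h a b c d assume "f \<in> hom (functor_category A B) a b"
      "g \<in> hom (functor_category A B) b c" "h \<in> hom (functor_category A B) c d"
    then obtain t s r where fgh: "f = (a, b, t)" "g = (b, c, s)" "h = (c, d, r)"
      and t: "nat_trans A B a b t" and s: "nat_trans A B b c s" and r: "nat_trans A B c d r"
      by auto
    show "Cmp (functor_category A B) (Cmp (functor_category A B) h g) f =
      Cmp (functor_category A B) h (Cmp (functor_category A B) g f)"
      using B.Cmp_assoc[OF nat_transD(1)[OF t] nat_transD(1)[OF s] nat_transD(1)[OF r]]
      by (auto simp: fgh intro!: restrict_ext)
  qed
qed

lemma functor_objectsI:
  "is_functor A B F \<Longrightarrow> FObj F \<in> extensional (Obj A) \<Longrightarrow> FArr F \<in> extensional (Arr A) \<Longrightarrow>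
    F \<in> functor_objects A B"
  by (simp add: functor_objects_def)

lemma (in category) isoI:
  "f \<in> hom C a b \<Longrightarrow> g \<in> hom C b a \<Longrightarrow> Cmp C g f = Idn C a \<Longrightarrow> Cmp C f g = Idn C b \<Longrightarrow> iso C f"
  by (auto simp: iso_def hom_def)

lemma (in category) isoE:
  assumes "iso C f" and "f \<in> hom C a b"
  obtains g where "g \<in> hom C b a" "Cmp C g f = Idn C a" "Cmp C f g = Idn C b"
  using assms by (auto simp: iso_def hom_def)

lemma comp_functor_simps [simp]:
  "FObj (comp_functor G F) a = FObj G (FObj F a)" "FArr (comp_functor G F) f = FArr G (FArr F f)"
  by (auto simp: comp_functor_def)

lemma id_functor_simps [simp]: "FObj id_functor a = a" "FArr id_functor f = f"
  by (auto simp: id_functor_def)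

lemma is_functor_comp:
  assumes F: "is_functor A B F" and G: "is_functor B C G"
  shows "is_functor A C (comp_functor G F)"
proof (rule is_functorI)
  fix f g a b c assume f: "f \<in> hom A a b" and g: "g \<in> hom A b c"
  show "FArr (comp_functor G F) (Cmp A g f) =
      Cmp C (FArr (comp_functor G F) g) (FArr (comp_functor G F) f)"
    using is_functorD(4)[OF F f g] is_functorD(4)[OF G is_functorD(2)[OF F f] is_functorD(2)[OF F g]]
    by simp
qed (use is_functorD(1-3)[OF F] is_functorD(1-3)[OF G] in auto)

text \<open>
  A quasi-inverse is chosen on objects by essential surjectivity; full faithfulness then transports
  arrows along the chosen isomorphisms.
\<close>

lemma equivalent_categoriesI:
  assumes "category A" and "category B" and F: "is_functor A B F"
    and ff: "\<And>a a' g. a \<in> Obj A \<Longrightarrow> a' \<in> Obj A \<Longrightarrow> g \<in> hom B (FObj F a) (FObj F a') \<Longrightarrow>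
      \<exists>!f. f \<in> hom A a a' \<and> FArr F f = g"
    and es: "\<And>b. b \<in> Obj B \<Longrightarrow> \<exists>a\<in>Obj A. \<exists>e\<in>hom B (FObj F a) b. iso B e"
  shows "equivalent_categories A B"
proof -
  interpret A: category A by fact
  interpret B: category B by fact
  note F_hom = is_functorD(2)[OF F] and F_Idn = is_functorD(3)[OF F] and F_Cmp = is_functorD(4)[OF F]
    and F_Obj = is_functorD(1)[OF F]
  have "\<forall>b\<in>Obj B. \<exists>a e e'. a \<in> Obj A \<and> e \<in> hom B (FObj F a) b \<and> e' \<in> hom B b (FObj F a) \<and>
      Cmp B e' e = Idn B (FObj F a) \<and> Cmp B e e' = Idn B b"
    using es by (metis B.isoE)
  then obtain R e e' where
    R: "\<And>b. b \<in> Obj B \<Longrightarrow> R b \<in> Obj A" and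
    e: "\<And>b. b \<in> Obj B \<Longrightarrow> e b \<in> hom B (FObj F (R b)) b" and
    e': "\<And>b. b \<in> Obj B \<Longrightarrow> e' b \<in> hom B b (FObj F (R b))" and
    ee: "\<And>b. b \<in> Obj B \<Longrightarrow> Cmp B (e' b) (e b) = Idn B (FObj F (R b))"
      "\<And>b. b \<in> Obj B \<Longrightarrow> Cmp B (e b) (e' b) = Idn B b"
    by metis
  define inv where "inv a a' g = (THE f. f \<in> hom A a a' \<and> FArr F f = g)" for a a' g
  have inv: "inv a a' g \<in> hom A a a'" "FArr F (inv a a' g) = g"
    if "a \<in> Obj A" "a' \<in> Obj A" "g \<in> hom B (FObj F a) (FObj F a')" for a a' g
    using theI'[OF ff[OF that]] unfolding inv_def by auto
  have faithful: "f = f'" if "f \<in> hom A a a'" "f' \<in> hom A a a'" "FArr F f = FArr F f'" for f f' a a'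
    using ff[OF A.hom_Obj[OF that(1)] F_hom[OF that(1)]] that by auto
  \<comment> \<open>Conjugation by the chosen isomorphisms turns \<open>g\<close> into an arrow in the image of \<open>F\<close>.\<close>
  define conj where "conj g = Cmp B (e' (Cod B g)) (Cmp B g (e (Dom B g)))" for g
  have conj: "conj g = Cmp B (e' b') (Cmp B g (e b))" "conj g \<in> hom B (FObj F (R b)) (FObj F (R b'))"
    if g: "g \<in> hom B b b'" for g b b'
    using B.hom_Obj[OF g] hom_Dom[OF g] hom_Cod[OF g] g
    by (auto simp: conj_def intro!: B.Cmp_hom[OF B.Cmp_hom] e e')
  define G where "G = \<lparr>FObj = R, FArr = \<lambda>g. inv (R (Dom B g)) (R (Cod B g)) (conj g)\<rparr>"
  have GO: "FObj G b = R b" for b by (simp add: G_def)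
  have G: "FArr G g \<in> hom A (R b) (R b')" "FArr F (FArr G g) = conj g" if g: "g \<in> hom B b b'" for g b b'
    using inv[OF R R conj(2)[OF g]] B.hom_Obj[OF g] hom_Dom[OF g] hom_Cod[OF g]
    by (auto simp: G_def)
  have G_functor: "is_functor B A G"
  proof (rule is_functorI, unfold GO)
    fix b assume b: "b \<in> Obj B"
    note i = B.Idn_hom[OF b]
    show "FArr G (Idn B b) = Idn A (R b)"
      using G[OF i] conj(1)[OF i] e[OF b] e'[OF b] ee[OF b] F_Idn[OF R[OF b]]
      by (intro faithful[OF _ A.Idn_hom[OF R[OF b]]]) (auto simp: B.Idn_Cmp)
  next
    fix f g a b c assume f: "f \<in> hom B a b" and g: "g \<in> hom B b c"
    note gf = B.Cmp_hom[OF f g] and a = B.hom_Obj(1)[OF f] and b = B.hom_Obj(2)[OF f]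
      and c = B.hom_Obj(2)[OF g]
    have fe: "Cmp B f (e a) \<in> hom B (FObj F (R a)) b"
      by (rule B.Cmp_hom[OF e[OF a] f])
    have "Cmp B (conj g) (conj f) = Cmp B (Cmp B (Cmp B (e' c) (Cmp B g (e b))) (e' b)) (Cmp B f (e a))"
      unfolding conj(1)[OF f] conj(1)[OF g]
      by (rule B.Cmp_assoc[symmetric, OF fe e'[OF b]]) (auto intro!: B.Cmp_hom[OF B.Cmp_hom] e e' g b c)
    also have "Cmp B (Cmp B (e' c) (Cmp B g (e b))) (e' b) = Cmp B (e' c) (Cmp B g (Cmp B (e b) (e' b)))"
      using B.Cmp_assoc[OF e'[OF b] B.Cmp_hom[OF e[OF b] g] e'[OF c]]
        B.Cmp_assoc[OF e'[OF b] e[OF b] g] by simp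
    also have "\<dots> = Cmp B (e' c) g"
      using ee(2)[OF b] B.Cmp_Idn[OF g] by simp
    also have "Cmp B (Cmp B (e' c) g) (Cmp B f (e a)) = Cmp B (e' c) (Cmp B (Cmp B g f) (e a))"
      using B.Cmp_assoc[OF fe g e'[OF c]] B.Cmp_assoc[OF e[OF a] f g] by simp
    finally have "conj (Cmp B g f) = Cmp B (conj g) (conj f)" by (simp add: conj(1)[OF gf])
    then show "FArr G (Cmp B g f) = Cmp A (FArr G g) (FArr G f)"
      using G[OF f] G[OF g] G[OF gf] F_Cmp[OF G(1)[OF f] G(1)[OF g]]
      by (intro faithful[OF _ A.Cmp_hom[OF G(1)[OF f] G(1)[OF g]]]) auto
  qed (use R G in auto)
  have counit: "nat_trans B B (comp_functor F G) id_functor e"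
  proof (rule nat_transI)
    fix g b b' assume g: "g \<in> hom B b b'"
    note b = B.hom_Obj[OF g]
    have ge: "Cmp B g (e b) \<in> hom B (FObj F (R b)) b'" by (rule B.Cmp_hom[OF e[OF b(1)] g])
    show "Cmp B (e b') (FArr (comp_functor F G) g) = Cmp B (FArr id_functor g) (e b)"
      using B.Cmp_assoc[OF ge e'[OF b(2)] e[OF b(2)]] ee(2)[OF b(2)] B.Idn_Cmp[OF ge]
      by (simp add: G(2)[OF g] conj(1)[OF g])
  qed (simp add: GO e)
  define u where "u a = inv a (R (FObj F a)) (e' (FObj F a))" for a
  define v where "v a = inv (R (FObj F a)) a (e (FObj F a))" for a
  have u: "u a \<in> hom A a (R (FObj F a))" "FArr F (u a) = e' (FObj F a)" if "a \<in> Obj A" for a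
    using inv[OF that R e'] that F_Obj by (auto simp: u_def)
  have v: "v a \<in> hom A (R (FObj F a)) a" "FArr F (v a) = e (FObj F a)" if "a \<in> Obj A" for a
    using inv[OF R that e] that F_Obj by (auto simp: v_def)
  have unit: "nat_trans A A id_functor (comp_functor G F) u"
  proof (rule nat_transI)
    fix f a b assume f: "f \<in> hom A a b"
    note ab = A.hom_Obj[OF f] and Ff = F_hom[OF f]
    note Fab = F_Obj[OF ab(1)] F_Obj[OF ab(2)]
    have "Cmp B (conj (FArr F f)) (e' (FObj F a)) = Cmp B (e' (FObj F b)) (FArr F f)"
      using B.Cmp_assoc[OF e'[OF Fab(1)] B.Cmp_hom[OF e[OF Fab(1)] Ff] e'[OF Fab(2)]]
        B.Cmp_assoc[OF e'[OF Fab(1)] e[OF Fab(1)] Ff] ee(2)[OF Fab(1)] B.Cmp_Idn[OF Ff]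
      by (simp add: conj(1)[OF Ff])
    then have "Cmp A (u b) f = Cmp A (FArr G (FArr F f)) (u a)"
      using F_Cmp[OF f u(1)[OF ab(2)]] F_Cmp[OF u(1)[OF ab(1)] G(1)[OF Ff]] u(2) ab G(2)[OF Ff]
      by (intro faithful[OF A.Cmp_hom[OF f u(1)[OF ab(2)]] A.Cmp_hom[OF u(1)[OF ab(1)] G(1)[OF Ff]]])
        auto
    then show "Cmp A (u b) (FArr id_functor f) = Cmp A (FArr (comp_functor G F) f) (u a)"
      by simp
  qed (simp add: GO u)
  have "iso A (u a)" if a: "a \<in> Obj A" for a
    using F_Cmp[OF u(1)[OF a] v(1)[OF a]] F_Cmp[OF v(1)[OF a] u(1)[OF a]] u v a ee[OF F_Obj[OF a]]
      F_Idn[OF a] F_Idn[OF R[OF F_Obj[OF a]]]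
    by (intro A.isoI[OF u(1)[OF a] v(1)[OF a]]
        faithful[OF A.Cmp_hom[OF u(1)[OF a] v(1)[OF a]] A.Idn_hom]
        faithful[OF A.Cmp_hom[OF v(1)[OF a] u(1)[OF a]] A.Idn_hom]) (auto intro: R F_Obj)
  moreover have "iso B (e b)" if "b \<in> Obj B" for b
    by (rule B.isoI[OF e e']) (use that ee in auto)
  ultimately show ?thesis
    unfolding equivalent_categories_def naturally_isomorphic_def
    using assms(1,2) F G_functor unit counit by blast
qed

section \<open>Models and their homomorphisms, elementwise\<close>

lemma is_productD:
  assumes "is_product C I A P pr" and "Q \<in> Obj C" and "\<forall>i\<in>I. q i \<in> hom C Q (A i)"
  shows "\<exists>!h. h \<in> hom C Q P \<and> (\<forall>i\<in>I. Cmp C (pr i) h = q i)"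
  using assms(1)[unfolded is_product_def, THEN conjunct2, THEN conjunct2, rule_format, OF assms(2)]
    assms(3) by blast

lemma Set_cat_simps [simp]:
  "Obj (Set_cat U) = {A. small U A}" "Idn (Set_cat U) A = (A, A, \<lambda>x\<in>A. x)"
  "Cmp (Set_cat U) (B, C, g) (A, B', f) = (A, C, compose A g f)"
  by (auto simp: Set_cat_def)

lemma hom_Set_cat:
  "h \<in> hom (Set_cat U) A B \<longleftrightarrow>
     small U A \<and> small U B \<and> (\<exists>f. h = (A, B, f) \<and> f \<in> A \<rightarrow>\<^sub>E B)"
  by (auto simp: Set_cat_def hom_def)

lemma category_Set_cat: "category (Set_cat U)"
proof
  fix f assume "f \<in> Arr (Set_cat U)"
  then show "Dom (Set_cat U) f \<in> Obj (Set_cat U)" "Cod (Set_cat U) f \<in> Obj (Set_cat U)"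
    by (auto simp: Set_cat_def)
next
  fix f g h A B C D assume "f \<in> hom (Set_cat U) A B" "g \<in> hom (Set_cat U) B C"
    "h \<in> hom (Set_cat U) C D"
  then show "Cmp (Set_cat U) (Cmp (Set_cat U) h g) f = Cmp (Set_cat U) h (Cmp (Set_cat U) g f)"
    by (auto simp: hom_Set_cat compose_def PiE_iff intro!: restrict_ext)
qed (auto simp: hom_Set_cat compose_def PiE_iff intro!: extensionalityI)

text \<open>
  Arrows of \<open>Set_cat\<close> carry their domain and codomain; the following are the bare functions
  underlying the value of a functor at an arrow and the component of a transformation at an object.
\<close>

definition ap :: "('o, 'a, 'u set, 'u set_arr) fnctr \<Rightarrow> 'a \<Rightarrow> 'u \<Rightarrow> 'u" where
  "ap M k = snd (snd (FArr M k))"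

definition app :: "('o, 'a, 'u set, 'u set_arr) nt \<Rightarrow> 'o \<Rightarrow> 'u \<Rightarrow> 'u" where
  "app t a = snd (snd (snd (snd t) a))"

text \<open>
  This says that the functions \<open>p i\<close> exhibit \<open>P\<close> as the power of the set \<open>B\<close> with exponent \<open>I\<close>.
\<close>

definition unique_tuples :: "'i set \<Rightarrow> 'z set \<Rightarrow> 'y set \<Rightarrow> ('i \<Rightarrow> 'y \<Rightarrow> 'z) \<Rightarrow> bool" where
  "unique_tuples I B P p \<longleftrightarrow> (\<forall>x. (\<forall>i\<in>I. x i \<in> B) \<longrightarrow> (\<exists>!m. m \<in> P \<and> (\<forall>i\<in>I. p i m = x i)))"

lemma unique_tuples_cong:
  "B = B' \<Longrightarrow> P = P' \<Longrightarrow> (\<And>i m. i \<in> I \<Longrightarrow> m \<in> P' \<Longrightarrow> p i m = p' i m) \<Longrightarrow>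
    unique_tuples I B P p = unique_tuples I B' P' p'"
  by (simp add: unique_tuples_def cong: conj_cong)

lemma unique_tuplesE:
  assumes "unique_tuples I B P p" and "\<And>i. i \<in> I \<Longrightarrow> x i \<in> B"
  obtains m where "m \<in> P" "\<And>i. i \<in> I \<Longrightarrow> p i m = x i"
  using assms unfolding unique_tuples_def by metis

lemma unique_tuples_eqI:
  assumes "unique_tuples I B P p" and "m \<in> P" "m' \<in> P"
    and "\<And>i. i \<in> I \<Longrightarrow> p i m \<in> B" and "\<And>i. i \<in> I \<Longrightarrow> p i m = p i m'"
  shows "m = m'"
proof -
  have "\<exists>!n. n \<in> P \<and> (\<forall>i\<in>I. p i n = p i m)"
    using assms(1,4) unfolding unique_tuples_def by simp
  then show ?thesis using assms(2,3,5) by (metis (full_types))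
qed

context small_universe
begin

text \<open>
  Elements are arrows out of a one-point set, so testing the universal property on one point
  already gives unique tuples; in the other direction a mediating arrow is assembled pointwise.
\<close>

lemma product_Set_cat_iff:
  assumes P: "small U P" and B: "small U B"
    and pr: "\<And>i. i \<in> I \<Longrightarrow> pr i = (P, B, p i)" and p: "\<And>i. i \<in> I \<Longrightarrow> p i \<in> P \<rightarrow>\<^sub>E B"
  shows "is_product (Set_cat U) I (\<lambda>_. B) P pr \<longleftrightarrow> unique_tuples I B P p"
proof
  assume prod: "is_product (Set_cat U) I (\<lambda>_. B) P pr"
  show "unique_tuples I B P p" unfolding unique_tuples_def
  proof (intro allI impI)
    fix x assume x: "\<forall>i\<in>I. x i \<in> B"
    let ?Q = "{undefined :: 'u}"
    have Q: "?Q \<in> Obj (Set_cat U)" by (simp add: small_finite)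
    have "\<forall>i\<in>I. (?Q, B, \<lambda>_\<in>?Q. x i) \<in> hom (Set_cat U) ?Q B"
      using x B by (auto simp: hom_Set_cat small_finite)
    then have ex1: "\<exists>!h. h \<in> hom (Set_cat U) ?Q P \<and>
        (\<forall>i\<in>I. Cmp (Set_cat U) (pr i) h = (?Q, B, \<lambda>_\<in>?Q. x i))"
      by (rule is_productD[OF prod Q])
    have pt: "(?Q, P, \<lambda>_\<in>?Q. m) \<in> hom (Set_cat U) ?Q P \<and>
        (\<forall>i\<in>I. Cmp (Set_cat U) (pr i) (?Q, P, \<lambda>_\<in>?Q. m) = (?Q, B, \<lambda>_\<in>?Q. x i))"
      if "m \<in> P" "\<forall>i\<in>I. p i m = x i" for m
      using that P by (auto simp: hom_Set_cat small_finite pr compose_def intro!: restrict_ext)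
    show "\<exists>!m. m \<in> P \<and> (\<forall>i\<in>I. p i m = x i)"
    proof (rule ex_ex1I)
      from ex1 obtain h where h: "h \<in> hom (Set_cat U) ?Q P"
        "\<forall>i\<in>I. Cmp (Set_cat U) (pr i) h = (?Q, B, \<lambda>_\<in>?Q. x i)" by blast
      then obtain f where f: "h = (?Q, P, f)" "f \<in> ?Q \<rightarrow>\<^sub>E P" by (auto simp: hom_Set_cat)
      have "p i (f undefined) = x i" if "i \<in> I" for i
        using h(2) that by (auto simp: f(1) pr compose_def dest!: fun_cong[of _ _ undefined])
      then show "\<exists>m. m \<in> P \<and> (\<forall>i\<in>I. p i m = x i)" using f(2) by auto
    next
      fix m m' assume "m \<in> P \<and> (\<forall>i\<in>I. p i m = x i)" "m' \<in> P \<and> (\<forall>i\<in>I. p i m' = x i)"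
      then have "(?Q, P, \<lambda>_\<in>?Q. m) = (?Q, P, \<lambda>_\<in>?Q. m')"
        using ex1 pt[of m] pt[of m'] by blast
      then show "m = m'" by (auto dest!: fun_cong[of _ _ undefined])
    qed
  qed
next
  assume tup: "unique_tuples I B P p"
  show "is_product (Set_cat U) I (\<lambda>_. B) P pr"
    unfolding is_product_def
  proof (intro conjI ballI allI impI)
    fix Q q assume Q: "Q \<in> Obj (Set_cat U)" and q: "\<forall>i\<in>I. q i \<in> hom (Set_cat U) Q B"
    define q' where "q' i = snd (snd (q i))" for i
    have q': "q i = (Q, B, q' i)" "q' i \<in> Q \<rightarrow>\<^sub>E B" if "i \<in> I" for i
      using bspec[OF q that] by (auto simp: hom_Set_cat q'_def)
    have ex1: "\<exists>!m. m \<in> P \<and> (\<forall>i\<in>I. p i m = q' i z)" if "z \<in> Q" for z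
      using tup q' that unfolding unique_tuples_def by (auto simp: PiE_iff)
    define h where "h = (\<lambda>z\<in>Q. THE m. m \<in> P \<and> (\<forall>i\<in>I. p i m = q' i z))"
    have h: "h z \<in> P" "\<And>i. i \<in> I \<Longrightarrow> p i (h z) = q' i z" if "z \<in> Q" for z
      using theI'[OF ex1[OF that]] that by (auto simp: h_def)
    show "\<exists>!h. h \<in> hom (Set_cat U) Q P \<and> (\<forall>i\<in>I. Cmp (Set_cat U) (pr i) h = q i)"
    proof (rule ex1I[of _ "(Q, P, h)"])
      have "compose Q (p i) h = q' i" if "i \<in> I" for i
        by (rule extensionalityI[of _ Q]) (use h q' that in \<open>auto simp: compose_def PiE_iff\<close>)
      then show "(Q, P, h) \<in> hom (Set_cat U) Q P \<and>
          (\<forall>i\<in>I. Cmp (Set_cat U) (pr i) (Q, P, h) = q i)"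
        using Q P h(1) q' by (auto simp: hom_Set_cat pr) (simp add: h_def)
    next
      fix g assume g: "g \<in> hom (Set_cat U) Q P \<and> (\<forall>i\<in>I. Cmp (Set_cat U) (pr i) g = q i)"
      then obtain f where f: "g = (Q, P, f)" "f \<in> Q \<rightarrow>\<^sub>E P" by (auto simp: hom_Set_cat)
      have "f z = h z" if z: "z \<in> Q" for z
      proof -
        have "p i (f z) = q' i z" if "i \<in> I" for i
        proof -
          have "compose Q (p i) f = q' i" using g q'(1)[OF that] that by (auto simp: f(1) pr)
          then show ?thesis using z by (metis compose_eq)
        qed
        then show ?thesis using ex1[OF z] h[OF z] f(2) z by blast
      qed
      moreover have "h \<in> extensional Q" by (simp add: h_def)
      ultimately show "g = (Q, P, h)" using f by (auto intro!: extensionalityI[of _ Q] simp: PiE_iff)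
    qed
  qed (use P B pr p in \<open>auto simp: hom_Set_cat\<close>)
qed

end

locale lawvere_theory = small_universe U + infinitary_Lawvere_theory U L X
  for U :: "'u itself" and L :: "('o, 'a) cat" and X :: 'o
begin

abbreviation Md where "Md \<equiv> Mod U L X"

text \<open>
  The elements of a model constructed below are arrows, or families of elements of other models,
  hence not of the type \<open>'u\<close>. The following predicate describes models whose underlying sets are
  of any type; \<open>realize\<close> transports them to \<open>'u\<close>.
\<close>

definition set_model :: "('o \<Rightarrow> 'z set) \<Rightarrow> ('a \<Rightarrow> 'z \<Rightarrow> 'z) \<Rightarrow> bool" where
  "set_model A act \<longleftrightarrow>
     (\<forall>a\<in>Obj L. small U (A a)) \<and>
     (\<forall>a b k z. k \<in> hom L a b \<longrightarrow> z \<in> A a \<longrightarrow> act k z \<in> A b) \<and>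
     (\<forall>a z. a \<in> Obj L \<longrightarrow> z \<in> A a \<longrightarrow> act (Idn L a) z = z) \<and>
     (\<forall>a b c k l z. k \<in> hom L a b \<longrightarrow> l \<in> hom L b c \<longrightarrow> z \<in> A a \<longrightarrow>
        act (Cmp L l k) z = act l (act k z)) \<and>
     (\<forall>(I :: 'u set) P pr. small U I \<longrightarrow> is_product L I (\<lambda>_. X) P pr \<longrightarrow>
        unique_tuples I (A X) (A P) (\<lambda>i. act (pr i)))"

lemma set_modelD:
  assumes "set_model A act"
  shows "a \<in> Obj L \<Longrightarrow> small U (A a)"
    and "k \<in> hom L a b \<Longrightarrow> z \<in> A a \<Longrightarrow> act k z \<in> A b"
    and "a \<in> Obj L \<Longrightarrow> z \<in> A a \<Longrightarrow> act (Idn L a) z = z"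
    and "k \<in> hom L a b \<Longrightarrow> l \<in> hom L b c \<Longrightarrow> z \<in> A a \<Longrightarrow> act (Cmp L l k) z = act l (act k z)"
    and "small U (I :: 'u set) \<Longrightarrow> is_product L I (\<lambda>_. X) P pr \<Longrightarrow>
      unique_tuples I (A X) (A P) (\<lambda>i. act (pr i))"
  using assms unfolding set_model_def by blast+

definition nat_map :: "('o \<Rightarrow> 'z set) \<Rightarrow> ('a \<Rightarrow> 'z \<Rightarrow> 'z) \<Rightarrow> ('o \<Rightarrow> 'y set) \<Rightarrow> ('a \<Rightarrow> 'y \<Rightarrow> 'y) \<Rightarrow>
    ('o \<Rightarrow> 'z \<Rightarrow> 'y) \<Rightarrow> bool" where
  "nat_map A act B act' t \<longleftrightarrow>
     (\<forall>a z. a \<in> Obj L \<longrightarrow> z \<in> A a \<longrightarrow> t a z \<in> B a) \<and>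
     (\<forall>a b k z. k \<in> hom L a b \<longrightarrow> z \<in> A a \<longrightarrow> t b (act k z) = act' k (t a z))"

definition mk_model :: "('o \<Rightarrow> 'u set) \<Rightarrow> ('a \<Rightarrow> 'u \<Rightarrow> 'u) \<Rightarrow> ('o, 'a, 'u set, 'u set_arr) fnctr" where
  "mk_model A act = \<lparr>FObj = (\<lambda>a\<in>Obj L. A a),
     FArr = (\<lambda>k\<in>Arr L. (A (Dom L k), A (Cod L k), \<lambda>z\<in>A (Dom L k). act k z))\<rparr>"

definition mk_arr :: "('o, 'a, 'u set, 'u set_arr) fnctr \<Rightarrow> ('o, 'a, 'u set, 'u set_arr) fnctr \<Rightarrow>
    ('o \<Rightarrow> 'u \<Rightarrow> 'u) \<Rightarrow> ('o, 'a, 'u set, 'u set_arr) nt" where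
  "mk_arr M N t = (M, N, \<lambda>a\<in>Obj L. (FObj M a, FObj N a, \<lambda>z\<in>FObj M a. t a z))"

lemma Md_simps [simp]:
  "Dom Md (M, N, t) = M" "Cod Md (M, N, t) = N"
  "Idn Md M = (M, M, \<lambda>a\<in>Obj L. Idn (Set_cat U) (FObj M a))"
  "Cmp Md (N', K, s) (M, N, t) = (M, K, \<lambda>a\<in>Obj L. Cmp (Set_cat U) (s a) (t a))"
  by (auto simp: Mod_def functor_category_simps)

lemma category_Mod: "category Md"
  unfolding Mod_def
  by (intro category_full_subcategory category_functor_category category_Set_cat category_axioms)

sublocale Md: category Md by (rule category_Mod)

lemma is_model_iff:
  assumes M: "is_functor L (Set_cat U) M"
  shows "is_model U L X M \<longleftrightarrow> (\<forall>(I :: 'u set) P pr. small U I \<longrightarrow> is_product L I (\<lambda>_. X) P pr \<longrightarrow>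
    unique_tuples I (FObj M X) (FObj M P) (\<lambda>i. ap M (pr i)))"
proof -
  have "is_product (Set_cat U) I (\<lambda>_. FObj M X) (FObj M P) (\<lambda>i. FArr M (pr i)) \<longleftrightarrow>
      unique_tuples I (FObj M X) (FObj M P) (\<lambda>i. ap M (pr i))"
    if P: "is_product L I (\<lambda>_. X) P pr" for I :: "'u set" and P pr
  proof (rule product_Set_cat_iff)
    show "small U (FObj M P)" "small U (FObj M X)"
      using is_functorD(1)[OF M] P X_Obj by (auto simp: is_product_def)
    fix i assume "i \<in> I"
    then have "pr i \<in> hom L P X" using P by (simp add: is_product_def)
    from is_functorD(2)[OF M this]
    show "FArr M (pr i) = (FObj M P, FObj M X, ap M (pr i))"
      "ap M (pr i) \<in> FObj M P \<rightarrow>\<^sub>E FObj M X"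
      by (auto simp: hom_Set_cat ap_def)
  qed
  then show ?thesis unfolding is_model_def by (simp add: imp_conjL)
qed

lemma Mod_Obj_iff: "M \<in> Obj Md \<longleftrightarrow> M \<in> functor_objects L (Set_cat U) \<and> set_model (FObj M) (ap M)"
proof -
  have "set_model (FObj M) (ap M) \<longleftrightarrow> is_model U L X M"
    if "M \<in> functor_objects L (Set_cat U)"
  proof -
    have M: "is_functor L (Set_cat U) M" by (rule is_functor_object[OF that])
    have k: "FArr M k = (FObj M a, FObj M b, ap M k) \<and> ap M k \<in> FObj M a \<rightarrow>\<^sub>E FObj M b"
      if "k \<in> hom L a b" for k a b
      using is_functorD(2)[OF M that] by (auto simp: hom_Set_cat ap_def)
    show ?thesis
    proof
      assume "is_model U L X M"
      then show "set_model (FObj M) (ap M)"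
        unfolding set_model_def
      proof (intro conjI ballI allI impI)
        fix a assume "a \<in> Obj L"
        then show "small U (FObj M a)" using is_functorD(1)[OF M] by simp
      next
        fix a b l z assume "l \<in> hom L a b" "z \<in> FObj M a"
        then show "ap M l z \<in> FObj M b" using k[of l a b] by auto
      next
        fix a z assume "a \<in> Obj L" "z \<in> FObj M a"
        then show "ap M (Idn L a) z = z" using is_functorD(3)[OF M] by (simp add: ap_def)
      next
        fix h l a b c z assume hl: "h \<in> hom L a b" "l \<in> hom L b c" and z: "z \<in> FObj M a"
        show "ap M (Cmp L l h) z = ap M l (ap M h z)"
          using is_functorD(4)[OF M hl] k[OF hl(1)] k[OF hl(2)] k[OF Cmp_hom[OF hl]] z
          by (simp add: compose_def)
      qed (simp add: is_model_iff[OF M])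
    next
      assume "set_model (FObj M) (ap M)"
      from set_modelD(5)[OF this] show "is_model U L X M" by (simp add: is_model_iff[OF M])
    qed
  qed
  then show ?thesis by (auto simp: Mod_def functor_category_simps)
qed

lemmas Mod_set_model = Mod_Obj_iff[THEN iffD1, THEN conjunct2]

lemmas model_small = set_modelD(1)[OF Mod_set_model]
  and model_ap = set_modelD(2)[OF Mod_set_model]
  and model_Idn = set_modelD(3)[OF Mod_set_model]
  and model_Cmp = set_modelD(4)[OF Mod_set_model]
  and model_tuples = set_modelD(5)[OF Mod_set_model]

lemma model_FArr:
  assumes "k \<in> hom L a b" and "M \<in> Obj Md"
  shows "FArr M k = (FObj M a, FObj M b, ap M k) \<and> ap M k \<in> FObj M a \<rightarrow>\<^sub>E FObj M b"
  using is_functorD(2)[OF is_functor_object assms(1), of M "Set_cat U"] assms(2)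
  by (auto simp: hom_Set_cat ap_def Mod_Obj_iff)

lemma mk_model_simps [simp]:
  "a \<in> Obj L \<Longrightarrow> FObj (mk_model A act) a = A a"
  "k \<in> hom L a b \<Longrightarrow> z \<in> A a \<Longrightarrow> ap (mk_model A act) k z = act k z"
  by (auto simp: mk_model_def ap_def hom_def)

lemma mk_model_Obj:
  assumes m: "set_model A act" shows "mk_model A act \<in> Obj Md"
  unfolding Mod_Obj_iff
proof
  note d = set_modelD[OF m]
  have F: "FArr (mk_model A act) k = (A a, A b, \<lambda>z\<in>A a. act k z)" if "k \<in> hom L a b" for k a b
    using that by (auto simp: mk_model_def hom_def)
  show "mk_model A act \<in> functor_objects L (Set_cat U)"
  proof (rule functor_objectsI)
    show "is_functor L (Set_cat U) (mk_model A act)"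
    proof (rule is_functorI)
      fix k a b assume k: "k \<in> hom L a b"
      show "FArr (mk_model A act) k \<in>
          hom (Set_cat U) (FObj (mk_model A act) a) (FObj (mk_model A act) b)"
        using d(1,2) k hom_Obj[OF k] by (auto simp: hom_Set_cat F)
    next
      fix a assume a: "a \<in> Obj L"
      show "FArr (mk_model A act) (Idn L a) = Idn (Set_cat U) (FObj (mk_model A act) a)"
        using d(3)[OF a] a by (auto simp: F[OF Idn_hom[OF a]] intro!: restrict_ext)
    next
      fix k l a b c assume kl: "k \<in> hom L a b" "l \<in> hom L b c"
      show "FArr (mk_model A act) (Cmp L l k) =
          Cmp (Set_cat U) (FArr (mk_model A act) l) (FArr (mk_model A act) k)"
        using d(4)[OF kl] d(2)[OF kl(1)]
        by (auto simp: F[OF Cmp_hom[OF kl]] F[OF kl(1)] F[OF kl(2)] compose_def intro!: restrict_ext)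
    qed (use d(1) in simp)
  qed (auto simp: mk_model_def)
  have eq: "ap (mk_model A act) k z = act k z" "FObj (mk_model A act) a = A a"
      "FObj (mk_model A act) b = A b"
    if "k \<in> hom L a b" "z \<in> A a" for k a b z
    using that hom_Obj[OF that(1)] by auto
  show "set_model (FObj (mk_model A act)) (ap (mk_model A act))"
    unfolding set_model_def
  proof (intro conjI allI impI ballI)
    fix k l a b c z assume kl: "k \<in> hom L a b" "l \<in> hom L b c" "z \<in> FObj (mk_model A act) a"
    then have z: "z \<in> A a" using hom_Obj by auto
    show "ap (mk_model A act) (Cmp L l k) z = ap (mk_model A act) l (ap (mk_model A act) k z)"
      using kl z d(4)[OF kl(1,2) z] d(2)[OF kl(1) z] eq(1)[OF Cmp_hom[OF kl(1,2)] z]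
        eq(1)[OF kl(1) z] eq(1)[OF kl(2) d(2)[OF kl(1) z]] by simp
  next
    fix I :: "'u set" and P pr assume I: "small U I" and P: "is_product L I (\<lambda>_. X) P pr"
    then have "P \<in> Obj L" and pr: "\<And>i. i \<in> I \<Longrightarrow> pr i \<in> hom L P X"
      by (auto simp: is_product_def)
    then show "unique_tuples I (FObj (mk_model A act) X) (FObj (mk_model A act) P)
        (\<lambda>i. ap (mk_model A act) (pr i))"
      using d(5)[OF I P] X_Obj eq(1)[OF pr]
      by (subst unique_tuples_cong[of _ "A X" _ "A P" _ _ "\<lambda>i. act (pr i)"]) auto
  qed (use d(1-3) hom_Obj in \<open>auto simp: eq eq(1)[OF Idn_hom]\<close>)
qed

lemma Mod_homE:
  assumes "t \<in> hom Md M N"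
  shows "M \<in> Obj Md" "N \<in> Obj Md" "nat_map (FObj M) (ap M) (FObj N) (ap N) (app t)"
    "t = mk_arr M N (app t)"
proof -
  show M: "M \<in> Obj Md" and N: "N \<in> Obj Md" using Md.hom_Obj[OF assms] by auto
  obtain s where t: "t = (M, N, s)" and s: "nat_trans L (Set_cat U) M N s" "s \<in> extensional (Obj L)"
    using assms by (auto simp: Mod_def hom_full_subcategory_iff hom_functor_category)
  have sa: "s a = (FObj M a, FObj N a, app t a) \<and> app t a \<in> FObj M a \<rightarrow>\<^sub>E FObj N a" if "a \<in> Obj L" for a
    using nat_transD(1)[OF s(1) that] by (auto simp: t app_def hom_Set_cat)
  show "nat_map (FObj M) (ap M) (FObj N) (ap N) (app t)"
    unfolding nat_map_def
  proof (intro conjI allI impI)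
    fix a b k z assume k: "k \<in> hom L a b" and z: "z \<in> FObj M a"
    have "compose (FObj M a) (app t b) (ap M k) = compose (FObj M a) (ap N k) (app t a)"
      using nat_transD(2)[OF s(1) k] sa[OF hom_Obj(1)[OF k]] sa[OF hom_Obj(2)[OF k]]
        model_FArr[OF k M] model_FArr[OF k N] by simp
    then show "app t b (ap M k z) = ap N k (app t a z)" using z by (metis compose_eq)
  qed (use sa in auto)
  show "t = mk_arr M N (app t)"
    using sa s(2) by (auto simp: mk_arr_def t intro!: extensionalityI[of _ "Obj L"]) 
      (metis PiE_restrict)
qed

lemma mk_arr_hom:
  assumes M: "M \<in> Obj Md" and N: "N \<in> Obj Md"
    and t: "nat_map (FObj M) (ap M) (FObj N) (ap N) t"
  shows "mk_arr M N t \<in> hom Md M N"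
proof -
  have "nat_trans L (Set_cat U) M N (\<lambda>a. (FObj M a, FObj N a, \<lambda>z\<in>FObj M a. t a z))"
  proof (rule nat_transI)
    fix k a b assume k: "k \<in> hom L a b"
    show "Cmp (Set_cat U) (FObj M b, FObj N b, restrict (t b) (FObj M b)) (FArr M k) =
        Cmp (Set_cat U) (FArr N k) (FObj M a, FObj N a, restrict (t a) (FObj M a))"
      using model_FArr[OF k M] model_FArr[OF k N] t k unfolding nat_map_def
      by (auto simp: compose_def intro!: restrict_ext)
  qed (use t model_small[OF M] model_small[OF N] in \<open>auto simp: nat_map_def hom_Set_cat\<close>)
  then show ?thesis
    using M N nat_trans_restrict[OF category_axioms]
    by (auto simp: mk_arr_def Mod_def hom_full_subcategory_iff hom_functor_category
        functor_category_simps)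
qed

lemma app_mk_arr: "a \<in> Obj L \<Longrightarrow> z \<in> FObj M a \<Longrightarrow> app (mk_arr M N t) a z = t a z"
  by (simp add: app_def mk_arr_def)

lemma Mod_hom_app:
  assumes "t \<in> hom Md M N"
  shows "a \<in> Obj L \<Longrightarrow> z \<in> FObj M a \<Longrightarrow> app t a z \<in> FObj N a"
    and "k \<in> hom L a b \<Longrightarrow> z \<in> FObj M a \<Longrightarrow> app t b (ap M k z) = ap N k (app t a z)"
  using Mod_homE(3)[OF assms] unfolding nat_map_def by blast+

lemma Mod_hom_eqI:
  assumes t: "t \<in> hom Md M N" and s: "s \<in> hom Md M N"
    and eq: "\<And>a z. a \<in> Obj L \<Longrightarrow> z \<in> FObj M a \<Longrightarrow> app t a z = app s a z"
  shows "t = s"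
proof -
  have "mk_arr M N (app t) = mk_arr M N (app s)"
    by (auto simp: mk_arr_def eq intro!: restrict_ext)
  then show ?thesis using Mod_homE(4)[OF t] Mod_homE(4)[OF s] by simp
qed

lemma app_Idn: "M \<in> Obj Md \<Longrightarrow> a \<in> Obj L \<Longrightarrow> z \<in> FObj M a \<Longrightarrow> app (Idn Md M) a z = z"
  by (simp add: app_def)

lemma app_Cmp:
  assumes t: "t \<in> hom Md M N" and s: "s \<in> hom Md N K" and z: "a \<in> Obj L" "z \<in> FObj M a"
  shows "app (Cmp Md s t) a z = app s a (app t a z)"
proof -
  have "app (Cmp Md (mk_arr N K (app s)) (mk_arr M N (app t))) a z = app s a (app t a z)"
    using z Mod_hom_app(1)[OF t z] by (simp add: app_def[of "(_, _)"] mk_arr_def compose_def)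
  then show ?thesis using Mod_homE(4)[OF t] Mod_homE(4)[OF s] by simp
qed

end

section \<open>Powers\<close>

lemma is_productI:
  assumes "P \<in> Obj C" and "\<And>i. i \<in> I \<Longrightarrow> pr i \<in> hom C P (A i)"
    and "\<And>Q q. Q \<in> Obj C \<Longrightarrow> (\<And>i. i \<in> I \<Longrightarrow> q i \<in> hom C Q (A i)) \<Longrightarrow>
      \<exists>h. h \<in> hom C Q P \<and> (\<forall>i\<in>I. Cmp C (pr i) h = q i)"
    and "\<And>Q h h'. h \<in> hom C Q P \<Longrightarrow> h' \<in> hom C Q P \<Longrightarrow>
      (\<And>i. i \<in> I \<Longrightarrow> Cmp C (pr i) h = Cmp C (pr i) h') \<Longrightarrow> h = h'"
  shows "is_product C I A P pr"
  unfolding is_product_def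
proof (intro conjI ballI allI impI)
  fix Q q assume "Q \<in> Obj C" and q: "\<forall>i\<in>I. q i \<in> hom C Q (A i)"
  then obtain h where h: "h \<in> hom C Q P" "\<forall>i\<in>I. Cmp C (pr i) h = q i" using assms(3)[of Q q] by auto
  show "\<exists>!h. h \<in> hom C Q P \<and> (\<forall>i\<in>I. Cmp C (pr i) h = q i)"
    by (rule ex1I[of _ h]) (use h in \<open>auto intro: assms(4)\<close>)
qed (use assms(1,2) in auto)

lemma is_product_Obj: "is_product C I A P pr \<Longrightarrow> P \<in> Obj C"
  and is_product_proj: "is_product C I A P pr \<Longrightarrow> i \<in> I \<Longrightarrow> pr i \<in> hom C P (A i)"
  by (auto simp: is_product_def)

lemma is_product_tuple:
  assumes "is_product C I A P pr" and "Q \<in> Obj C" and "\<And>i. i \<in> I \<Longrightarrow> q i \<in> hom C Q (A i)"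
  obtains h where "h \<in> hom C Q P" "\<And>i. i \<in> I \<Longrightarrow> Cmp C (pr i) h = q i"
  using is_productD[OF assms(1,2), of q] assms(3) by blast

lemma (in category) is_product_eqI:
  assumes P: "is_product C I A P pr" and h: "h \<in> hom C Q P" and h': "h' \<in> hom C Q P"
    and eq: "\<And>i. i \<in> I \<Longrightarrow> Cmp C (pr i) h = Cmp C (pr i) h'"
  shows "h = h'"
proof -
  have "\<forall>i\<in>I. Cmp C (pr i) h \<in> hom C Q (A i)"
    using Cmp_hom[OF h is_product_proj[OF P]] by simp
  from is_productD[OF P hom_Obj(1)[OF h] this] show ?thesis using h h' eq by (metis (full_types))
qed

lemma (in category) is_product_reindex:
  assumes e: "bij_betw e S I" and P: "is_product C I (\<lambda>_. B) P pr"
  shows "is_product C S (\<lambda>_. B) P (\<lambda>s. pr (e s))"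
proof (rule is_productI)
  fix Q q assume Q: "Q \<in> Obj C" and q: "\<And>s. s \<in> S \<Longrightarrow> q s \<in> hom C Q B"
  have "q (inv_into S e i) \<in> hom C Q B" if "i \<in> I" for i
    using e that by (auto simp: bij_betw_def intro!: q inv_into_into)
  then obtain h where h: "h \<in> hom C Q P" "\<And>i. i \<in> I \<Longrightarrow> Cmp C (pr i) h = q (inv_into S e i)"
    using is_product_tuple[OF P Q, of "\<lambda>i. q (inv_into S e i)"] by blast
  then show "\<exists>h. h \<in> hom C Q P \<and> (\<forall>s\<in>S. Cmp C (pr (e s)) h = q s)"
    using e by (intro exI[of _ h]) (auto simp: bij_betw_def)
next
  fix Q h h' assume h: "h \<in> hom C Q P" "h' \<in> hom C Q P"
    and eq: "\<And>s. s \<in> S \<Longrightarrow> Cmp C (pr (e s)) h = Cmp C (pr (e s)) h'"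
  show "h = h'" by (rule is_product_eqI[OF P h]) (use eq e in \<open>auto simp: bij_betw_def\<close>)
qed (use is_product_Obj[OF P] is_product_proj[OF P] e in \<open>auto simp: bij_betw_def\<close>)

text \<open>
  This makes every object of a Lawvere theory literally a power of \<open>X\<close>, so that later
  arguments by coordinates do not have to carry an isomorphism along.
\<close>

lemma (in category) is_product_iso:
  assumes P: "is_product C I A P pr" and f: "f \<in> hom C a P" "iso C f"
  shows "is_product C I A a (\<lambda>i. Cmp C (pr i) f)"
proof -
  obtain g where g: "g \<in> hom C P a" "Cmp C g f = Idn C a" "Cmp C f g = Idn C P"
    using isoE[OF f(2,1)] by metis
  note pr = is_product_proj[OF P]
  show ?thesis
  proof (rule is_productI)
    fix Q q assume Q: "Q \<in> Obj C" and q: "\<And>i. i \<in> I \<Longrightarrow> q i \<in> hom C Q (A i)"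
    obtain h where h: "h \<in> hom C Q P" "\<And>i. i \<in> I \<Longrightarrow> Cmp C (pr i) h = q i"
      using is_product_tuple[OF P Q q] by blast
    have "Cmp C f (Cmp C g h) = h"
      using Cmp_assoc[OF h(1) g(1) f(1)] g(3) Idn_Cmp[OF h(1)] by simp
    then have "Cmp C (Cmp C (pr i) f) (Cmp C g h) = q i" if "i \<in> I" for i
      using Cmp_assoc[OF Cmp_hom[OF h(1) g(1)] f(1) pr[OF that]] h(2)[OF that] by simp
    then show "\<exists>h. h \<in> hom C Q a \<and> (\<forall>i\<in>I. Cmp C (Cmp C (pr i) f) h = q i)"
      using Cmp_hom[OF h(1) g(1)] by blast
  next
    fix Q h h' assume h: "h \<in> hom C Q a" "h' \<in> hom C Q a"
      and eq: "\<And>i. i \<in> I \<Longrightarrow> Cmp C (Cmp C (pr i) f) h = Cmp C (Cmp C (pr i) f) h'"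
    have "Cmp C f h = Cmp C f h'"
      by (rule is_product_eqI[OF P Cmp_hom[OF h(1) f(1)] Cmp_hom[OF h(2) f(1)]])
        (use eq Cmp_assoc[OF h(1) f(1) pr] Cmp_assoc[OF h(2) f(1) pr] in simp)
    then show "h = h'"
      using Cmp_assoc[OF h(1) f(1) g(1)] Cmp_assoc[OF h(2) f(1) g(1)] g(2)
        Idn_Cmp[OF h(1)] Idn_Cmp[OF h(2)] by simp
  qed (use hom_Obj[OF f(1)] Cmp_hom[OF f(1) pr] in auto)
qed

lemma unique_tuples_reindex:
  assumes e: "bij_betw e S I" and "unique_tuples I B P p"
  shows "unique_tuples S B P (\<lambda>s. p (e s))"
  unfolding unique_tuples_def
proof (intro allI impI)
  fix x assume x: "\<forall>s\<in>S. x s \<in> B"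
  have "\<forall>i\<in>I. x (inv_into S e i) \<in> B"
    using e x by (auto simp: bij_betw_def intro: inv_into_into)
  then have "\<exists>!m. m \<in> P \<and> (\<forall>i\<in>I. p i m = x (inv_into S e i))"
    using assms(2) unfolding unique_tuples_def by simp
  moreover have "(\<forall>i\<in>I. p i m = x (inv_into S e i)) \<longleftrightarrow> (\<forall>s\<in>S. p (e s) m = x s)" for m
    using e by (auto simp: bij_betw_def)
  ultimately show "\<exists>!m. m \<in> P \<and> (\<forall>s\<in>S. p (e s) m = x s)" by simp
qed

context small_universe
begin

lemma bij_enc: "small U S \<Longrightarrow> bij_betw (enc S) S (enc S ` S)"
  by (simp add: bij_betw_def inj_enc)

lemma bij_dec: "small U S \<Longrightarrow> bij_betw (dec S) (enc S ` S) S"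
  unfolding dec_def by (intro bij_betw_the_inv_into bij_enc)

lemma enc_eq_iff: "small U S \<Longrightarrow> z \<in> S \<Longrightarrow> z' \<in> S \<Longrightarrow> enc S z = enc S z' \<longleftrightarrow> z = z'"
  using dec_enc by metis

end

context lawvere_theory
begin

text \<open>
  Powers exist for small index sets of any type, by reindexing along \<open>enc\<close>.
\<close>

lemma power_of_X:
  assumes "small U S"
  obtains P pr where "is_product L S (\<lambda>_. X) P pr"
  using power_exists[OF small_image[OF assms, of "enc S"]]
    is_product_reindex[OF bij_enc[OF assms]] by metis

lemma Obj_power:
  assumes "a \<in> Obj L"
  obtains I :: "'u set" and pr where "small U I" "is_product L I (\<lambda>_. X) a pr"
proof -
  obtain I :: "'u set" and P pr f where "small U I" "is_product L I (\<lambda>_. X) P pr"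
      "f \<in> hom L a P" "iso L f"
    using iso_power[OF assms] unfolding isomorphic_def by blast
  then show thesis using is_product_iso that by blast
qed

lemma set_model_tuples:
  assumes m: "set_model A act" and S: "small U S" and P: "is_product L S (\<lambda>_. X) P pr"
  shows "unique_tuples S (A X) (A P) (\<lambda>s. act (pr s))"
proof -
  have "unique_tuples (enc S ` S) (A X) (A P) (\<lambda>i. act (pr (dec S i)))"
    by (rule set_modelD(5)[OF m small_image[OF S] is_product_reindex[OF bij_dec[OF S] P]])
  from unique_tuples_reindex[OF bij_enc[OF S] this] show ?thesis
    by (rule unique_tuples_cong[THEN iffD1, rotated -1]) (simp_all add: dec_enc[OF S])
qed

lemma set_model_eqI:
  assumes m: "set_model A act" and S: "small U S" and P: "is_product L S (\<lambda>_. X) P pr"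
    and z: "z \<in> A P" "z' \<in> A P" and eq: "\<And>s. s \<in> S \<Longrightarrow> act (pr s) z = act (pr s) z'"
  shows "z = z'"
  by (rule unique_tuples_eqI[OF set_model_tuples[OF m S P] z])
    (use eq set_modelD(2)[OF m is_product_proj[OF P] z(1)] in auto)

section \<open>Realizing models in the universe\<close>

definition realize :: "('o \<Rightarrow> 'z set) \<Rightarrow> ('a \<Rightarrow> 'z \<Rightarrow> 'z) \<Rightarrow> ('o, 'a, 'u set, 'u set_arr) fnctr" where
  "realize A act = mk_model (\<lambda>a. enc (A a) ` A a)
     (\<lambda>k z. enc (A (Cod L k)) (act k (dec (A (Dom L k)) z)))"

lemma realize_simps:
  assumes "set_model A act"
  shows "a \<in> Obj L \<Longrightarrow> FObj (realize A act) a = enc (A a) ` A a"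
    and "k \<in> hom L a b \<Longrightarrow> z \<in> A a \<Longrightarrow> ap (realize A act) k (enc (A a) z) = enc (A b) (act k z)"
proof -
  assume k: "k \<in> hom L a b" and z: "z \<in> A a"
  show "ap (realize A act) k (enc (A a) z) = enc (A b) (act k z)"
    using z hom_Dom[OF k] hom_Cod[OF k] set_modelD(1)[OF assms hom_Obj(1)[OF k]]
    by (simp add: realize_def mk_model_simps(2)[OF k] dec_enc)
qed (simp add: realize_def)

lemma realize_Obj:
  assumes m: "set_model A act" shows "realize A act \<in> Obj Md"
  unfolding realize_def
proof (rule mk_model_Obj)
  note d = set_modelD[OF m]
  let ?act = "\<lambda>k z. enc (A (Cod L k)) (act k (dec (A (Dom L k)) z))"
  have act: "?act k (enc (A a) z) = enc (A b) (act k z)" if "k \<in> hom L a b" "z \<in> A a" for k a b z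
    using that hom_Obj[OF that(1)] d(1) by (simp add: hom_def dec_enc)
  show "set_model (\<lambda>a. enc (A a) ` A a) ?act"
    unfolding set_model_def
  proof (intro conjI ballI allI impI)
    fix I :: "'u set" and P pr assume I: "small U I" and P: "is_product L I (\<lambda>_. X) P pr"
    note tup = d(5)[OF I P] and AX = d(1)[OF X_Obj] and AP = d(1)[OF is_product_Obj[OF P]]
    note pr = is_product_proj[OF P]
    show "unique_tuples I (enc (A X) ` A X) (enc (A P) ` A P) (\<lambda>i. ?act (pr i))"
      unfolding unique_tuples_def
    proof (intro allI impI ex_ex1I)
      fix x assume x: "\<forall>i\<in>I. x i \<in> enc (A X) ` A X"
      then have "\<And>i. i \<in> I \<Longrightarrow> dec (A X) (x i) \<in> A X" using dec_enc[OF AX] by auto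
      then obtain m where m: "m \<in> A P" "\<And>i. i \<in> I \<Longrightarrow> act (pr i) m = dec (A X) (x i)"
        using unique_tuplesE[OF tup, of "\<lambda>i. dec (A X) (x i)"] by blast
      moreover have "enc (A X) (dec (A X) (x i)) = x i" if "i \<in> I" for i
        using x that dec_enc[OF AX] by auto
      ultimately show "\<exists>m. m \<in> enc (A P) ` A P \<and> (\<forall>i\<in>I. ?act (pr i) m = x i)"
        by (intro exI[of _ "enc (A P) m"]) (simp add: act[OF pr])
    next
      fix x m m' assume "m \<in> enc (A P) ` A P \<and> (\<forall>i\<in>I. ?act (pr i) m = x i)"
        and "m' \<in> enc (A P) ` A P \<and> (\<forall>i\<in>I. ?act (pr i) m' = x i)"
      then obtain z z' where z: "m = enc (A P) z" "m' = enc (A P) z'" "z \<in> A P" "z' \<in> A P"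
        and eq: "\<And>i. i \<in> I \<Longrightarrow> ?act (pr i) (enc (A P) z) = ?act (pr i) (enc (A P) z')" by auto
      have "act (pr i) z = act (pr i) z'" if "i \<in> I" for i
        using eq[OF that] unfolding act[OF pr[OF that] z(3)] act[OF pr[OF that] z(4)]
        using enc_eq_iff[OF AX] d(2)[OF pr[OF that]] z(3,4) by simp
      then have "z = z'"
        by (intro unique_tuples_eqI[OF tup z(3,4)]) (auto intro: d(2)[OF pr] z)
      then show "m = m'" using z by simp
    qed
  next
    fix a b c k l z assume kl: "k \<in> hom L a b" "l \<in> hom L b c" and "z \<in> enc (A a) ` A a"
    then obtain w where w: "z = enc (A a) w" "w \<in> A a" by auto
    show "?act (Cmp L l k) z = ?act l (?act k z)"
      unfolding w(1) act[OF Cmp_hom[OF kl] w(2)] act[OF kl(1) w(2)] act[OF kl(2) d(2)[OF kl(1) w(2)]]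
      by (simp add: d(4)[OF kl w(2)])
  next
    fix a z assume a: "a \<in> Obj L" and "z \<in> enc (A a) ` A a"
    then obtain w where w: "z = enc (A a) w" "w \<in> A a" by auto
    show "?act (Idn L a) z = z"
      unfolding w(1) act[OF Idn_hom[OF a] w(2)] by (simp add: d(3)[OF a w(2)])
  next
    fix a b k z assume k: "k \<in> hom L a b" and "z \<in> enc (A a) ` A a"
    then obtain w where w: "z = enc (A a) w" "w \<in> A a" by auto
    show "?act k z \<in> enc (A b) ` A b"
      unfolding w(1) act[OF k w(2)] by (simp add: d(2)[OF k w(2)])
  qed (simp add: small_image d(1))
qed

lemma arr_to_realize:
  assumes A: "set_model A act" and M: "M \<in> Obj Md" and t: "nat_map (FObj M) (ap M) A act t"
  shows "mk_arr M (realize A act) (\<lambda>a z. enc (A a) (t a z)) \<in> hom Md M (realize A act)"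
  using t hom_Obj unfolding nat_map_def
  by (intro mk_arr_hom M realize_Obj A) (auto simp: nat_map_def realize_simps[OF A])

lemma arr_from_realize:
  assumes A: "set_model A act" and N: "N \<in> Obj Md" and t: "nat_map A act (FObj N) (ap N) t"
  shows "mk_arr (realize A act) N (\<lambda>a z. t a (dec (A a) z)) \<in> hom Md (realize A act) N"
proof (intro mk_arr_hom N realize_Obj A)
  note d = set_modelD[OF A]
  show "nat_map (FObj (realize A act)) (ap (realize A act)) (FObj N) (ap N)
      (\<lambda>a z. t a (dec (A a) z))"
    unfolding nat_map_def
  proof (intro conjI allI impI)
    fix a z assume "a \<in> Obj L" "z \<in> FObj (realize A act) a"
    then show "t a (dec (A a) z) \<in> FObj N a"
      using t d(1) unfolding nat_map_def by (auto simp: realize_simps[OF A] dec_enc)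
  next
    fix a b k z assume k: "k \<in> hom L a b" and z: "z \<in> FObj (realize A act) a"
    note ab = hom_Obj[OF k]
    obtain w where w: "z = enc (A a) w" "w \<in> A a" using z ab by (auto simp: realize_simps[OF A])
    show "t b (dec (A b) (ap (realize A act) k z)) = ap N k (t a (dec (A a) z))"
      using t k w d(2)[OF k w(2)] d(1) ab unfolding nat_map_def w(1) realize_simps(2)[OF A k w(2)]
      by (simp add: dec_enc)
  qed
qed

end

section \<open>Cocompleteness of the category of models\<close>

context lawvere_theory
begin

lemma model_eqI:
  "M \<in> Obj Md \<Longrightarrow> small U S \<Longrightarrow> is_product L S (\<lambda>_. X) P pr \<Longrightarrow> z \<in> FObj M P \<Longrightarrow> z' \<in> FObj M P \<Longrightarrow>
    (\<And>s. s \<in> S \<Longrightarrow> ap M (pr s) z = ap M (pr s) z') \<Longrightarrow> z = z'"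
  by (rule set_model_eqI[OF Mod_set_model])

text \<open>
  Every object is a power of \<open>X\<close>, and elements of a model at a power are determined by their
  coordinates, so homomorphisms are determined by their component at \<open>X\<close>.
\<close>

lemma Mod_hom_eqI_at_X:
  assumes t: "t \<in> hom Md M N" and s: "s \<in> hom Md M N"
    and eq: "\<And>z. z \<in> FObj M X \<Longrightarrow> app t X z = app s X z"
  shows "t = s"
proof (rule Mod_hom_eqI[OF t s])
  fix a z assume a: "a \<in> Obj L" and z: "z \<in> FObj M a"
  obtain I :: "'u set" and pr where I: "small U I" "is_product L I (\<lambda>_. X) a pr"
    using Obj_power[OF a] .
  note pr = is_product_proj[OF I(2)]
  show "app t a z = app s a z"
  proof (rule model_eqI[OF Md.hom_Obj(2)[OF t] I])
    fix i assume i: "i \<in> I"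
    show "ap N (pr i) (app t a z) = ap N (pr i) (app s a z)"
      using Mod_hom_app(2)[OF t pr[OF i] z] Mod_hom_app(2)[OF s pr[OF i] z]
        eq[OF model_ap[OF Md.hom_Obj(1)[OF t] pr[OF i] z]] by simp
  qed (use Mod_hom_app(1)[OF t a z] Mod_hom_app(1)[OF s a z] in auto)
qed

lemma locally_small_Mod: "locally_small U Md"
  unfolding locally_small_def
proof (intro ballI)
  fix M N assume MN: "M \<in> Obj Md" "N \<in> Obj Md"
  show "small U (hom Md M N)"
  proof (rule small_inj_on)
    show "inj_on (\<lambda>t. restrict (app t X) (FObj M X)) (hom Md M N)"
    proof (rule inj_onI)
      fix t s assume ts: "t \<in> hom Md M N" "s \<in> hom Md M N"
        and eq: "restrict (app t X) (FObj M X) = restrict (app s X) (FObj M X)"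
      show "t = s"
        by (rule Mod_hom_eqI_at_X[OF ts]) (metis eq restrict_apply')
    qed
    show "(\<lambda>t. restrict (app t X) (FObj M X)) ` hom Md M N \<subseteq> FObj M X \<rightarrow>\<^sub>E FObj N X"
      using Mod_hom_app(1) X_Obj by auto
    show "small U (FObj M X \<rightarrow>\<^sub>E FObj N X)"
      by (intro small_PiE model_small MN X_Obj)
  qed
qed

end

text \<open>
  Let \<open>S\<close> be the disjoint union of the underlying sets of the models in the diagram and \<open>P\<close> the power
  of \<open>X\<close> with exponent \<open>S\<close>. A homomorphism from the free model \<open>hom L P\<close> to \<open>N\<close> is an element
  of \<open>N P\<close>, that is, a family in \<open>N X\<close> indexed by \<open>S\<close>. Every cocone with vertex \<open>N\<close> gives such a
  family, hence such an element, called \<open>base\<close> below.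
  
  The colimit is the joint image of the resulting homomorphisms from \<open>hom L P\<close> to all vertices. Its
  elements are families indexed by all cocones, so there is no quotient to handle: the
  homomorphism induced by a cocone is the projection to its vertex.
\<close>

locale model_diagram = lawvere_theory U L X
  for U :: "'u itself" and L :: "('o, 'a) cat" and X +
  fixes J :: "('j, 'k) cat"
    and D :: "('j, 'k, ('o, 'a, 'u set, 'u set_arr) fnctr, ('o, 'a, 'u set, 'u set_arr) nt) fnctr"
    and P :: 'o and pr :: "'j \<times> 'u \<Rightarrow> 'a"
  assumes J: "category J" "small U (Obj J)"
    and D: "is_functor J (Mod U L X) D"
    and P: "is_product L (SIGMA j:Obj J. FObj (FObj D j) X) (\<lambda>_. X) P pr"
begin

abbreviation S where "S \<equiv> SIGMA j:Obj J. FObj (FObj D j) X"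

definition cocones where
  "cocones = {c. is_cocone J Md D (fst c) (snd c)}"

text \<open>
  The element of the vertex at \<open>P\<close> whose coordinates are the values of the legs at \<open>X\<close>.
\<close>

definition base where
  "base c = (SOME m. m \<in> FObj (fst c) P \<and>
     (\<forall>j\<in>Obj J. \<forall>x\<in>FObj (FObj D j) X. ap (fst c) (pr (j, x)) m = app (snd c j) X x))"

text \<open>
  The image of an arrow out of \<open>P\<close> at all vertices at once. The value off the set of cocones is
  fixed, so that two such families are equal as soon as they agree on cocones.
\<close>

definition evaluation where
  "evaluation f = (\<lambda>c. if c \<in> cocones then ap (fst c) f (base c) else undefined)"

definition Q where
  "Q a = evaluation ` hom L P a"

definition act where
  "act k \<phi> = (\<lambda>c. if c \<in> cocones then ap (fst c) k (\<phi> c) else undefined)"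

lemma D_Obj: "j \<in> Obj J \<Longrightarrow> FObj D j \<in> Obj Md"
  by (rule is_functorD(1)[OF D])

lemma small_S: "small U S"
  by (intro small_Sigma J(2) model_small D_Obj X_Obj)

lemma P_Obj: "P \<in> Obj L" and pr: "j \<in> Obj J \<Longrightarrow> x \<in> FObj (FObj D j) X \<Longrightarrow> pr (j, x) \<in> hom L P X"
  using P by (auto simp: is_product_def)

lemma coconesD:
  assumes "c \<in> cocones"
  shows "fst c \<in> Obj Md" and "j \<in> Obj J \<Longrightarrow> snd c j \<in> hom Md (FObj D j) (fst c)"
    and "f \<in> hom J i j \<Longrightarrow> Cmp Md (snd c j) (FArr D f) = snd c i"
  using assms by (auto simp: cocones_def is_cocone_def hom_def)

lemma base:
  assumes c: "c \<in> cocones"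
  shows "base c \<in> FObj (fst c) P"
    and "j \<in> Obj J \<Longrightarrow> x \<in> FObj (FObj D j) X \<Longrightarrow>
      ap (fst c) (pr (j, x)) (base c) = app (snd c j) X x"
proof -
  note N = coconesD(1)[OF c]
  have "app (snd c (fst s)) X (snd s) \<in> FObj (fst c) X" if "s \<in> S" for s
    using that Mod_hom_app(1)[OF coconesD(2)[OF c] X_Obj] by auto
  then obtain m where "m \<in> FObj (fst c) P"
      "\<And>s. s \<in> S \<Longrightarrow> ap (fst c) (pr s) m = app (snd c (fst s)) X (snd s)"
    using unique_tuplesE[OF set_model_tuples[OF Mod_set_model[OF N] small_S P],
        of "\<lambda>s. app (snd c (fst s)) X (snd s)"] by blast
  then have "\<exists>m. m \<in> FObj (fst c) P \<and>
     (\<forall>j\<in>Obj J. \<forall>x\<in>FObj (FObj D j) X. ap (fst c) (pr (j, x)) m = app (snd c j) X x)"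
    by (intro exI[of _ m]) auto
  note b = someI_ex[OF this, folded base_def]
  from b show "base c \<in> FObj (fst c) P" by simp
  from b show "j \<in> Obj J \<Longrightarrow> x \<in> FObj (FObj D j) X \<Longrightarrow>
      ap (fst c) (pr (j, x)) (base c) = app (snd c j) X x" by simp
qed

lemma act_evaluation: "f \<in> hom L P a \<Longrightarrow> k \<in> hom L a b \<Longrightarrow> act k (evaluation f) = evaluation (Cmp L k f)"
  using model_Cmp[OF coconesD(1)] base(1) by (auto simp: act_def evaluation_def)

lemma Q_at_cocone: "\<phi> \<in> Q a \<Longrightarrow> c \<in> cocones \<Longrightarrow> \<phi> c \<in> FObj (fst c) a"
  unfolding Q_def evaluation_def by (auto split: prod.splits intro!: model_ap[OF coconesD(1) _ base(1)])

text \<open>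
  Uniqueness of tuples is inherited from the vertices of the cocones. For existence, the
  coordinates are represented by arrows from \<open>P\<close> to \<open>X\<close>, and these combine to one arrow from \<open>P\<close> to
  the power.
\<close>

lemma set_model_Q: "set_model Q act"
  unfolding set_model_def
proof (intro conjI ballI allI impI)
  fix a assume "a \<in> Obj L"
  then show "small U (Q a)"
    unfolding Q_def using locally_small P_Obj by (intro small_image) (simp add: locally_small_def)
next
  fix k a b \<phi> assume "k \<in> hom L a b" "\<phi> \<in> Q a"
  then show "act k \<phi> \<in> Q b"
    unfolding Q_def using act_evaluation Cmp_hom by (auto intro!: imageI)
next
  fix a \<phi> assume "a \<in> Obj L" "\<phi> \<in> Q a"
  then show "act (Idn L a) \<phi> = \<phi>"
    unfolding Q_def using act_evaluation[OF _ Idn_hom] Idn_Cmp by auto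
next
  fix k l a b c \<phi> assume kl: "k \<in> hom L a b" "l \<in> hom L b c" and "\<phi> \<in> Q a"
  then obtain f where f: "f \<in> hom L P a" "\<phi> = evaluation f" by (auto simp: Q_def)
  show "act (Cmp L l k) \<phi> = act l (act k \<phi>)"
    using act_evaluation[OF f(1) Cmp_hom[OF kl]] act_evaluation[OF f(1) kl(1)]
      act_evaluation[OF Cmp_hom[OF f(1) kl(1)] kl(2)] Cmp_assoc[OF f(1) kl] f(2) by simp
next
  fix I :: "'u set" and R p assume I: "small U I" and R: "is_product L I (\<lambda>_. X) R p"
  note p = is_product_proj[OF R]
  show "unique_tuples I (Q X) (Q R) (\<lambda>i. act (p i))"
    unfolding unique_tuples_def
  proof (intro allI impI ex_ex1I)
    fix x assume "\<forall>i\<in>I. x i \<in> Q X"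
    then have "\<forall>i\<in>I. \<exists>f. f \<in> hom L P X \<and> x i = evaluation f" by (auto simp: Q_def)
    then obtain f where f: "\<And>i. i \<in> I \<Longrightarrow> f i \<in> hom L P X" "\<And>i. i \<in> I \<Longrightarrow> x i = evaluation (f i)" by metis
    obtain h where h: "h \<in> hom L P R" "\<And>i. i \<in> I \<Longrightarrow> Cmp L (p i) h = f i"
      using is_product_tuple[OF R P_Obj, where q = f, OF f(1)] by blast
    then show "\<exists>m. m \<in> Q R \<and> (\<forall>i\<in>I. act (p i) m = x i)"
      by (intro exI[of _ "evaluation h"]) (simp add: Q_def act_evaluation[OF h(1) p] f(2))
  next
    fix x \<phi> \<psi> assume \<phi>: "\<phi> \<in> Q R \<and> (\<forall>i\<in>I. act (p i) \<phi> = x i)"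
      and \<psi>: "\<psi> \<in> Q R \<and> (\<forall>i\<in>I. act (p i) \<psi> = x i)"
    show "\<phi> = \<psi>"
    proof
      fix c show "\<phi> c = \<psi> c"
      proof (cases "c \<in> cocones")
        case True
        show ?thesis
        proof (rule model_eqI[OF coconesD(1)[OF True] I R])
          fix i assume "i \<in> I"
          then have "act (p i) \<phi> c = act (p i) \<psi> c" using \<phi> \<psi> by simp
          then show "ap (fst c) (p i) (\<phi> c) = ap (fst c) (p i) (\<psi> c)" using True by (simp add: act_def)
        qed (use \<phi> \<psi> Q_at_cocone True in auto)
      next
        case False
        then show ?thesis using \<phi> \<psi> by (auto simp: Q_def evaluation_def)
      qed
    qed
  qed
qed

definition colim where "colim = realize Q act"

definition colim_leg where
  "colim_leg j = mk_arr (FObj D j) colim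
     (\<lambda>a z. enc (Q a) (\<lambda>c. if c \<in> cocones then app (snd c j) a z else undefined))"

definition desc where
  "desc c = mk_arr colim (fst c) (\<lambda>a z. dec (Q a) z c)"

lemma small_Q: "a \<in> Obj L \<Longrightarrow> small U (Q a)"
  by (rule set_modelD(1)[OF set_model_Q])

text \<open>
  The coordinates of \<open>z\<close> belong to \<open>S\<close>, and the arrow from \<open>P\<close> with the corresponding projections
  as coordinates represents the family of images of \<open>z\<close>.
\<close>

lemma colim_leg_in_Q:
  assumes j: "j \<in> Obj J" and a: "a \<in> Obj L" and z: "z \<in> FObj (FObj D j) a"
  shows "(\<lambda>c. if c \<in> cocones then app (snd c j) a z else undefined) \<in> Q a"
proof -
  obtain I :: "'u set" and p where I: "small U I" "is_product L I (\<lambda>_. X) a p"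
    using Obj_power[OF a] .
  note p = is_product_proj[OF I(2)]
  have x: "ap (FObj D j) (p i) z \<in> FObj (FObj D j) X" if "i \<in> I" for i
    using model_ap[OF D_Obj[OF j] p[OF that] z] .
  obtain f where f: "f \<in> hom L P a" "\<And>i. i \<in> I \<Longrightarrow> Cmp L (p i) f = pr (j, ap (FObj D j) (p i) z)"
    using is_product_tuple[OF I(2) P_Obj,
      where q = "\<lambda>i. pr (j, ap (FObj D j) (p i) z)", OF pr[OF j x]] by blast
  have "ap (fst c) f (base c) = app (snd c j) a z" if c: "c \<in> cocones" for c
  proof (rule model_eqI[OF coconesD(1)[OF c] I])
    fix i assume i: "i \<in> I"
    have "ap (fst c) (p i) (ap (fst c) f (base c)) = ap (fst c) (Cmp L (p i) f) (base c)"
      using model_Cmp[OF coconesD(1)[OF c] f(1) p[OF i] base(1)[OF c]] by simp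
    also have "\<dots> = app (snd c j) X (ap (FObj D j) (p i) z)"
      using base(2)[OF c j x[OF i]] f(2)[OF i] by simp
    also have "\<dots> = ap (fst c) (p i) (app (snd c j) a z)"
      by (rule Mod_hom_app(2)[OF coconesD(2)[OF c j] p[OF i] z])
    finally show "ap (fst c) (p i) (ap (fst c) f (base c)) = ap (fst c) (p i) (app (snd c j) a z)" .
  qed (use model_ap[OF coconesD(1)[OF c] f(1) base(1)[OF c]]
      Mod_hom_app(1)[OF coconesD(2)[OF c j] a z] in auto)
  then have "(\<lambda>c. if c \<in> cocones then app (snd c j) a z else undefined) = evaluation f"
    by (auto simp: evaluation_def)
  then show ?thesis using f(1) by (simp add: Q_def)
qed

lemma colim_leg_hom: "j \<in> Obj J \<Longrightarrow> colim_leg j \<in> hom Md (FObj D j) colim"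
  unfolding colim_leg_def colim_def
proof (rule arr_to_realize[OF set_model_Q D_Obj])
  assume j: "j \<in> Obj J"
  show "nat_map (FObj (FObj D j)) (ap (FObj D j)) Q act
      (\<lambda>a z c. if c \<in> cocones then app (snd c j) a z else undefined)"
    unfolding nat_map_def using colim_leg_in_Q[OF j] Mod_hom_app(2)[OF coconesD(2)[OF _ j]]
    by (auto simp: act_def)
qed

lemma app_colim_leg:
  "j \<in> Obj J \<Longrightarrow> a \<in> Obj L \<Longrightarrow> z \<in> FObj (FObj D j) a \<Longrightarrow>
    app (colim_leg j) a z = enc (Q a) (\<lambda>c. if c \<in> cocones then app (snd c j) a z else undefined)"
  by (simp add: colim_leg_def app_mk_arr)

lemma desc_hom: "c \<in> cocones \<Longrightarrow> desc c \<in> hom Md colim (fst c)"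
  unfolding desc_def colim_def
proof (rule arr_from_realize[OF set_model_Q coconesD(1), where t = "\<lambda>a \<phi>. \<phi> c"])
  assume "c \<in> cocones"
  then show "nat_map Q act (FObj (fst c)) (ap (fst c)) (\<lambda>a \<phi>. \<phi> c)"
    unfolding nat_map_def using Q_at_cocone by (auto simp: act_def)
qed

lemma colim_Obj: "colim \<in> Obj Md"
  unfolding colim_def by (rule realize_Obj[OF set_model_Q])

lemma FObj_colim: "a \<in> Obj L \<Longrightarrow> FObj colim a = enc (Q a) ` Q a"
  unfolding colim_def by (rule realize_simps(1)[OF set_model_Q])

lemma app_desc:
  "c \<in> cocones \<Longrightarrow> a \<in> Obj L \<Longrightarrow> \<phi> \<in> Q a \<Longrightarrow> app (desc c) a (enc (Q a) \<phi>) = \<phi> c"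
  by (simp add: desc_def app_mk_arr FObj_colim dec_enc small_Q)

lemma desc_colim_leg: "c \<in> cocones \<Longrightarrow> j \<in> Obj J \<Longrightarrow> Cmp Md (desc c) (colim_leg j) = snd c j"
  by (rule Mod_hom_eqI[OF Md.Cmp_hom[OF colim_leg_hom desc_hom] coconesD(2)])
    (simp_all add: app_Cmp[OF colim_leg_hom desc_hom] app_colim_leg app_desc colim_leg_in_Q)

text \<open>
  As an image of \<open>hom L P\<close>, the colimit is generated by the image of the identity of \<open>P\<close>. The
  coordinates of the value of \<open>h\<close> at this element are values of the composites of \<open>h\<close> with the
  legs, so they agree with the coordinates of \<open>base c\<close>.
\<close>

lemma desc_unique:
  assumes c: "c \<in> cocones" and h: "h \<in> hom Md colim (fst c)"
    and eq: "\<And>j. j \<in> Obj J \<Longrightarrow> Cmp Md h (colim_leg j) = snd c j"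
  shows "h = desc c"
proof (rule Mod_hom_eqI[OF h desc_hom[OF c]])
  fix a z assume a: "a \<in> Obj L" and "z \<in> FObj colim a"
  then obtain f where f: "f \<in> hom L P a" and z: "z = enc (Q a) (evaluation f)"
    by (auto simp: FObj_colim Q_def)
  note id = Idn_hom[OF P_Obj]
  have Q: "evaluation (Idn L P) \<in> Q P" using id by (simp add: Q_def)
  have e: "enc (Q P) (evaluation (Idn L P)) \<in> FObj colim P" using Q by (simp add: FObj_colim P_Obj)
  have ap_e: "ap colim k (enc (Q P) (evaluation (Idn L P))) = enc (Q b) (evaluation k)" if k: "k \<in> hom L P b" for k b
    unfolding colim_def realize_simps(2)[OF set_model_Q k Q]
    using act_evaluation[OF id k] Cmp_Idn[OF k] by simp
  have "app h P (enc (Q P) (evaluation (Idn L P))) = base c"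
  proof (rule model_eqI[OF coconesD(1)[OF c] small_S P])
    fix s assume "s \<in> S"
    then obtain j x where s: "s = (j, x)" "j \<in> Obj J" "x \<in> FObj (FObj D j) X" by auto
    note prs = pr[OF s(2,3)]
    have "ap (fst c) (pr s) (app h P (enc (Q P) (evaluation (Idn L P)))) = app h X (enc (Q X) (evaluation (pr s)))"
      using Mod_hom_app(2)[OF h prs e] ap_e[OF prs] s(1) by simp
    also have "evaluation (pr s) = (\<lambda>c. if c \<in> cocones then app (snd c j) X x else undefined)"
      using base(2)[OF _ s(2,3)] s(1) by (auto simp: evaluation_def)
    also have "app h X (enc (Q X) (\<lambda>c. if c \<in> cocones then app (snd c j) X x else undefined)) =
        app (snd c j) X x"
      using app_colim_leg[OF s(2) X_Obj s(3)] app_Cmp[OF colim_leg_hom[OF s(2)] h X_Obj s(3)] eq[OF s(2)] by simp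
    also have "\<dots> = ap (fst c) (pr s) (base c)"
      using base(2)[OF c s(2,3)] s(1) by simp
    finally show "ap (fst c) (pr s) (app h P (enc (Q P) (evaluation (Idn L P)))) = ap (fst c) (pr s) (base c)" .
  qed (use Mod_hom_app(1)[OF h P_Obj e] base(1)[OF c] in auto)
  then have "app h a z = ap (fst c) f (base c)"
    using Mod_hom_app(2)[OF h f e] ap_e[OF f] z by simp
  then show "app h a z = app (desc c) a z"
    using app_desc[OF c a] f c by (simp add: z Q_def evaluation_def)
qed

lemma is_colimit_colim: "is_colimit J Md D colim colim_leg"
  unfolding is_colimit_def is_cocone_def[of _ _ _ colim]
proof (intro conjI ballI allI impI)
  fix f assume f: "f \<in> Arr J"
  let ?i = "Dom J f" and ?j = "Cod J f"
  have ij: "?i \<in> Obj J" "?j \<in> Obj J"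
    using category.Dom_Obj[OF J(1) f] category.Cod_Obj[OF J(1) f] .
  note f' = Arr_hom[OF f]
  note Df = is_functorD(2)[OF D f']
  show "Cmp Md (colim_leg ?j) (FArr D f) = colim_leg ?i"
  proof (rule Mod_hom_eqI[OF Md.Cmp_hom[OF Df colim_leg_hom[OF ij(2)]] colim_leg_hom[OF ij(1)]])
    fix a z assume az: "a \<in> Obj L" "z \<in> FObj (FObj D ?i) a"
    have "app (snd c ?j) a (app (FArr D f) a z) = app (snd c ?i) a z" if c: "c \<in> cocones" for c
      using app_Cmp[OF Df coconesD(2)[OF c ij(2)] az] coconesD(3)[OF c f'] by simp
    then show "app (Cmp Md (colim_leg ?j) (FArr D f)) a z = app (colim_leg ?i) a z"
      using Mod_hom_app(1)[OF Df az]
      by (simp add: app_Cmp[OF Df colim_leg_hom[OF ij(2)] az] app_colim_leg ij az cong: if_cong)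
  qed
next
  fix N s assume "is_cocone J Md D N s"
  then have c: "(N, s) \<in> cocones" by (simp add: cocones_def)
  show "\<exists>!h. h \<in> hom Md colim N \<and> (\<forall>j\<in>Obj J. Cmp Md h (colim_leg j) = s j)"
  proof (rule ex1I[of _ "desc (N, s)"])
    show "desc (N, s) \<in> hom Md colim N \<and> (\<forall>j\<in>Obj J. Cmp Md (desc (N, s)) (colim_leg j) = s j)"
      using desc_hom[OF c] desc_colim_leg[OF c] by simp
  next
    fix h assume "h \<in> hom Md colim N \<and> (\<forall>j\<in>Obj J. Cmp Md h (colim_leg j) = s j)"
    then show "h = desc (N, s)" using desc_unique[OF c, of h] by simp
  qed
qed (use colim_Obj colim_leg_hom in auto)

end

theorem (in lawvere_theory) cocomplete_Mod: "cocomplete_category U Md"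
  unfolding cocomplete_category_def
proof (intro conjI allI impI category_Mod locally_small_Mod)
  fix J :: "('u, 'u) cat" and D assume "small_category U J \<and> is_functor J Md D"
  then have J: "category J" "small U (Obj J)" and D: "is_functor J Md D"
    by (auto simp: small_category_def)
  have "small U (SIGMA j:Obj J. FObj (FObj D j) X)"
    by (intro small_Sigma J(2) model_small is_functorD(1)[OF D] X_Obj)
  from power_of_X[OF this]
  obtain P pr where P: "is_product L (SIGMA j:Obj J. FObj (FObj D j) X) (\<lambda>_. X) P pr" .
  interpret model_diagram U L X J D P pr
    by (intro model_diagram.intro lawvere_theory_axioms model_diagram_axioms.intro J D P)
  show "\<exists>c t. is_colimit J Md D c t" using is_colimit_colim by blast
qed

section \<open>Coproducts and coequalizers as colimits\<close>

definition discrete_cat :: "'u set \<Rightarrow> ('u, 'u) cat" where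
  "discrete_cat I = \<lparr>Obj = I, Arr = I, Dom = id, Cod = id, Idn = id, Cmp = (\<lambda>g f. f)\<rparr>"

lemma discrete_cat_simps [simp]:
  "Obj (discrete_cat I) = I" "Arr (discrete_cat I) = I" "Dom (discrete_cat I) i = i"
  "Cod (discrete_cat I) i = i" "Idn (discrete_cat I) i = i" "Cmp (discrete_cat I) j i = i"
  by (simp_all add: discrete_cat_def)

lemma hom_discrete_cat: "f \<in> hom (discrete_cat I) i j \<longleftrightarrow> i \<in> I \<and> f = i \<and> j = i"
  by (auto simp: hom_def)

lemma category_discrete_cat: "category (discrete_cat I)"
  by unfold_locales (auto simp: hom_discrete_cat)

lemma is_colimit_discrete_iff:
  assumes "category C" and D: "is_functor (discrete_cat I) C D"
  shows "is_colimit (discrete_cat I) C D c t \<longleftrightarrow> is_coproduct C I (FObj D) c t"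
proof -
  interpret C: category C by fact
  have cocone: "is_cocone (discrete_cat I) C D d s \<longleftrightarrow>
      d \<in> Obj C \<and> (\<forall>i\<in>I. s i \<in> hom C (FObj D i) d)" for d s
    using is_functorD(3)[OF D] C.Cmp_Idn by (auto simp: is_cocone_def)
  show ?thesis
    unfolding is_colimit_def is_coproduct_def cocone by (simp add: imp_conjL conj_ac Ball_def)
qed

definition is_coequalizer where
  "is_coequalizer C a b f g c w \<longleftrightarrow> w \<in> hom C b c \<and> Cmp C w f = Cmp C w g \<and>
     (\<forall>d v. v \<in> hom C b d \<longrightarrow> Cmp C v f = Cmp C v g \<longrightarrow> (\<exists>!h. h \<in> hom C c d \<and> Cmp C h w = v))"

context small_universe
begin

text \<open>
  Distinct elements of \<open>'u\<close>, from which the shape of a coequalizer is built.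
\<close>

definition pt :: "nat \<Rightarrow> 'u" where
  "pt = (SOME p. inj p)"

lemma pt_eq_iff [simp]: "pt m = pt n \<longleftrightarrow> m = n"
proof -
  have "\<exists>p :: nat \<Rightarrow> 'u. inj p" using infinite_countable_subset[OF infinite_universe] by blast
  from inj_eq[OF someI_ex[OF this]] show ?thesis unfolding pt_def .
qed

text \<open>
  The parallel arrows \<open>pt 2\<close> and \<open>pt 3\<close> from \<open>pt 0\<close> to \<open>pt 4\<close>; the objects double as their
  identities, and of two composable arrows at least one is an identity.
\<close>

definition pair_cat :: "('u, 'u) cat" where
  "pair_cat = \<lparr>Obj = {pt 0, pt 4}, Arr = {pt 0, pt 4, pt 2, pt 3},
     Dom = (\<lambda>x. if x = pt 4 then pt 4 else pt 0), Cod = (\<lambda>x. if x = pt 0 then pt 0 else pt 4),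
     Idn = id, Cmp = (\<lambda>g f. if g = pt 0 \<or> g = pt 4 then f else g)\<rparr>"

lemma pair_cat_simps [simp]:
  "Obj pair_cat = {pt 0, pt 4}" "Arr pair_cat = {pt 0, pt 4, pt 2, pt 3}"
  "Dom pair_cat x = (if x = pt 4 then pt 4 else pt 0)"
  "Cod pair_cat x = (if x = pt 0 then pt 0 else pt 4)"
  "Idn pair_cat x = x" "Cmp pair_cat g f = (if g = pt 0 \<or> g = pt 4 then f else g)"
  by (simp_all add: pair_cat_def)

lemma hom_pair_cat:
  "f \<in> hom pair_cat a b \<longleftrightarrow> (f = pt 0 \<and> a = pt 0 \<and> b = pt 0) \<or> (f = pt 4 \<and> a = pt 4 \<and> b = pt 4) \<or>
     (f = pt 2 \<and> a = pt 0 \<and> b = pt 4) \<or> (f = pt 3 \<and> a = pt 0 \<and> b = pt 4)"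
  by (auto simp: hom_def)

lemma category_pair_cat: "category pair_cat"
  by unfold_locales (auto simp: hom_pair_cat)

lemma small_category_pair_cat: "small_category U pair_cat"
  by (simp add: small_category_def category_pair_cat small_finite)

definition pair_diagram where
  "pair_diagram C a b f g = \<lparr>FObj = (\<lambda>x. if x = pt 0 then a else b),
     FArr = (\<lambda>x. if x = pt 0 then Idn C a else if x = pt 4 then Idn C b else if x = pt 2 then f else g)\<rparr>"

lemma pair_diagram_simps [simp]:
  "FObj (pair_diagram C a b f g) (pt 0) = a" "FObj (pair_diagram C a b f g) (pt 4) = b"
  "FArr (pair_diagram C a b f g) (pt 0) = Idn C a" "FArr (pair_diagram C a b f g) (pt 4) = Idn C b"
  "FArr (pair_diagram C a b f g) (pt 2) = f" "FArr (pair_diagram C a b f g) (pt 3) = g"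
  by (simp_all add: pair_diagram_def)

lemma is_functor_pair_diagram:
  assumes "category C" and f: "f \<in> hom C a b" and g: "g \<in> hom C a b"
  shows "is_functor pair_cat C (pair_diagram C a b f g)"
proof -
  interpret C: category C by fact
  show ?thesis
    using C.hom_Obj[OF f] f g
    by (simp add: is_functor_def C.Cmp_Idn[OF f] C.Cmp_Idn[OF g] C.Idn_Cmp[OF f] C.Idn_Cmp[OF g]
        C.Cmp_Idn[OF C.Idn_hom] C.Idn_hom)
qed

lemma is_cocone_pair_iff:
  assumes "category C" and D: "is_functor pair_cat C D"
  shows "is_cocone pair_cat C D d s \<longleftrightarrow> s (pt 4) \<in> hom C (FObj D (pt 4)) d \<and>
    s (pt 0) = Cmp C (s (pt 4)) (FArr D (pt 2)) \<and> s (pt 0) = Cmp C (s (pt 4)) (FArr D (pt 3))"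
proof -
  interpret C: category C by fact
  have f: "FArr D (pt 2) \<in> hom C (FObj D (pt 0)) (FObj D (pt 4))"
    by (rule is_functorD(2)[OF D]) (simp add: hom_pair_cat)
  have id: "FArr D (pt 0) = Idn C (FObj D (pt 0))" "FArr D (pt 4) = Idn C (FObj D (pt 4))"
    using is_functorD(3)[OF D, of "pt 0"] is_functorD(3)[OF D, of "pt 4"] by auto
  show ?thesis
    using C.hom_Obj C.Cmp_hom[OF f, of "s (pt 4)" d] C.Cmp_Idn[of "s (pt 4)" "FObj D (pt 4)" d]
      C.Cmp_Idn[of "s (pt 0)" "FObj D (pt 0)" d]
    by (auto simp: is_cocone_def id)
qed

lemma is_coequalizer_of_colimit:
  assumes C: "category C" and D: "is_functor pair_cat C D" and c: "is_colimit pair_cat C D c t"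
  shows "is_coequalizer C (FObj D (pt 0)) (FObj D (pt 4)) (FArr D (pt 2)) (FArr D (pt 3)) c (t (pt 4))"
  unfolding is_coequalizer_def
proof (intro conjI allI impI)
  interpret C: category C by fact
  note cocone = is_cocone_pair_iff[OF C D]
  have t: "is_cocone pair_cat C D c t" using c by (simp add: is_colimit_def)
  then show t1: "t (pt 4) \<in> hom C (FObj D (pt 4)) c"
    and "Cmp C (t (pt 4)) (FArr D (pt 2)) = Cmp C (t (pt 4)) (FArr D (pt 3))"
    unfolding cocone by auto
  fix d v assume v: "v \<in> hom C (FObj D (pt 4)) d" "Cmp C v (FArr D (pt 2)) = Cmp C v (FArr D (pt 3))"
  define s where "s = (\<lambda>x. if x = pt 0 then Cmp C v (FArr D (pt 2)) else v)"
  have "is_cocone pair_cat C D d s" unfolding cocone using v by (simp add: s_def)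
  then have "\<exists>!h. h \<in> hom C c d \<and> (\<forall>j\<in>Obj pair_cat. Cmp C h (t j) = s j)"
    using c by (auto simp: is_colimit_def)
  moreover have "(\<forall>j\<in>Obj pair_cat. Cmp C h (t j) = s j) \<longleftrightarrow> Cmp C h (t (pt 4)) = v"
    if h: "h \<in> hom C c d" for h
  proof -
    have f: "FArr D (pt 2) \<in> hom C (FObj D (pt 0)) (FObj D (pt 4))"
      by (rule is_functorD(2)[OF D]) (simp add: hom_pair_cat)
    have "t (pt 0) = Cmp C (t (pt 4)) (FArr D (pt 2))" using t unfolding cocone by auto
    then show ?thesis using C.Cmp_assoc[OF f t1 h] by (auto simp: s_def)
  qed
  ultimately show "\<exists>!h. h \<in> hom C c d \<and> Cmp C h (t (pt 4)) = v"
    by (metis (no_types, lifting))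
qed

lemma is_colimit_of_coequalizer:
  assumes C: "category C" and D: "is_functor pair_cat C D"
    and c: "is_coequalizer C (FObj D (pt 0)) (FObj D (pt 4)) (FArr D (pt 2)) (FArr D (pt 3)) c w"
  shows "is_colimit pair_cat C D c (\<lambda>x. if x = pt 0 then Cmp C w (FArr D (pt 2)) else w)"
    (is "is_colimit _ _ _ _ ?t")
  unfolding is_colimit_def
proof (intro conjI allI impI)
  interpret C: category C by fact
  note cocone = is_cocone_pair_iff[OF C D]
  have w: "w \<in> hom C (FObj D (pt 4)) c" "Cmp C w (FArr D (pt 2)) = Cmp C w (FArr D (pt 3))"
    using c by (auto simp: is_coequalizer_def)
  then show "is_cocone pair_cat C D c ?t" unfolding cocone by simp
  fix d s assume "is_cocone pair_cat C D d s"
  then have s: "s (pt 4) \<in> hom C (FObj D (pt 4)) d" "s (pt 0) = Cmp C (s (pt 4)) (FArr D (pt 2))"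
      "Cmp C (s (pt 4)) (FArr D (pt 2)) = Cmp C (s (pt 4)) (FArr D (pt 3))"
    unfolding cocone by auto
  then have "\<exists>!h. h \<in> hom C c d \<and> Cmp C h w = s (pt 4)"
    using c unfolding is_coequalizer_def by simp
  moreover have "(\<forall>j\<in>Obj pair_cat. Cmp C h (?t j) = s j) \<longleftrightarrow> Cmp C h w = s (pt 4)"
    if h: "h \<in> hom C c d" for h
  proof -
    have f: "FArr D (pt 2) \<in> hom C (FObj D (pt 0)) (FObj D (pt 4))"
      by (rule is_functorD(2)[OF D]) (simp add: hom_pair_cat)
    show ?thesis using C.Cmp_assoc[OF f w(1) h] s(2) by auto
  qed
  ultimately show "\<exists>!h. h \<in> hom C c d \<and> (\<forall>j\<in>Obj pair_cat. Cmp C h (?t j) = s j)"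
    by (metis (no_types, lifting))
qed

lemma coequalizer_exists:
  assumes C: "cocomplete_category U C" and f: "f \<in> hom C a b" and g: "g \<in> hom C a b"
  shows "\<exists>c w. is_coequalizer C a b f g c w"
proof -
  have cat: "category C" using C by (simp add: cocomplete_category_def)
  note D = is_functor_pair_diagram[OF cat f g]
  obtain c t where "is_colimit pair_cat C (pair_diagram C a b f g) c t"
    using C D small_category_pair_cat unfolding cocomplete_category_def by blast
  from is_coequalizer_of_colimit[OF cat D this] show ?thesis
    by auto
qed

lemma cocontinuous_coequalizer:
  assumes A: "category A" and B: "category B" and F: "is_functor A B F" "cocontinuous U A B F"
    and f: "f \<in> hom A a b" and g: "g \<in> hom A a b" and w: "is_coequalizer A a b f g c w"
  shows "is_coequalizer B (FObj F a) (FObj F b) (FArr F f) (FArr F g) (FObj F c) (FArr F w)"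
proof -
  note D = is_functor_pair_diagram[OF A f g]
  note FD = is_functor_comp[OF D F(1)]
  have "is_colimit pair_cat A (pair_diagram A a b f g) c (\<lambda>x. if x = pt 0 then Cmp A w f else w)"
    using is_colimit_of_coequalizer[OF A D, of c w] w by (simp cong: if_cong)
  then have "is_colimit pair_cat B (comp_functor F (pair_diagram A a b f g)) (FObj F c)
      (\<lambda>j. FArr F (if j = pt 0 then Cmp A w f else w))"
    using F(2) small_category_pair_cat D unfolding cocontinuous_def by blast
  from is_coequalizer_of_colimit[OF B FD this] show ?thesis
    by simp
qed

lemma cocontinuous_copower:
  assumes A: "category A" and B: "category B" and F: "is_functor A B F" "cocontinuous U A B F"
    and I: "small U (I :: 'u set)" and a: "a \<in> Obj A" and P: "is_coproduct A I (\<lambda>_. a) P inc"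
  shows "is_coproduct B I (\<lambda>_. FObj F a) (FObj F P) (\<lambda>i. FArr F (inc i))"
proof -
  interpret A: category A by fact
  define D where "D = \<lparr>FObj = (\<lambda>_ :: 'u. a), FArr = (\<lambda>_ :: 'u. Idn A a)\<rparr>"
  have D: "is_functor (discrete_cat I) A D"
    using a A.Idn_hom[OF a] A.Cmp_Idn[OF A.Idn_hom[OF a]]
    by (intro is_functorI) (auto simp: D_def)
  have "small_category U (discrete_cat I)"
    using I by (simp add: small_category_def category_discrete_cat)
  moreover have "is_colimit (discrete_cat I) A D P inc"
    using is_colimit_discrete_iff[OF A D] P by (simp add: D_def)
  ultimately have "is_colimit (discrete_cat I) B (comp_functor F D) (FObj F P) (\<lambda>i. FArr F (inc i))"
    using F(2) D unfolding cocontinuous_def by blast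
  moreover have "FObj (comp_functor F D) = (\<lambda>_. FObj F a)" by (auto simp: D_def)
  ultimately show ?thesis
    using is_colimit_discrete_iff[OF B is_functor_comp[OF D F(1)]] by simp
qed

end

section \<open>Free models\<close>

lemma is_coproductI:
  assumes "P \<in> Obj C" and "\<And>i. i \<in> I \<Longrightarrow> inc i \<in> hom C (A i) P"
    and "\<And>Q q. Q \<in> Obj C \<Longrightarrow> (\<And>i. i \<in> I \<Longrightarrow> q i \<in> hom C (A i) Q) \<Longrightarrow>
      \<exists>h. h \<in> hom C P Q \<and> (\<forall>i\<in>I. Cmp C h (inc i) = q i)"
    and "\<And>Q h h'. h \<in> hom C P Q \<Longrightarrow> h' \<in> hom C P Q \<Longrightarrow>
      (\<And>i. i \<in> I \<Longrightarrow> Cmp C h (inc i) = Cmp C h' (inc i)) \<Longrightarrow> h = h'"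
  shows "is_coproduct C I A P inc"
  unfolding is_coproduct_def
proof (intro conjI ballI allI impI)
  fix Q q assume "Q \<in> Obj C" and q: "\<forall>i\<in>I. q i \<in> hom C (A i) Q"
  then obtain h where h: "h \<in> hom C P Q" "\<forall>i\<in>I. Cmp C h (inc i) = q i" using assms(3)[of Q q] by auto
  show "\<exists>!h. h \<in> hom C P Q \<and> (\<forall>i\<in>I. Cmp C h (inc i) = q i)"
    by (rule ex1I[of _ h]) (use h in \<open>auto intro: assms(4)\<close>)
qed (use assms(1,2) in auto)

context lawvere_theory
begin

text \<open>
  The model \<open>hom L a\<close>, its elements \<open>arr_elem f\<close>, and the homomorphism \<open>el M a z\<close> out of it that the
  Yoneda lemma attaches to an element \<open>z\<close> of \<open>M a\<close>.
\<close>

definition rep :: "'o \<Rightarrow> ('o, 'a, 'u set, 'u set_arr) fnctr" where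
  "rep a = realize (hom L a) (Cmp L)"

definition arr_elem :: "'a \<Rightarrow> 'u" where
  "arr_elem f = enc (hom L (Dom L f) (Cod L f)) f"

definition el :: "('o, 'a, 'u set, 'u set_arr) fnctr \<Rightarrow> 'o \<Rightarrow> 'u \<Rightarrow> ('o, 'a, 'u set, 'u set_arr) nt" where
  "el M a z = mk_arr (rep a) M (\<lambda>b g. ap M (dec (hom L a b) g) z)"

lemma set_model_hom:
  assumes a: "a \<in> Obj L" shows "set_model (hom L a) (Cmp L)"
  unfolding set_model_def
proof (intro conjI ballI allI impI)
  fix I :: "'u set" and P pr assume I: "small U I" and P: "is_product L I (\<lambda>_. X) P pr"
  show "unique_tuples I (hom L a X) (hom L a P) (\<lambda>i. Cmp L (pr i))"
    using is_productD[OF P a] unfolding unique_tuples_def by simp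
next
  fix b assume "b \<in> Obj L"
  then show "small U (hom L a b)" using locally_small a by (simp add: locally_small_def)
next
  fix b c k f assume "k \<in> hom L b c" "f \<in> hom L a b"
  then show "Cmp L k f \<in> hom L a c" by (rule Cmp_hom[rotated])
next
  fix b f assume "f \<in> hom L a b"
  then show "Cmp L (Idn L b) f = f" by (rule Idn_Cmp)
next
  fix b c d k l f assume "k \<in> hom L b c" "l \<in> hom L c d" "f \<in> hom L a b"
  then show "Cmp L (Cmp L l k) f = Cmp L l (Cmp L k f)" by (intro Cmp_assoc)
qed

lemma rep_Obj: "a \<in> Obj L \<Longrightarrow> rep a \<in> Obj Md"
  unfolding rep_def by (intro realize_Obj set_model_hom)

lemma arr_elem_eq: "f \<in> hom L a b \<Longrightarrow> arr_elem f = enc (hom L a b) f"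
  by (simp add: arr_elem_def hom_def)

lemma arr_elem_in_rep: "f \<in> hom L a b \<Longrightarrow> arr_elem f \<in> FObj (rep a) b"
  and rep_elemE: "a \<in> Obj L \<Longrightarrow> b \<in> Obj L \<Longrightarrow> g \<in> FObj (rep a) b \<Longrightarrow>
    (\<And>f. f \<in> hom L a b \<Longrightarrow> g = arr_elem f \<Longrightarrow> thesis) \<Longrightarrow> thesis"
  using hom_Obj unfolding rep_def by (auto simp: realize_simps(1)[OF set_model_hom] arr_elem_eq)

lemma ap_rep: "f \<in> hom L a b \<Longrightarrow> k \<in> hom L b c \<Longrightarrow> ap (rep a) k (arr_elem f) = arr_elem (Cmp L k f)"
  unfolding rep_def
  using realize_simps(2)[OF set_model_hom, of a k b c f] hom_Obj(1)[of f a b]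
  by (simp add: arr_elem_eq[of f a b] arr_elem_eq[OF Cmp_hom])

lemma dec_arr_elem: "f \<in> hom L a b \<Longrightarrow> dec (hom L a b) (arr_elem f) = f"
  using set_modelD(1)[OF set_model_hom] hom_Obj by (simp add: arr_elem_eq dec_enc)

lemma el_hom:
  assumes M: "M \<in> Obj Md" and a: "a \<in> Obj L" and z: "z \<in> FObj M a"
  shows "el M a z \<in> hom Md (rep a) M"
  unfolding el_def rep_def
proof (rule arr_from_realize[OF set_model_hom[OF a] M, of "\<lambda>b f. ap M f z"])
  show "nat_map (hom L a) (Cmp L) (FObj M) (ap M) (\<lambda>b f. ap M f z)"
    unfolding nat_map_def using model_ap[OF M] model_Cmp[OF M] z by simp
qed

lemma app_el: "a \<in> Obj L \<Longrightarrow> f \<in> hom L a b \<Longrightarrow> app (el M a z) b (arr_elem f) = ap M f z"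
  using arr_elem_in_rep[of f a b] hom_Obj by (simp add: el_def app_mk_arr dec_arr_elem)

lemma app_el_Idn: "M \<in> Obj Md \<Longrightarrow> a \<in> Obj L \<Longrightarrow> z \<in> FObj M a \<Longrightarrow> app (el M a z) a (arr_elem (Idn L a)) = z"
  using app_el[OF _ Idn_hom] model_Idn by simp

lemma Idn_elem: "a \<in> Obj L \<Longrightarrow> arr_elem (Idn L a) \<in> FObj (rep a) a"
  by (rule arr_elem_in_rep[OF Idn_hom])

lemma yoneda:
  assumes a: "a \<in> Obj L" and t: "t \<in> hom Md (rep a) M"
  shows "t = el M a (app t a (arr_elem (Idn L a)))"
proof (rule Mod_hom_eqI[OF t])
  note M = Md.hom_Obj(2)[OF t]
  show "el M a (app t a (arr_elem (Idn L a))) \<in> hom Md (rep a) M"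
    by (rule el_hom[OF M a Mod_hom_app(1)[OF t a Idn_elem[OF a]]])
  fix b g assume "b \<in> Obj L" "g \<in> FObj (rep a) b"
  then obtain f where f: "f \<in> hom L a b" "g = arr_elem f" using rep_elemE[OF a] by blast
  have "app t b (ap (rep a) f (arr_elem (Idn L a))) = ap M f (app t a (arr_elem (Idn L a)))"
    by (rule Mod_hom_app(2)[OF t f(1) Idn_elem[OF a]])
  then show "app t b g = app (el M a (app t a (arr_elem (Idn L a)))) b g"
    using f by (simp add: ap_rep[OF Idn_hom[OF a] f(1)] Cmp_Idn app_el[OF a f(1)])
qed

lemma el_eqD:
  assumes "M \<in> Obj Md" and "a \<in> Obj L" and "z \<in> FObj M a" and "z' \<in> FObj M a"
    and "el M a z = el M a z'"
  shows "z = z'"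
  using arg_cong[OF assms(5), of "\<lambda>t. app t a (arr_elem (Idn L a))"]
  by (simp only: app_el_Idn[OF assms(1,2,3)] app_el_Idn[OF assms(1,2,4)])

lemma Cmp_el:
  assumes t: "t \<in> hom Md M N" and a: "a \<in> Obj L" and z: "z \<in> FObj M a"
  shows "Cmp Md t (el M a z) = el N a (app t a z)"
proof -
  note M = Md.hom_Obj(1)[OF t]
  note e = el_hom[OF M a z]
  from yoneda[OF a Md.Cmp_hom[OF e t]] show ?thesis
    by (simp add: app_Cmp[OF e t a Idn_elem[OF a]] app_el_Idn[OF M a z])
qed

definition rep_arr where
  "rep_arr k = el (rep (Dom L k)) (Cod L k) (arr_elem k)"

lemma rep_arr_eq: "k \<in> hom L a b \<Longrightarrow> rep_arr k = el (rep a) b (arr_elem k)"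
  by (simp add: rep_arr_def hom_def)

lemma rep_arr_hom: "k \<in> hom L a b \<Longrightarrow> rep_arr k \<in> hom Md (rep b) (rep a)"
  using hom_Obj by (simp add: rep_arr_eq el_hom rep_Obj arr_elem_in_rep)

lemma el_rep_arr:
  assumes M: "M \<in> Obj Md" and k: "k \<in> hom L a b" and z: "z \<in> FObj M a"
  shows "Cmp Md (el M a z) (rep_arr k) = el M b (ap M k z)"
  using Cmp_el[OF el_hom[OF M hom_Obj(1)[OF k] z] hom_Obj(2)[OF k] arr_elem_in_rep[OF k]]
  by (simp add: rep_arr_eq[OF k] app_el[OF hom_Obj(1)[OF k] k])

lemma rep_arr_Idn: "a \<in> Obj L \<Longrightarrow> rep_arr (Idn L a) = Idn Md (rep a)"
  using yoneda[OF _ Md.Idn_hom[OF rep_Obj]] app_Idn[OF rep_Obj _ Idn_elem]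
  by (simp add: rep_arr_eq[OF Idn_hom])

lemma rep_arr_Cmp:
  assumes k: "k \<in> hom L a b" and l: "l \<in> hom L b c"
  shows "rep_arr (Cmp L l k) = Cmp Md (rep_arr k) (rep_arr l)"
  using el_rep_arr[OF rep_Obj l arr_elem_in_rep[OF k]] hom_Obj[OF k]
  by (simp add: rep_arr_eq[OF k] rep_arr_eq[OF Cmp_hom[OF k l]] ap_rep[OF k l])

definition Rep where "Rep = \<lparr>FObj = rep, FArr = rep_arr\<rparr>"

lemma Rep_simps [simp]: "FObj Rep a = rep a" "FArr Rep k = rep_arr k"
  by (simp_all add: Rep_def)

lemma is_functor_Rep: "is_functor (op_cat L) Md Rep"
  by (rule is_functorI) (simp_all add: rep_Obj rep_arr_hom rep_arr_Idn rep_arr_Cmp)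

text \<open>
  By the Yoneda lemma, homomorphisms from \<open>rep P\<close> to \<open>M\<close> are elements of \<open>M P\<close>, hence families in
  \<open>M X\<close>, hence families of homomorphisms from \<open>rep X\<close> to \<open>M\<close>.
\<close>

lemma is_comodel_Rep: "is_comodel U L X Md Rep"
  unfolding is_comodel_def Rep_simps
proof (intro allI impI)
  fix I :: "'u set" and P pr assume "small U I \<and> is_product L I (\<lambda>_. X) P pr"
  then have I: "small U I" and P: "is_product L I (\<lambda>_. X) P pr" by auto
  note pr = is_product_proj[OF P] and PO = is_product_Obj[OF P]
  show "is_coproduct Md I (\<lambda>_. rep X) (rep P) (\<lambda>i. rep_arr (pr i))"
  proof (rule is_coproductI)
    fix M q assume M: "M \<in> Obj Md" and q: "\<And>i. i \<in> I \<Longrightarrow> q i \<in> hom Md (rep X) M"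
    obtain m where m: "m \<in> FObj M P" "\<And>i. i \<in> I \<Longrightarrow> ap M (pr i) m = app (q i) X (arr_elem (Idn L X))"
      using unique_tuplesE[OF model_tuples[OF M I P], of "\<lambda>i. app (q i) X (arr_elem (Idn L X))"]
        Mod_hom_app(1)[OF q X_Obj Idn_elem[OF X_Obj]] by blast
    show "\<exists>h. h \<in> hom Md (rep P) M \<and> (\<forall>i\<in>I. Cmp Md h (rep_arr (pr i)) = q i)"
      using el_hom[OF M PO m(1)] el_rep_arr[OF M pr m(1)] m(2) yoneda[OF X_Obj q]
      by (intro exI[of _ "el M P m"]) simp
  next
    fix M h h' assume h: "h \<in> hom Md (rep P) M" and h': "h' \<in> hom Md (rep P) M"
      and eq: "\<And>i. i \<in> I \<Longrightarrow> Cmp Md h (rep_arr (pr i)) = Cmp Md h' (rep_arr (pr i))"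
    note M = Md.hom_Obj(2)[OF h]
    define m where "m = app h P (arr_elem (Idn L P))"
    define m' where "m' = app h' P (arr_elem (Idn L P))"
    have mP: "m \<in> FObj M P" "m' \<in> FObj M P"
      using Mod_hom_app(1)[OF h PO Idn_elem[OF PO]] Mod_hom_app(1)[OF h' PO Idn_elem[OF PO]]
      by (auto simp: m_def m'_def)
    have hm: "h = el M P m" "h' = el M P m'" unfolding m_def m'_def by (intro yoneda PO h h')+
    have "m = m'"
    proof (rule model_eqI[OF M I P mP])
      fix i assume i: "i \<in> I"
      have "el M X (ap M (pr i) m) = el M X (ap M (pr i) m')"
        using eq[OF i] unfolding hm el_rep_arr[OF M pr[OF i] mP(1)] el_rep_arr[OF M pr[OF i] mP(2)] .
      then show "ap M (pr i) m = ap M (pr i) m'"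
        by (rule el_eqD[OF M X_Obj model_ap[OF M pr[OF i] mP(1)] model_ap[OF M pr[OF i] mP(2)]])
    qed
    then show "h = h'" by (simp add: hm)
  qed (simp_all add: rep_Obj PO rep_arr_hom[OF pr])
qed

end

section \<open>Weighted cocones and presentations of models\<close>

context lawvere_theory
begin

text \<open>
  Cocones over the diagram of the objects \<open>N a\<close> indexed by the elements \<open>z\<close> of \<open>M a\<close>, for all \<open>a\<close>.
  A universal one is a colimit of \<open>N\<close> weighted by \<open>M\<close>, that is, the coend of the copowers
  \<open>M a \<cdot> N a\<close>.
\<close>

definition wcocone where
  "wcocone C N M c w \<longleftrightarrow> c \<in> Obj C \<and>
     (\<forall>a z. a \<in> Obj L \<longrightarrow> z \<in> FObj M a \<longrightarrow> w a z \<in> hom C (FObj N a) c) \<and>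
     (\<forall>a b k z. k \<in> hom L a b \<longrightarrow> z \<in> FObj M a \<longrightarrow> Cmp C (w a z) (FArr N k) = w b (ap M k z))"

definition wcolimit where
  "wcolimit C N M c w \<longleftrightarrow> wcocone C N M c w \<and> (\<forall>d v. wcocone C N M d v \<longrightarrow>
     (\<exists>!h. h \<in> hom C c d \<and> (\<forall>a z. a \<in> Obj L \<longrightarrow> z \<in> FObj M a \<longrightarrow> Cmp C h (w a z) = v a z)))"

text \<open>
  The model \<open>M\<close> is generated by \<open>m\<close>, and all equations between elements of \<open>M X\<close> written in
  terms of \<open>m\<close> follow from \<open>u m = v m\<close>. The consequences are expressed by arrows \<open>p\<close> of \<open>L\<close>, so they
  can be evaluated in every comodel, not just in models.
\<close>

definition presents where
  "presents M P Q u v m \<longleftrightarrow> u \<in> hom L P Q \<and> v \<in> hom L P Q \<and> m \<in> FObj M P \<and> ap M u m = ap M v m \<and>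
     (\<forall>a z. a \<in> Obj L \<longrightarrow> z \<in> FObj M a \<longrightarrow> (\<exists>f. f \<in> hom L P a \<and> ap M f m = z)) \<and>
     (\<forall>f g. f \<in> hom L P X \<longrightarrow> g \<in> hom L P X \<longrightarrow> ap M f m = ap M g m \<longrightarrow>
        (\<exists>p. p \<in> hom L Q X \<and> Cmp L p u = f \<and> Cmp L p v = g))"

lemma wcoconeD:
  assumes "wcocone C N M c w"
  shows "c \<in> Obj C" and "a \<in> Obj L \<Longrightarrow> z \<in> FObj M a \<Longrightarrow> w a z \<in> hom C (FObj N a) c"
    and "k \<in> hom L a b \<Longrightarrow> z \<in> FObj M a \<Longrightarrow> Cmp C (w a z) (FArr N k) = w b (ap M k z)"
  using assms unfolding wcocone_def by blast+

lemma wcoconeI: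
  assumes "c \<in> Obj C" and "\<And>a z. a \<in> Obj L \<Longrightarrow> z \<in> FObj M a \<Longrightarrow> w a z \<in> hom C (FObj N a) c"
    and "\<And>a b k z. k \<in> hom L a b \<Longrightarrow> z \<in> FObj M a \<Longrightarrow> Cmp C (w a z) (FArr N k) = w b (ap M k z)"
  shows "wcocone C N M c w"
  using assms unfolding wcocone_def by blast

lemma wcolimit_cocone: "wcolimit C N M c w \<Longrightarrow> wcocone C N M c w"
  by (simp add: wcolimit_def)

lemma wcolimit_desc:
  assumes "wcolimit C N M c w" and "wcocone C N M d v"
  obtains h where "h \<in> hom C c d" "\<And>a z. a \<in> Obj L \<Longrightarrow> z \<in> FObj M a \<Longrightarrow> Cmp C h (w a z) = v a z"
  using assms unfolding wcolimit_def by metis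

lemma presentsD:
  assumes "presents M P Q u v m"
  shows "u \<in> hom L P Q" "v \<in> hom L P Q" "m \<in> FObj M P" "ap M u m = ap M v m"
    and "a \<in> Obj L \<Longrightarrow> z \<in> FObj M a \<Longrightarrow> \<exists>f. f \<in> hom L P a \<and> ap M f m = z"
    and "f \<in> hom L P X \<Longrightarrow> g \<in> hom L P X \<Longrightarrow> ap M f m = ap M g m \<Longrightarrow>
      \<exists>p. p \<in> hom L Q X \<and> Cmp L p u = f \<and> Cmp L p v = g"
  using assms unfolding presents_def by simp_all

text \<open>
  Take all elements of \<open>M X\<close> as generators and all equations that hold between them as relations.
\<close>

lemma presentation_exists:
  assumes M: "M \<in> Obj Md"
  shows "\<exists>P Q u v m. presents M P Q u v m"
proof -
  note SX = model_small[OF M X_Obj]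
  obtain P pr where P: "is_product L (FObj M X) (\<lambda>_. X) P pr" using power_of_X[OF SX] .
  note PO = is_product_Obj[OF P] and pr = is_product_proj[OF P]
  obtain m where m: "m \<in> FObj M P" "\<And>x. x \<in> FObj M X \<Longrightarrow> ap M (pr x) m = x"
    using unique_tuplesE[OF set_model_tuples[OF Mod_set_model[OF M] SX P], of "\<lambda>x. x"] by blast
  \<comment> \<open>\<open>m\<close> is the universal family of generators, \<open>R\<close> the set of relations, and \<open>u\<close> and \<open>v\<close>
    collect the left-hand and right-hand sides.\<close>
  define R where "R = {(f, g). f \<in> hom L P X \<and> g \<in> hom L P X \<and> ap M f m = ap M g m}"
  have "small U (hom L P X \<times> hom L P X)"
    using locally_small PO X_Obj by (intro small_Sigma) (auto simp: locally_small_def)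
  then have "small U R" by (rule small_subset) (auto simp: R_def)
  then obtain Q q where Q: "is_product L R (\<lambda>_. X) Q q" by (rule power_of_X)
  note q = is_product_proj[OF Q]
  have fst: "fst r \<in> hom L P X" and snd: "snd r \<in> hom L P X" if "r \<in> R" for r
    using that by (auto simp: R_def)
  obtain u where u: "u \<in> hom L P Q" "\<And>r. r \<in> R \<Longrightarrow> Cmp L (q r) u = fst r"
    using is_product_tuple[OF Q PO, where q = fst, OF fst] by blast
  obtain v where v: "v \<in> hom L P Q" "\<And>r. r \<in> R \<Longrightarrow> Cmp L (q r) v = snd r"
    using is_product_tuple[OF Q PO, where q = snd, OF snd] by blast
  have "presents M P Q u v m"
    unfolding presents_def
  proof (intro conjI allI impI u(1) v(1) m(1))
    show "ap M u m = ap M v m"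
    proof (rule model_eqI[OF M \<open>small U R\<close> Q])
      fix r assume r: "r \<in> R"
      then have "ap M (fst r) m = ap M (snd r) m" by (auto simp: R_def)
      then show "ap M (q r) (ap M u m) = ap M (q r) (ap M v m)"
        using model_Cmp[OF M u(1) q[OF r] m(1)] model_Cmp[OF M v(1) q[OF r] m(1)] u(2)[OF r] v(2)[OF r]
        by simp
    qed (rule model_ap[OF M u(1) m(1)], rule model_ap[OF M v(1) m(1)])
  next
    fix a z assume a: "a \<in> Obj L" and z: "z \<in> FObj M a"
    obtain I :: "'u set" and p where I: "small U I" "is_product L I (\<lambda>_. X) a p"
      using Obj_power[OF a] .
    note p = is_product_proj[OF I(2)]
    have x: "ap M (p i) z \<in> FObj M X" if "i \<in> I" for i by (rule model_ap[OF M p[OF that] z])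
    obtain f where f: "f \<in> hom L P a" "\<And>i. i \<in> I \<Longrightarrow> Cmp L (p i) f = pr (ap M (p i) z)"
      using is_product_tuple[OF I(2) PO, where q = "\<lambda>i. pr (ap M (p i) z)", OF pr[OF x]] by blast
    have "ap M f m = z"
    proof (rule model_eqI[OF M I model_ap[OF M f(1) m(1)] z])
      fix i assume i: "i \<in> I"
      show "ap M (p i) (ap M f m) = ap M (p i) z"
        using model_Cmp[OF M f(1) p[OF i] m(1)] f(2)[OF i] m(2)[OF x[OF i]] by simp
    qed
    then show "\<exists>f. f \<in> hom L P a \<and> ap M f m = z" using f(1) by blast
  next
    fix f g assume "f \<in> hom L P X" "g \<in> hom L P X" "ap M f m = ap M g m"
    then have "(f, g) \<in> R" by (simp add: R_def)
    then show "\<exists>p. p \<in> hom L Q X \<and> Cmp L p u = f \<and> Cmp L p v = g"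
      using q u(2) v(2) by (intro exI[of _ "q (f, g)"]) simp
  qed
  then show ?thesis by blast
qed

text \<open>
  A weighted cocone on \<open>Rep\<close> with vertex \<open>K\<close> assigns to every element of \<open>M a\<close> a homomorphism from
  \<open>rep a\<close> to \<open>K\<close>, which by the Yoneda lemma is an element of \<open>K a\<close>; altogether this is a homomorphism
  from \<open>M\<close> to \<open>K\<close>.
\<close>

lemma wcolimit_density:
  assumes M: "M \<in> Obj Md" shows "wcolimit Md Rep M M (el M)"
  unfolding wcolimit_def
proof (intro conjI allI impI)
  show "wcocone Md Rep M M (el M)"
    by (rule wcoconeI) (simp_all add: M el_hom el_rep_arr)
  fix K w assume w: "wcocone Md Rep M K w"
  note K = wcoconeD(1)[OF w]
  have wh: "w a z \<in> hom Md (rep a) K" if "a \<in> Obj L" "z \<in> FObj M a" for a z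
    using wcoconeD(2)[OF w that] by simp
  define t where "t a z = app (w a z) a (arr_elem (Idn L a))" for a z
  have wel: "w a z = el K a (t a z)" "t a z \<in> FObj K a" if "a \<in> Obj L" "z \<in> FObj M a" for a z
    using yoneda[OF that(1) wh[OF that]] Mod_hom_app(1)[OF wh[OF that] that(1) Idn_elem[OF that(1)]]
    by (simp_all add: t_def)
  have t_hom: "mk_arr M K t \<in> hom Md M K"
  proof (rule mk_arr_hom[OF M K])
    show "nat_map (FObj M) (ap M) (FObj K) (ap K) t"
      unfolding nat_map_def
    proof (intro conjI allI impI)
      fix a b k z assume k: "k \<in> hom L a b" and z: "z \<in> FObj M a"
      note ab = hom_Obj[OF k] and kz = model_ap[OF M k z]
      note tz = wel[OF ab(1) z] and tkz = wel[OF ab(2) kz]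
      have "el K b (t b (ap M k z)) = el K b (ap K k (t a z))"
        using wcoconeD(3)[OF w k z] el_rep_arr[OF K k tz(2)] tz(1) tkz(1) by simp
      then show "t b (ap M k z) = ap K k (t a z)"
        by (rule el_eqD[OF K ab(2) tkz(2) model_ap[OF K k tz(2)]])
    qed (rule wel(2))
  qed
  show "\<exists>!h. h \<in> hom Md M K \<and> (\<forall>a z. a \<in> Obj L \<longrightarrow> z \<in> FObj M a \<longrightarrow> Cmp Md h (el M a z) = w a z)"
  proof (rule ex1I[of _ "mk_arr M K t"])
    show "mk_arr M K t \<in> hom Md M K \<and>
        (\<forall>a z. a \<in> Obj L \<longrightarrow> z \<in> FObj M a \<longrightarrow> Cmp Md (mk_arr M K t) (el M a z) = w a z)"
      using t_hom Cmp_el[OF t_hom] wel by (simp add: app_mk_arr)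
  next
    fix h assume h: "h \<in> hom Md M K \<and>
        (\<forall>a z. a \<in> Obj L \<longrightarrow> z \<in> FObj M a \<longrightarrow> Cmp Md h (el M a z) = w a z)"
    show "h = mk_arr M K t"
    proof (rule Mod_hom_eqI[OF _ t_hom])
      fix a z assume az: "a \<in> Obj L" "z \<in> FObj M a"
      have hh: "h \<in> hom Md M K" using h by blast
      have "el K a (app h a z) = el K a (t a z)"
        using h Cmp_el[OF hh az] wel(1)[OF az] az by simp
      then have "app h a z = t a z"
        by (rule el_eqD[OF K az(1) Mod_hom_app(1)[OF hh az] wel(2)[OF az]])
      then show "app h a z = app (mk_arr M K t) a z" using az by (simp add: app_mk_arr)
    qed (use h in blast)
  qed
qed

end

locale comodel = lawvere_theory U L X + C: category C
  for U :: "'u itself" and L :: "('o, 'a) cat" and X and C :: "('p, 'b) cat" +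
  fixes N :: "('o, 'a, 'p, 'b) fnctr"
  assumes N: "is_functor (op_cat L) C N" and N_comodel: "is_comodel U L X C N"
begin

lemma N_Obj: "a \<in> Obj L \<Longrightarrow> FObj N a \<in> Obj C"
  and N_hom: "k \<in> hom L a b \<Longrightarrow> FArr N k \<in> hom C (FObj N b) (FObj N a)"
  and N_Idn: "a \<in> Obj L \<Longrightarrow> FArr N (Idn L a) = Idn C (FObj N a)"
  and N_Cmp: "k \<in> hom L a b \<Longrightarrow> l \<in> hom L b c \<Longrightarrow> FArr N (Cmp L l k) = Cmp C (FArr N k) (FArr N l)"
  using is_functorD[OF N] by auto

lemma jointly_epi:
  assumes I: "small U (I :: 'u set)" and P: "is_product L I (\<lambda>_. X) P pr"
    and h: "h \<in> hom C (FObj N P) d" "h' \<in> hom C (FObj N P) d"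
    and eq: "\<And>i. i \<in> I \<Longrightarrow> Cmp C h (FArr N (pr i)) = Cmp C h' (FArr N (pr i))"
  shows "h = h'"
proof -
  have "is_coproduct C I (\<lambda>_. FObj N X) (FObj N P) (\<lambda>i. FArr N (pr i))"
    using N_comodel I P unfolding is_comodel_def by simp
  then have "\<exists>!k. k \<in> hom C (FObj N P) d \<and>
      (\<forall>i\<in>I. Cmp C k (FArr N (pr i)) = Cmp C h (FArr N (pr i)))"
    using C.Cmp_hom[OF N_hom[OF is_product_proj[OF P]] h(1)] C.hom_Obj(2)[OF h(1)]
    unfolding is_coproduct_def by simp
  then show ?thesis using h eq by (metis (full_types))
qed

lemma wcocone_generated:
  "presents M P Q u v m \<Longrightarrow> wcocone C N M c w \<Longrightarrow> f \<in> hom L P a \<Longrightarrow>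
    w a (ap M f m) = Cmp C (w P m) (FArr N f)"
  by (rule wcoconeD(3)[symmetric, OF _ _ presentsD(3)])

lemma wcocone_coequalizes:
  "presents M P Q u v m \<Longrightarrow> wcocone C N M c w \<Longrightarrow>
    Cmp C (w P m) (FArr N u) = Cmp C (w P m) (FArr N v)"
  using wcocone_generated presentsD(1,2,4) by metis

text \<open>
  At an element \<open>f m\<close> the cocone has to be \<open>w\<close> after \<open>N f\<close>. This does not depend on the
  choice of \<open>f\<close>: for arrows into \<open>X\<close> because all relations follow from \<open>u m = v m\<close>, and in general
  because every object is a power of \<open>X\<close> and \<open>N\<close> turns its projections into a jointly epic family.
\<close>

lemma wcocone_of_coequalizing:
  assumes M: "M \<in> Obj Md" and pres: "presents M P Q u v m"
    and w: "w \<in> hom C (FObj N P) c" "Cmp C w (FArr N u) = Cmp C w (FArr N v)"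
  shows "\<exists>W. wcocone C N M c W \<and> W P m = w"
proof -
  note p = presentsD[OF pres]
  have PO: "P \<in> Obj L" by (rule hom_Obj(1)[OF p(1)])
  have wd_X: "Cmp C w (FArr N f) = Cmp C w (FArr N g)"
    if fg: "f \<in> hom L P X" "g \<in> hom L P X" "ap M f m = ap M g m" for f g
  proof -
    obtain r where r: "r \<in> hom L Q X" "Cmp L r u = f" "Cmp L r v = g" using p(6)[OF fg] by blast
    have "Cmp C w (FArr N f) = Cmp C (Cmp C w (FArr N u)) (FArr N r)"
      using C.Cmp_assoc[OF N_hom[OF r(1)] N_hom[OF p(1)] w(1)] N_Cmp[OF p(1) r(1)] r(2) by simp
    also have "\<dots> = Cmp C w (FArr N g)"
      using C.Cmp_assoc[OF N_hom[OF r(1)] N_hom[OF p(2)] w(1)] N_Cmp[OF p(2) r(1)] r(3) w(2) by simp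
    finally show ?thesis .
  qed
  have wd: "Cmp C w (FArr N f) = Cmp C w (FArr N g)"
    if f: "f \<in> hom L P a" and g: "g \<in> hom L P a" and eq: "ap M f m = ap M g m" for f g a
  proof -
    obtain I :: "'u set" and q where I: "small U I" "is_product L I (\<lambda>_. X) a q"
      using Obj_power[OF hom_Obj(2)[OF f]] .
    show ?thesis
    proof (rule jointly_epi[OF I C.Cmp_hom[OF N_hom[OF f] w(1)] C.Cmp_hom[OF N_hom[OF g] w(1)]])
      fix i assume "i \<in> I"
      note q = is_product_proj[OF I(2) this]
      have "Cmp C w (FArr N (Cmp L (q i) f)) = Cmp C w (FArr N (Cmp L (q i) g))"
        by (rule wd_X[OF Cmp_hom[OF f q] Cmp_hom[OF g q]])
          (simp add: model_Cmp[OF M f q p(3)] model_Cmp[OF M g q p(3)] eq)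
      then show "Cmp C (Cmp C w (FArr N f)) (FArr N (q i)) = Cmp C (Cmp C w (FArr N g)) (FArr N (q i))"
        using C.Cmp_assoc[OF N_hom[OF q] N_hom[OF f] w(1)] C.Cmp_assoc[OF N_hom[OF q] N_hom[OF g] w(1)]
        by (simp add: N_Cmp[OF f q] N_Cmp[OF g q])
    qed
  qed
  define lift where "lift a z = (SOME f. f \<in> hom L P a \<and> ap M f m = z)" for a z
  have lift: "lift a z \<in> hom L P a" "ap M (lift a z) m = z" if "a \<in> Obj L" "z \<in> FObj M a" for a z
    using someI_ex[OF p(5)[OF that]] by (simp_all add: lift_def)
  define W where "W a z = Cmp C w (FArr N (lift a z))" for a z
  have W: "W a (ap M f m) = Cmp C w (FArr N f)" if f: "f \<in> hom L P a" for f a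
    unfolding W_def using lift[OF hom_Obj(2)[OF f] model_ap[OF M f p(3)]] f by (intro wd)
  have "wcocone C N M c W"
  proof (rule wcoconeI)
    fix a b k z assume k: "k \<in> hom L a b" and z: "z \<in> FObj M a"
    obtain f where f: "f \<in> hom L P a" "ap M f m = z" using p(5)[OF hom_Obj(1)[OF k] z] by blast
    have "Cmp C (Cmp C w (FArr N f)) (FArr N k) = Cmp C w (FArr N (Cmp L k f))"
      using C.Cmp_assoc[OF N_hom[OF k] N_hom[OF f(1)] w(1)] by (simp add: N_Cmp[OF f(1) k])
    then show "Cmp C (W a z) (FArr N k) = W b (ap M k z)"
      using W[OF f(1)] W[OF Cmp_hom[OF f(1) k]] model_Cmp[OF M f(1) k p(3)] f(2) by simp
  qed (use C.hom_Obj(2)[OF w(1)] C.Cmp_hom[OF N_hom[OF lift(1)] w(1)] in \<open>auto simp: W_def\<close>)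
  moreover have "W P m = w"
    using W[OF Idn_hom[OF PO]] model_Idn[OF M PO p(3)] N_Idn[OF PO] C.Cmp_Idn[OF w(1)] by simp
  ultimately show ?thesis by blast
qed

text \<open>
  Evaluation at \<open>m\<close> identifies weighted cocones with arrows out of \<open>N P\<close> that coequalize \<open>N u\<close> and
  \<open>N v\<close>, compatibly with arrows between vertices.
\<close>

lemma wcolimit_iff_coequalizer:
  assumes M: "M \<in> Obj Md" and pres: "presents M P Q u v m" and w: "wcocone C N M c w"
  shows "wcolimit C N M c w \<longleftrightarrow>
    is_coequalizer C (FObj N Q) (FObj N P) (FArr N u) (FArr N v) c (w P m)"
proof -
  note p = presentsD[OF pres]
  have PO: "P \<in> Obj L" by (rule hom_Obj(1)[OF p(1)])
  have fac: "(\<forall>a z. a \<in> Obj L \<longrightarrow> z \<in> FObj M a \<longrightarrow> Cmp C h (w a z) = W a z) \<longleftrightarrow>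
      Cmp C h (w P m) = W P m" if h: "h \<in> hom C c d" and W: "wcocone C N M d W" for h d W
  proof (intro iffI allI impI)
    fix a z assume eq: "Cmp C h (w P m) = W P m" and a: "a \<in> Obj L" and z: "z \<in> FObj M a"
    obtain f where f: "f \<in> hom L P a" "ap M f m = z" using p(5)[OF a z] by blast
    show "Cmp C h (w a z) = W a z"
      using wcocone_generated[OF pres w f(1)] wcocone_generated[OF pres W f(1)]
        C.Cmp_assoc[OF N_hom[OF f(1)] wcoconeD(2)[OF w PO p(3)] h] eq f(2) by simp
  qed (simp add: PO p(3))
  show ?thesis
  proof
    assume wc: "wcolimit C N M c w"
    show "is_coequalizer C (FObj N Q) (FObj N P) (FArr N u) (FArr N v) c (w P m)"
      unfolding is_coequalizer_def
    proof (intro conjI allI impI)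
      fix d x assume x: "x \<in> hom C (FObj N P) d" "Cmp C x (FArr N u) = Cmp C x (FArr N v)"
      obtain W where W: "wcocone C N M d W" "W P m = x"
        using wcocone_of_coequalizing[OF M pres x] by blast
      then have "\<exists>!h. h \<in> hom C c d \<and>
          (\<forall>a z. a \<in> Obj L \<longrightarrow> z \<in> FObj M a \<longrightarrow> Cmp C h (w a z) = W a z)"
        using wc unfolding wcolimit_def by simp
      then show "\<exists>!h. h \<in> hom C c d \<and> Cmp C h (w P m) = x"
        using fac[OF _ W(1)] W(2) by (simp cong: conj_cong)
    qed (use wcoconeD(2)[OF w PO p(3)] wcocone_coequalizes[OF pres w] in auto)
  next
    assume coeq: "is_coequalizer C (FObj N Q) (FObj N P) (FArr N u) (FArr N v) c (w P m)"
    show "wcolimit C N M c w"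
      unfolding wcolimit_def
    proof (intro conjI allI impI w)
      fix d W assume W: "wcocone C N M d W"
      have "\<exists>!h. h \<in> hom C c d \<and> Cmp C h (w P m) = W P m"
        using coeq wcoconeD(2)[OF W PO p(3)] wcocone_coequalizes[OF pres W]
        unfolding is_coequalizer_def by simp
      then show "\<exists>!h. h \<in> hom C c d \<and>
          (\<forall>a z. a \<in> Obj L \<longrightarrow> z \<in> FObj M a \<longrightarrow> Cmp C h (w a z) = W a z)"
        using fac[OF _ W] by (simp cong: conj_cong)
    qed
  qed
qed

lemma wcolimit_exists:
  assumes "cocomplete_category U C" and M: "M \<in> Obj Md"
  shows "\<exists>c w. wcolimit C N M c w"
proof -
  obtain P Q u v m where pres: "presents M P Q u v m" using presentation_exists[OF M] by blast
  obtain c x where x: "is_coequalizer C (FObj N Q) (FObj N P) (FArr N u) (FArr N v) c x"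
    using coequalizer_exists[OF assms(1) N_hom[OF presentsD(1)[OF pres]] N_hom[OF presentsD(2)[OF pres]]]
    by blast
  then obtain w where w: "wcocone C N M c w" "w P m = x"
    using wcocone_of_coequalizing[OF M pres, of x c] unfolding is_coequalizer_def by blast
  then have "wcolimit C N M c w" using wcolimit_iff_coequalizer[OF M pres w(1)] x by simp
  then show ?thesis by blast
qed

lemma wcocone_post:
  assumes h: "h \<in> hom C c d" and w: "wcocone C N M c w"
  shows "wcocone C N M d (\<lambda>a z. Cmp C h (w a z))"
proof (rule wcoconeI)
  fix a b k z assume k: "k \<in> hom L a b" and z: "z \<in> FObj M a"
  show "Cmp C (Cmp C h (w a z)) (FArr N k) = Cmp C h (w b (ap M k z))"
    using C.Cmp_assoc[OF N_hom[OF k] wcoconeD(2)[OF w hom_Obj(1)[OF k] z] h] wcoconeD(3)[OF w k z]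
    by simp
qed (use C.hom_Obj(2)[OF h] C.Cmp_hom[OF wcoconeD(2)[OF w] h] in auto)

lemma wcolimit_eqI:
  assumes w: "wcolimit C N M c w" and h: "h \<in> hom C c d" "h' \<in> hom C c d"
    and eq: "\<And>a z. a \<in> Obj L \<Longrightarrow> z \<in> FObj M a \<Longrightarrow> Cmp C h (w a z) = Cmp C h' (w a z)"
  shows "h = h'"
proof -
  have "\<exists>!k. k \<in> hom C c d \<and>
      (\<forall>a z. a \<in> Obj L \<longrightarrow> z \<in> FObj M a \<longrightarrow> Cmp C k (w a z) = Cmp C h (w a z))"
    using w wcocone_post[OF h(1) wcolimit_cocone[OF w]] unfolding wcolimit_def by simp
  then show ?thesis using h eq by (metis (full_types))
qed

end

section \<open>Restriction to free models\<close>

locale cocomplete_target = lawvere_theory U L X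
  for U :: "'u itself" and L :: "('o, 'a) cat" and X +
  fixes C :: "('p, 'b) cat"
  assumes cocomplete: "cocomplete_category U C"
begin

sublocale C: category C using cocomplete by (simp add: cocomplete_category_def)

abbreviation HomC where "HomC \<equiv> Hom_c U Md C"
abbreviation ModC where "ModC \<equiv> Mod_op U C L X"

lemma category_HomC: "category HomC"
  unfolding Hom_c_def
  by (intro category_full_subcategory category_functor_category category_Mod C.category_axioms)

lemma category_ModC: "category ModC"
  unfolding Mod_op_def
  by (intro category_full_subcategory category_functor_category category_op category_axioms
      C.category_axioms)

lemma HomC_Obj: "G \<in> Obj HomC \<longleftrightarrow> G \<in> functor_objects Md C \<and> cocontinuous U Md C G"
  by (simp add: Hom_c_def functor_category_simps)

lemma ModC_Obj: "N \<in> Obj ModC \<longleftrightarrow> N \<in> functor_objects (op_cat L) C \<and> is_comodel U L X C N"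
  by (simp add: Mod_op_def functor_category_simps)

lemma HomC_hom: "\<alpha> \<in> hom HomC G G' \<longleftrightarrow> G \<in> Obj HomC \<and> G' \<in> Obj HomC \<and>
    (\<exists>t. \<alpha> = (G, G', t) \<and> nat_trans Md C G G' t \<and> t \<in> extensional (Obj Md))"
  unfolding HomC_Obj by (auto simp: Hom_c_def hom_full_subcategory_iff hom_functor_category)

lemma ModC_hom: "\<alpha> \<in> hom ModC N N' \<longleftrightarrow> N \<in> Obj ModC \<and> N' \<in> Obj ModC \<and>
    (\<exists>t. \<alpha> = (N, N', t) \<and> nat_trans (op_cat L) C N N' t \<and> t \<in> extensional (Obj L))"
  unfolding ModC_Obj by (auto simp: Mod_op_def hom_full_subcategory_iff hom_functor_category)

lemma HomC_simps: "Idn HomC G = (G, G, \<lambda>M\<in>Obj Md. Idn C (FObj G M))"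
  "Cmp HomC (G', H, s) (F, G, t) = (F, H, \<lambda>M\<in>Obj Md. Cmp C (s M) (t M))"
  by (simp_all add: Hom_c_def functor_category_simps)

lemma ModC_simps: "Idn ModC N = (N, N, \<lambda>a\<in>Obj L. Idn C (FObj N a))"
  "Cmp ModC (N', K, s) (F, N, t) = (F, K, \<lambda>a\<in>Obj L. Cmp C (s a) (t a))"
  by (simp_all add: Mod_op_def functor_category_simps)

lemma comodel_ModC: "N \<in> Obj ModC \<Longrightarrow> comodel U L X C N"
  using is_functor_object ModC_Obj
  by (intro comodel.intro comodel_axioms.intro lawvere_theory_axioms C.category_axioms) auto

text \<open>
  The composite of \<open>G\<close> with the Yoneda embedding, made extensional as an object of \<open>ModC\<close> has to be.
\<close>

definition restr where
  "restr G = \<lparr>FObj = (\<lambda>a\<in>Obj L. FObj G (rep a)), FArr = (\<lambda>k\<in>Arr L. FArr G (rep_arr k))\<rparr>"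

lemma restr_simps [simp]:
  "a \<in> Obj L \<Longrightarrow> FObj (restr G) a = FObj G (rep a)"
  "k \<in> hom L a b \<Longrightarrow> FArr (restr G) k = FArr G (rep_arr k)"
  by (auto simp: restr_def hom_def)

lemma restr_ModC:
  assumes G: "G \<in> Obj HomC"
  shows "restr G \<in> Obj ModC"
proof -
  have F: "is_functor Md C G" and cc: "cocontinuous U Md C G"
    using G by (auto simp: HomC_Obj is_functor_object)
  have "is_functor (op_cat L) C (restr G)"
  proof (rule is_functorI)
    fix k a b assume "k \<in> hom (op_cat L) a b"
    then have k: "k \<in> hom L b a" by simp
    show "FArr (restr G) k \<in> hom C (FObj (restr G) a) (FObj (restr G) b)"
      using is_functorD(2)[OF F rep_arr_hom[OF k]] hom_Obj[OF k] k by simp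
  next
    fix a assume "a \<in> Obj (op_cat L)"
    then show "FArr (restr G) (Idn (op_cat L) a) = Idn C (FObj (restr G) a)"
      using is_functorD(3)[OF F rep_Obj] by (simp add: restr_simps(2)[OF Idn_hom] rep_arr_Idn)
  next
    fix k l a b c assume "k \<in> hom (op_cat L) a b" "l \<in> hom (op_cat L) b c"
    then have k: "k \<in> hom L b a" and l: "l \<in> hom L c b" by auto
    show "FArr (restr G) (Cmp (op_cat L) l k) = Cmp C (FArr (restr G) l) (FArr (restr G) k)"
      using is_functorD(4)[OF F rep_arr_hom[OF k] rep_arr_hom[OF l]]
      by (simp add: restr_simps(2)[OF Cmp_hom[OF l k]] restr_simps(2)[OF k] restr_simps(2)[OF l]
          rep_arr_Cmp[OF l k])
  qed (simp add: is_functorD(1)[OF F rep_Obj])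
  moreover have "is_comodel U L X C (restr G)"
    unfolding is_comodel_def
  proof (intro allI impI)
    fix I :: "'u set" and P pr assume "small U I \<and> is_product L I (\<lambda>_. X) P pr"
    then have I: "small U I" and P: "is_product L I (\<lambda>_. X) P pr" by auto
    have "is_coproduct Md I (\<lambda>_. rep X) (rep P) (\<lambda>i. rep_arr (pr i))"
      using is_comodel_Rep I P by (simp add: is_comodel_def)
    from cocontinuous_copower[OF category_Mod C.category_axioms F cc I rep_Obj[OF X_Obj] this]
    show "is_coproduct C I (\<lambda>_. FObj (restr G) X) (FObj (restr G) P) (\<lambda>i. FArr (restr G) (pr i))"
      using is_product_Obj[OF P] is_product_proj[OF P] X_Obj
      by (simp add: is_coproduct_def restr_simps(2)[of _ P X])
  qed
  ultimately show ?thesis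
    unfolding ModC_Obj by (auto intro!: functor_objectsI simp: restr_def)
qed

text \<open>
  The model \<open>M\<close> is the weighted colimit of \<open>Rep\<close>, hence a coequalizer of representables. This
  small colimit is preserved by \<open>G\<close>, and read backwards for the comodel \<open>restr G\<close> it is a weighted
  colimit again.
\<close>

lemma wcolimit_restr:
  assumes G: "G \<in> Obj HomC" and M: "M \<in> Obj Md"
  shows "wcolimit C (restr G) M (FObj G M) (\<lambda>a z. FArr G (el M a z))"
proof -
  have F: "is_functor Md C G" and cc: "cocontinuous U Md C G"
    using G by (auto simp: HomC_Obj is_functor_object)
  interpret Rep: comodel U L X Md Rep
    by (intro comodel.intro comodel_axioms.intro lawvere_theory_axioms category_Mod
        is_functor_Rep is_comodel_Rep)
  interpret comodel U L X C "restr G" by (rule comodel_ModC[OF restr_ModC[OF G]])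
  obtain P Q u v m where pres: "presents M P Q u v m" using presentation_exists[OF M] by blast
  note p = presentsD[OF pres]
  have "is_coequalizer Md (rep Q) (rep P) (rep_arr u) (rep_arr v) M (el M P m)"
    using Rep.wcolimit_iff_coequalizer[OF M pres wcolimit_cocone[OF wcolimit_density[OF M]]]
      wcolimit_density[OF M] by simp
  from cocontinuous_coequalizer[OF category_Mod C.category_axioms F cc
      rep_arr_hom[OF p(1)] rep_arr_hom[OF p(2)] this]
  have "is_coequalizer C (FObj (restr G) Q) (FObj (restr G) P) (FArr (restr G) u) (FArr (restr G) v)
      (FObj G M) (FArr G (el M P m))"
    using p(1,2) hom_Obj[OF p(1)] by simp
  moreover have "wcocone C (restr G) M (FObj G M) (\<lambda>a z. FArr G (el M a z))"
  proof (rule wcoconeI)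
    fix a b k z assume k: "k \<in> hom L a b" and z: "z \<in> FObj M a"
    show "Cmp C (FArr G (el M a z)) (FArr (restr G) k) = FArr G (el M b (ap M k z))"
      using is_functorD(4)[OF F rep_arr_hom[OF k] el_hom[OF M hom_Obj(1)[OF k] z]]
        el_rep_arr[OF M k z] k by simp
  qed (use is_functorD(1,2)[OF F] M el_hom in auto)
  ultimately show ?thesis by (simp add: wcolimit_iff_coequalizer[OF M pres])
qed

definition restriction where
  "restriction = \<lparr>FObj = restr, FArr = (\<lambda>(G, G', t). (restr G, restr G', \<lambda>a\<in>Obj L. t (rep a)))\<rparr>"

lemma restriction_simps [simp]:
  "FObj restriction G = restr G"
  "FArr restriction (G, G', t) = (restr G, restr G', \<lambda>a\<in>Obj L. t (rep a))"
  by (simp_all add: restriction_def)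

lemma is_functor_restriction: "is_functor HomC ModC restriction"
proof (rule is_functorI)
  fix \<alpha> G G' assume "\<alpha> \<in> hom HomC G G'"
  then obtain t where t: "\<alpha> = (G, G', t)" "nat_trans Md C G G' t"
    and G: "G \<in> Obj HomC" "G' \<in> Obj HomC" by (auto simp: HomC_hom)
  have "nat_trans (op_cat L) C (restr G) (restr G') (\<lambda>a. t (rep a))"
  proof (rule nat_transI)
    fix k a b assume "k \<in> hom (op_cat L) a b"
    then have k: "k \<in> hom L b a" by simp
    show "Cmp C (t (rep b)) (FArr (restr G) k) = Cmp C (FArr (restr G') k) (t (rep a))"
      using nat_transD(2)[OF t(2) rep_arr_hom[OF k]] k by simp
  qed (use nat_transD(1)[OF t(2) rep_Obj] in simp)
  then show "FArr restriction \<alpha> \<in> hom ModC (FObj restriction G) (FObj restriction G')"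
    using restr_ModC[OF G(1)] restr_ModC[OF G(2)]
      nat_trans_restrict[OF category_op[OF category_axioms], of C "restr G" "restr G'"]
    by (simp add: ModC_hom t(1))
next
  fix \<alpha> \<beta> G G' G'' assume "\<alpha> \<in> hom HomC G G'" "\<beta> \<in> hom HomC G' G''"
  then obtain t s where "\<alpha> = (G, G', t)" "\<beta> = (G', G'', s)" by (auto simp: HomC_hom)
  then show "FArr restriction (Cmp HomC \<beta> \<alpha>) = Cmp ModC (FArr restriction \<beta>) (FArr restriction \<alpha>)"
    using rep_Obj by (auto simp: HomC_simps ModC_simps intro!: restrict_ext)
qed (use rep_Obj in \<open>auto simp: restr_ModC HomC_simps ModC_simps intro!: restrict_ext\<close>)

text \<open>
  Since \<open>G M\<close> is the colimit of \<open>restr G\<close> weighted by \<open>M\<close>, a transformation between the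
  restrictions induces arrows from \<open>G M\<close> to \<open>G' M\<close>, and any equation between arrows out of \<open>G M\<close>,
  such as naturality or uniqueness, can be checked on the legs.
\<close>

lemma restriction_fully_faithful:
  assumes G: "G \<in> Obj HomC" and G': "G' \<in> Obj HomC"
    and \<sigma>: "\<sigma> \<in> hom ModC (restr G) (restr G')"
  shows "\<exists>!\<alpha>. \<alpha> \<in> hom HomC G G' \<and> FArr restriction \<alpha> = \<sigma>"
proof -
  have F: "is_functor Md C G" and F': "is_functor Md C G'"
    using G G' by (auto simp: HomC_Obj is_functor_object)
  interpret comodel U L X C "restr G" by (rule comodel_ModC[OF restr_ModC[OF G]])
  obtain s where s: "\<sigma> = (restr G, restr G', s)" "nat_trans (op_cat L) C (restr G) (restr G') s"
      "s \<in> extensional (Obj L)"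
    using \<sigma> by (auto simp: ModC_hom)
  have s_hom: "s a \<in> hom C (FObj G (rep a)) (FObj G' (rep a))" if "a \<in> Obj L" for a
    using nat_transD(1)[OF s(2)] that by simp
  have s_nat: "Cmp C (s a) (FArr G (rep_arr k)) = Cmp C (FArr G' (rep_arr k)) (s b)"
    if "k \<in> hom L a b" for k a b
    using nat_transD(2)[OF s(2), of k b a] that by simp
  have Gel: "FArr G (el M a z) \<in> hom C (FObj G (rep a)) (FObj G M)"
    and G'el: "FArr G' (el M a z) \<in> hom C (FObj G' (rep a)) (FObj G' M)"
    if "M \<in> Obj Md" "a \<in> Obj L" "z \<in> FObj M a" for M a z
    using is_functorD(2)[OF F el_hom[OF that]] is_functorD(2)[OF F' el_hom[OF that]] .
  note wc = wcolimit_restr[OF G]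
  have cocone: "wcocone C (restr G) M (FObj G' M) (\<lambda>a z. Cmp C (FArr G' (el M a z)) (s a))"
    if M: "M \<in> Obj Md" for M
  proof (rule wcoconeI)
    fix a b k z assume k: "k \<in> hom L a b" and z: "z \<in> FObj M a"
    note ab = hom_Obj[OF k]
    note G'e = G'el[OF M ab(1) z] and G'k = is_functorD(2)[OF F' rep_arr_hom[OF k]]
    show "Cmp C (Cmp C (FArr G' (el M a z)) (s a)) (FArr (restr G) k) =
        Cmp C (FArr G' (el M b (ap M k z))) (s b)"
      using C.Cmp_assoc[OF is_functorD(2)[OF F rep_arr_hom[OF k]] s_hom[OF ab(1)] G'e]
        C.Cmp_assoc[OF s_hom[OF ab(2)] G'k G'e] s_nat[OF k] k
        is_functorD(4)[OF F' rep_arr_hom[OF k] el_hom[OF M ab(1) z]] el_rep_arr[OF M k z]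
      by simp
  qed (use is_functorD(1)[OF F' M] C.Cmp_hom[OF s_hom G'el[OF M]] in auto)
  have "\<exists>h. h \<in> hom C (FObj G M) (FObj G' M) \<and> (\<forall>a z. a \<in> Obj L \<longrightarrow> z \<in> FObj M a \<longrightarrow>
      Cmp C h (FArr G (el M a z)) = Cmp C (FArr G' (el M a z)) (s a))" if M: "M \<in> Obj Md" for M
    using wcolimit_desc[OF wc[OF M] cocone[OF M]] by metis
  then obtain t where t: "\<And>M. M \<in> Obj Md \<Longrightarrow> t M \<in> hom C (FObj G M) (FObj G' M)"
    and t_el: "\<And>M a z. M \<in> Obj Md \<Longrightarrow> a \<in> Obj L \<Longrightarrow> z \<in> FObj M a \<Longrightarrow>
      Cmp C (t M) (FArr G (el M a z)) = Cmp C (FArr G' (el M a z)) (s a)"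
    by metis
  have t_rep: "t (rep a) = s a" if a: "a \<in> Obj L" for a
  proof -
    have el: "el (rep a) a (arr_elem (Idn L a)) = Idn Md (rep a)"
      using rep_arr_Idn[OF a] rep_arr_eq[OF Idn_hom[OF a]] by simp
    have "Cmp C (t (rep a)) (Idn C (FObj G (rep a))) = Cmp C (Idn C (FObj G' (rep a))) (s a)"
      using t_el[OF rep_Obj[OF a] a Idn_elem[OF a]]
      unfolding el is_functorD(3)[OF F rep_Obj[OF a]] is_functorD(3)[OF F' rep_Obj[OF a]] .
    then show ?thesis
      using C.Cmp_Idn[OF t[OF rep_Obj[OF a]]] C.Idn_Cmp[OF s_hom[OF a]] by simp
  qed
  have t_nat: "nat_trans Md C G G' t"
  proof (rule nat_transI[OF t])
    fix h M K assume h: "h \<in> hom Md M K"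
    note M = Md.hom_Obj(1)[OF h] and K = Md.hom_Obj(2)[OF h]
    note Gh = is_functorD(2)[OF F h] and G'h = is_functorD(2)[OF F' h]
    show "Cmp C (t K) (FArr G h) = Cmp C (FArr G' h) (t M)"
    proof (rule wcolimit_eqI[OF wc[OF M] C.Cmp_hom[OF Gh t[OF K]] C.Cmp_hom[OF t[OF M] G'h]])
      fix a z assume a: "a \<in> Obj L" and z: "z \<in> FObj M a"
      note hz = Mod_hom_app(1)[OF h a z]
      have "Cmp C (Cmp C (t K) (FArr G h)) (FArr G (el M a z)) = Cmp C (t K) (FArr G (el K a (app h a z)))"
        using C.Cmp_assoc[OF Gel[OF M a z] Gh t[OF K]] is_functorD(4)[OF F el_hom[OF M a z] h]
          Cmp_el[OF h a z] by simp
      also have "\<dots> = Cmp C (FArr G' (Cmp Md h (el M a z))) (s a)"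
        using t_el[OF K a hz] Cmp_el[OF h a z] by simp
      also have "\<dots> = Cmp C (FArr G' h) (Cmp C (FArr G' (el M a z)) (s a))"
        using C.Cmp_assoc[OF s_hom[OF a] G'el[OF M a z] G'h] is_functorD(4)[OF F' el_hom[OF M a z] h]
        by simp
      also have "\<dots> = Cmp C (Cmp C (FArr G' h) (t M)) (FArr G (el M a z))"
        using C.Cmp_assoc[OF Gel[OF M a z] t[OF M] G'h] t_el[OF M a z] by simp
      finally show "Cmp C (Cmp C (t K) (FArr G h)) (FArr G (el M a z)) =
          Cmp C (Cmp C (FArr G' h) (t M)) (FArr G (el M a z))" .
    qed
  qed
  show ?thesis
  proof (rule ex1I[of _ "(G, G', restrict t (Obj Md))"])
    have "(\<lambda>a\<in>Obj L. restrict t (Obj Md) (rep a)) = s"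
      using s(3) t_rep rep_Obj by (auto intro!: extensionalityI[of _ "Obj L"])
    then show "(G, G', restrict t (Obj Md)) \<in> hom HomC G G' \<and>
        FArr restriction (G, G', restrict t (Obj Md)) = \<sigma>"
      using G G' t_nat nat_trans_restrict[OF category_Mod, of C G G'] s(1) by (simp add: HomC_hom)
  next
    fix \<beta> assume \<beta>: "\<beta> \<in> hom HomC G G' \<and> FArr restriction \<beta> = \<sigma>"
    then obtain r where r: "\<beta> = (G, G', r)" "nat_trans Md C G G' r" "r \<in> extensional (Obj Md)"
      by (auto simp: HomC_hom)
    have "(\<lambda>a\<in>Obj L. r (rep a)) = s" using \<beta> r(1) s(1) by simp
    then have r_rep: "r (rep a) = s a" if "a \<in> Obj L" for a using that by (metis restrict_apply')
    have "r M = t M" if M: "M \<in> Obj Md" for M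
    proof (rule wcolimit_eqI[OF wc[OF M] nat_transD(1)[OF r(2) M] t[OF M]])
      fix a z assume a: "a \<in> Obj L" and z: "z \<in> FObj M a"
      show "Cmp C (r M) (FArr G (el M a z)) = Cmp C (t M) (FArr G (el M a z))"
        using nat_transD(2)[OF r(2) el_hom[OF M a z]] t_el[OF M a z] r_rep[OF a] by simp
    qed
    then show "\<beta> = (G, G', restrict t (Obj Md))"
      using r(1,3) by (auto intro!: extensionalityI[of _ "Obj Md"])
  qed
qed

end

section \<open>Extending a comodel to a cocontinuous functor\<close>

locale comodel_extension = cocomplete_target U L X C + comodel U L X C N
  for U :: "'u itself" and L :: "('o, 'a) cat" and X and C :: "('p, 'b) cat" and N
begin

definition ext_obj where "ext_obj M = (SOME c. \<exists>w. wcolimit C N M c w)"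

definition leg where "leg M = (SOME w. wcolimit C N M (ext_obj M) w)"

lemma ext_wcolimit: "M \<in> Obj Md \<Longrightarrow> wcolimit C N M (ext_obj M) (leg M)"
  unfolding leg_def ext_obj_def by (rule someI_ex[OF someI_ex[OF wcolimit_exists[OF cocomplete]]])

lemmas ext_cocone = wcolimit_cocone[OF ext_wcolimit]

lemma leg_hom: "M \<in> Obj Md \<Longrightarrow> a \<in> Obj L \<Longrightarrow> z \<in> FObj M a \<Longrightarrow> leg M a z \<in> hom C (FObj N a) (ext_obj M)"
  by (rule wcoconeD(2)[OF ext_cocone])

lemma ext_obj_Obj: "M \<in> Obj Md \<Longrightarrow> ext_obj M \<in> Obj C"
  by (rule wcoconeD(1)[OF ext_cocone])

lemma wcocone_along:
  assumes t: "t \<in> hom Md M K" and v: "wcocone C N K d v"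
  shows "wcocone C N M d (\<lambda>a z. v a (app t a z))"
proof (rule wcoconeI)
  fix a b k z assume k: "k \<in> hom L a b" and z: "z \<in> FObj M a"
  show "Cmp C (v a (app t a z)) (FArr N k) = v b (app t b (ap M k z))"
    using wcoconeD(3)[OF v k Mod_hom_app(1)[OF t hom_Obj(1)[OF k] z]] Mod_hom_app(2)[OF t k z] by simp
qed (use wcoconeD(1,2)[OF v] Mod_hom_app(1)[OF t] in auto)

definition ext_arr where
  "ext_arr t = (SOME h. h \<in> hom C (ext_obj (Dom Md t)) (ext_obj (Cod Md t)) \<and>
     (\<forall>a z. a \<in> Obj L \<longrightarrow> z \<in> FObj (Dom Md t) a \<longrightarrow>
        Cmp C h (leg (Dom Md t) a z) = leg (Cod Md t) a (app t a z)))"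

lemma ext_arr:
  assumes t: "t \<in> hom Md M K"
  shows "ext_arr t \<in> hom C (ext_obj M) (ext_obj K)"
    and "a \<in> Obj L \<Longrightarrow> z \<in> FObj M a \<Longrightarrow> Cmp C (ext_arr t) (leg M a z) = leg K a (app t a z)"
proof -
  note M = Md.hom_Obj(1)[OF t] and K = Md.hom_Obj(2)[OF t]
  have "\<exists>h. h \<in> hom C (ext_obj M) (ext_obj K) \<and>
     (\<forall>a z. a \<in> Obj L \<longrightarrow> z \<in> FObj M a \<longrightarrow> Cmp C h (leg M a z) = leg K a (app t a z))"
    using wcolimit_desc[OF ext_wcolimit[OF M] wcocone_along[OF t ext_cocone[OF K]]] by metis
  from someI_ex[OF this]
  show "ext_arr t \<in> hom C (ext_obj M) (ext_obj K)"
    and "a \<in> Obj L \<Longrightarrow> z \<in> FObj M a \<Longrightarrow> Cmp C (ext_arr t) (leg M a z) = leg K a (app t a z)"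
    unfolding ext_arr_def hom_Dom[OF t] hom_Cod[OF t] by auto
qed

definition Ext where
  "Ext = \<lparr>FObj = restrict ext_obj (Obj Md), FArr = restrict ext_arr (Arr Md)\<rparr>"

lemma Ext_simps [simp]: "M \<in> Obj Md \<Longrightarrow> FObj Ext M = ext_obj M" "t \<in> hom Md M K \<Longrightarrow> FArr Ext t = ext_arr t"
  by (simp_all add: Ext_def hom_def)

lemma is_functor_Ext: "is_functor Md C Ext"
proof (rule is_functorI)
  fix t M K assume t: "t \<in> hom Md M K"
  then show "FArr Ext t \<in> hom C (FObj Ext M) (FObj Ext K)"
    using ext_arr(1)[OF t] Md.hom_Obj[OF t] by simp
next
  fix M assume M: "M \<in> Obj Md"
  note i = Md.Idn_hom[OF M]
  have "ext_arr (Idn Md M) = Idn C (ext_obj M)"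
  proof (rule wcolimit_eqI[OF ext_wcolimit[OF M] ext_arr(1)[OF i] C.Idn_hom[OF ext_obj_Obj[OF M]]])
    fix a z assume az: "a \<in> Obj L" "z \<in> FObj M a"
    show "Cmp C (ext_arr (Idn Md M)) (leg M a z) = Cmp C (Idn C (ext_obj M)) (leg M a z)"
      using ext_arr(2)[OF i az] C.Idn_Cmp[OF leg_hom[OF M az]] app_Idn[OF M az] by simp
  qed
  then show "FArr Ext (Idn Md M) = Idn C (FObj Ext M)"
    unfolding Ext_simps(2)[OF i] Ext_simps(1)[OF M] .
next
  fix t s M K K' assume t: "t \<in> hom Md M K" and s: "s \<in> hom Md K K'"
  note M = Md.hom_Obj(1)[OF t] and K = Md.hom_Obj(1)[OF s] and st = Md.Cmp_hom[OF t s]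
  have "ext_arr (Cmp Md s t) = Cmp C (ext_arr s) (ext_arr t)"
  proof (rule wcolimit_eqI[OF ext_wcolimit[OF M] ext_arr(1)[OF st] C.Cmp_hom[OF ext_arr(1)[OF t] ext_arr(1)[OF s]]])
    fix a z assume az: "a \<in> Obj L" "z \<in> FObj M a"
    show "Cmp C (ext_arr (Cmp Md s t)) (leg M a z) = Cmp C (Cmp C (ext_arr s) (ext_arr t)) (leg M a z)"
      using ext_arr(2)[OF st az] ext_arr(2)[OF t az] app_Cmp[OF t s az]
        ext_arr(2)[OF s az(1) Mod_hom_app(1)[OF t az]]
        C.Cmp_assoc[OF leg_hom[OF M az] ext_arr(1)[OF t] ext_arr(1)[OF s]] by simp
  qed
  then show "FArr Ext (Cmp Md s t) = Cmp C (FArr Ext s) (FArr Ext t)"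
    by (simp add: Ext_simps(2)[OF st] Ext_simps(2)[OF t] Ext_simps(2)[OF s])
qed (simp add: ext_obj_Obj)

text \<open>
  The value at \<open>d\<close> of the right adjoint of the extension. Weighted cocones from \<open>M\<close> to \<open>d\<close>, and hence
  arrows from \<open>ext_obj M\<close> to \<open>d\<close>, correspond to homomorphisms from \<open>M\<close> to \<open>hom_model d\<close>.
\<close>

definition hom_model where
  "hom_model d = realize (\<lambda>a. hom C (FObj N a) d) (\<lambda>k g. Cmp C g (FArr N k))"

lemma set_model_hom_into:
  assumes d: "d \<in> Obj C"
  shows "set_model (\<lambda>a. hom C (FObj N a) d) (\<lambda>k g. Cmp C g (FArr N k))"
  unfolding set_model_def
proof (intro conjI ballI allI impI)
  fix a assume "a \<in> Obj L"
  then show "small U (hom C (FObj N a) d)"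
    using cocomplete N_Obj d by (simp add: cocomplete_category_def locally_small_def)
next
  fix a b k g assume k: "k \<in> hom L a b" and g: "g \<in> hom C (FObj N a) d"
  show "Cmp C g (FArr N k) \<in> hom C (FObj N b) d" by (rule C.Cmp_hom[OF N_hom[OF k] g])
next
  fix a g assume a: "a \<in> Obj L" and g: "g \<in> hom C (FObj N a) d"
  show "Cmp C g (FArr N (Idn L a)) = g" using N_Idn[OF a] C.Cmp_Idn[OF g] by simp
next
  fix a b c k l g assume k: "k \<in> hom L a b" and l: "l \<in> hom L b c" and g: "g \<in> hom C (FObj N a) d"
  show "Cmp C g (FArr N (Cmp L l k)) = Cmp C (Cmp C g (FArr N k)) (FArr N l)"
    using C.Cmp_assoc[OF N_hom[OF l] N_hom[OF k] g] N_Cmp[OF k l] by simp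
next
  fix I :: "'u set" and P pr assume "small U I" "is_product L I (\<lambda>_. X) P pr"
  then have "is_coproduct C I (\<lambda>_. FObj N X) (FObj N P) (\<lambda>i. FArr N (pr i))"
    using N_comodel by (simp add: is_comodel_def)
  then show "unique_tuples I (hom C (FObj N X) d) (hom C (FObj N P) d) (\<lambda>i g. Cmp C g (FArr N (pr i)))"
    using d unfolding is_coproduct_def unique_tuples_def by simp
qed

definition transpose where
  "transpose M d v = mk_arr M (hom_model d) (\<lambda>a z. enc (hom C (FObj N a) d) (v a z))"

lemma small_hom_into: "d \<in> Obj C \<Longrightarrow> a \<in> Obj L \<Longrightarrow> small U (hom C (FObj N a) d)"
  by (rule set_modelD(1)[OF set_model_hom_into])

lemma transpose_hom:
  assumes M: "M \<in> Obj Md" and v: "wcocone C N M d v"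
  shows "transpose M d v \<in> hom Md M (hom_model d)"
  unfolding transpose_def hom_model_def
proof (rule arr_to_realize[OF set_model_hom_into[OF wcoconeD(1)[OF v]] M])
  show "nat_map (FObj M) (ap M) (\<lambda>a. hom C (FObj N a) d) (\<lambda>k g. Cmp C g (FArr N k)) v"
    unfolding nat_map_def using wcoconeD(2,3)[OF v] by simp
qed

lemma app_transpose:
  "a \<in> Obj L \<Longrightarrow> z \<in> FObj M a \<Longrightarrow> app (transpose M d v) a z = enc (hom C (FObj N a) d) (v a z)"
  by (simp add: transpose_def app_mk_arr)

lemma untranspose:
  assumes d: "d \<in> Obj C" and t: "t \<in> hom Md M (hom_model d)"
  obtains v where "wcocone C N M d v"
    "\<And>a z. a \<in> Obj L \<Longrightarrow> z \<in> FObj M a \<Longrightarrow> app t a z = enc (hom C (FObj N a) d) (v a z)"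
proof
  let ?v = "\<lambda>a z. dec (hom C (FObj N a) d) (app t a z)"
  have mem: "?v a z \<in> hom C (FObj N a) d \<and> app t a z = enc (hom C (FObj N a) d) (?v a z)"
    if "a \<in> Obj L" "z \<in> FObj M a" for a z
    using Mod_hom_app(1)[OF t that] that small_hom_into[OF d]
    by (auto simp: hom_model_def realize_simps(1)[OF set_model_hom_into[OF d]] dec_enc)
  then show "\<And>a z. a \<in> Obj L \<Longrightarrow> z \<in> FObj M a \<Longrightarrow> app t a z = enc (hom C (FObj N a) d) (?v a z)"
    by blast
  show "wcocone C N M d ?v"
  proof (rule wcoconeI)
    fix a b k z assume k: "k \<in> hom L a b" and z: "z \<in> FObj M a"
    note ab = hom_Obj[OF k]
    have v: "?v a z \<in> hom C (FObj N a) d" using mem[OF ab(1) z] by blast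
    have "app t b (ap M k z) = ap (hom_model d) k (app t a z)" by (rule Mod_hom_app(2)[OF t k z])
    also have "\<dots> = ap (hom_model d) k (enc (hom C (FObj N a) d) (?v a z))"
      using mem[OF ab(1) z] by simp
    also have "\<dots> = enc (hom C (FObj N b) d) (Cmp C (?v a z) (FArr N k))"
      unfolding hom_model_def by (rule realize_simps(2)[OF set_model_hom_into[OF d] k v])
    finally show "Cmp C (?v a z) (FArr N k) = ?v b (ap M k z)"
      using dec_enc[OF small_hom_into[OF d ab(2)] C.Cmp_hom[OF N_hom[OF k] v]] by simp
  qed (use d mem in auto)
qed

text \<open>
  Left adjoints preserve colimits: a cocone \<open>s\<close> with vertex \<open>d\<close> over the image of the diagram
  transposes to a cocone with vertex \<open>hom_model d\<close> over the diagram itself, whose mediating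
  homomorphism \<open>h\<close> transposes back to a weighted cocone \<open>x\<close> on \<open>M\<close>. An arrow out of \<open>ext_obj M\<close> mediates
  for \<open>s\<close> exactly if it mediates for \<open>x\<close>.
\<close>

lemma cocontinuous_Ext: "cocontinuous U Md C Ext"
  unfolding cocontinuous_def
proof (intro allI impI)
  fix J :: "('u, 'u) cat" and D M t
  assume "small_category U J \<and> is_functor J Md D \<and> is_colimit J Md D M t"
  then have J: "category J" and D: "is_functor J Md D" and colim: "is_colimit J Md D M t"
    by (auto simp: small_category_def)
  have cocone: "is_cocone J Md D M t" using colim by (simp add: is_colimit_def)
  have t: "t j \<in> hom Md (FObj D j) M" if "j \<in> Obj J" for j
    using cocone that by (auto simp: is_cocone_def)
  have M: "M \<in> Obj Md" using cocone by (simp add: is_cocone_def)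
  note DO = is_functorD(1)[OF D]
  note Arr_J = category.Dom_Obj[OF J] category.Cod_Obj[OF J]
  show "is_colimit J C (comp_functor Ext D) (FObj Ext M) (\<lambda>j. FArr Ext (t j))"
    unfolding is_colimit_def
  proof (intro conjI allI impI)
    show "is_cocone J C (comp_functor Ext D) (FObj Ext M) (\<lambda>j. FArr Ext (t j))"
      unfolding is_cocone_def
    proof (intro conjI ballI)
      fix f assume f: "f \<in> Arr J"
      note Df = is_functorD(2)[OF D Arr_hom[OF f]]
      show "Cmp C (FArr Ext (t (Cod J f))) (FArr (comp_functor Ext D) f) = FArr Ext (t (Dom J f))"
        using is_functorD(4)[OF is_functor_Ext Df t[OF Arr_J(2)[OF f]]] cocone f
        by (simp add: is_cocone_def)
    next
      fix j assume "j \<in> Obj J"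
      from is_functorD(2)[OF is_functor_Ext t[OF this]]
      show "FArr Ext (t j) \<in> hom C (FObj (comp_functor Ext D) j) (FObj Ext M)" by simp
    qed (rule is_functorD(1)[OF is_functor_Ext M])
  next
    fix d s assume s: "is_cocone J C (comp_functor Ext D) d s"
    have d: "d \<in> Obj C" using s by (simp add: is_cocone_def)
    have sj: "s j \<in> hom C (ext_obj (FObj D j)) d" if "j \<in> Obj J" for j
      using s that by (simp add: is_cocone_def Ext_simps(1)[OF DO[OF that], symmetric] del: Ext_simps(1))
    define v where "v j a z = Cmp C (s j) (leg (FObj D j) a z)" for j a z
    have v: "wcocone C N (FObj D j) d (v j)" if "j \<in> Obj J" for j
      unfolding v_def by (rule wcocone_post[OF sj ext_cocone[OF DO]]) (use that in auto)
    have "is_cocone J Md D (hom_model d) (\<lambda>j. transpose (FObj D j) d (v j))"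
      unfolding is_cocone_def
    proof (intro conjI ballI)
      show "hom_model d \<in> Obj Md"
        unfolding hom_model_def by (rule realize_Obj[OF set_model_hom_into[OF d]])
    next
      fix f assume f: "f \<in> Arr J"
      let ?i = "Dom J f" and ?j = "Cod J f"
      note ij = Arr_J[OF f] and Df = is_functorD(2)[OF D Arr_hom[OF f]]
      note tj = transpose_hom[OF DO[OF ij(2)] v[OF ij(2)]]
      show "Cmp Md (transpose (FObj D ?j) d (v ?j)) (FArr D f) = transpose (FObj D ?i) d (v ?i)"
      proof (rule Mod_hom_eqI[OF Md.Cmp_hom[OF Df tj] transpose_hom[OF DO[OF ij(1)] v[OF ij(1)]]])
        fix a z assume az: "a \<in> Obj L" "z \<in> FObj (FObj D ?i) a"
        note z' = Mod_hom_app(1)[OF Df az]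
        have "v ?j a (app (FArr D f) a z) = Cmp C (Cmp C (s ?j) (ext_arr (FArr D f))) (leg (FObj D ?i) a z)"
          unfolding v_def
          using C.Cmp_assoc[OF leg_hom[OF DO[OF ij(1)] az] ext_arr(1)[OF Df] sj[OF ij(2)]]
            ext_arr(2)[OF Df az] by simp
        also have "\<dots> = v ?i a z"
          using s f by (simp add: is_cocone_def v_def Ext_simps(2)[OF Df, symmetric])
        finally show "app (Cmp Md (transpose (FObj D ?j) d (v ?j)) (FArr D f)) a z =
            app (transpose (FObj D ?i) d (v ?i)) a z"
          by (simp add: app_Cmp[OF Df tj az] app_transpose az z')
      qed
    qed (rule transpose_hom[OF DO v])
    then have ex1: "\<exists>!h. h \<in> hom Md M (hom_model d) \<and>
        (\<forall>j\<in>Obj J. Cmp Md h (t j) = transpose (FObj D j) d (v j))"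
      using colim by (simp add: is_colimit_def)
    then obtain h where h: "h \<in> hom Md M (hom_model d)"
        "\<And>j. j \<in> Obj J \<Longrightarrow> Cmp Md h (t j) = transpose (FObj D j) d (v j)" by blast
    obtain x where x: "wcocone C N M d x"
        "\<And>a z. a \<in> Obj L \<Longrightarrow> z \<in> FObj M a \<Longrightarrow> app h a z = enc (hom C (FObj N a) d) (x a z)"
      using untranspose[OF d h(1)] by blast
    have x_t: "x a (app (t j) a z) = v j a z"
      if j: "j \<in> Obj J" and az: "a \<in> Obj L" "z \<in> FObj (FObj D j) a" for j a z
    proof -
      note tz = Mod_hom_app(1)[OF t[OF j] az]
      have "enc (hom C (FObj N a) d) (x a (app (t j) a z)) = enc (hom C (FObj N a) d) (v j a z)"
        using x(2)[OF az(1) tz] app_Cmp[OF t[OF j] h(1) az] h(2)[OF j] app_transpose[OF az] by simp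
      then show ?thesis
        using enc_eq_iff[OF small_hom_into[OF d az(1)]] wcoconeD(2)[OF x(1) az(1) tz]
          wcoconeD(2)[OF v[OF j] az] by simp
    qed
    have key: "(\<forall>j\<in>Obj J. Cmp C k (ext_arr (t j)) = s j) \<longleftrightarrow>
        (\<forall>a z. a \<in> Obj L \<longrightarrow> z \<in> FObj M a \<longrightarrow> Cmp C k (leg M a z) = x a z)"
      if k: "k \<in> hom C (ext_obj M) d" for k
    proof
      assume eq: "\<forall>j\<in>Obj J. Cmp C k (ext_arr (t j)) = s j"
      let ?w = "\<lambda>a z. Cmp C k (leg M a z)"
      have w: "wcocone C N M d ?w" by (rule wcocone_post[OF k ext_cocone[OF M]])
      note w_hom = transpose_hom[OF M w]
      have "Cmp Md (transpose M d ?w) (t j) = transpose (FObj D j) d (v j)" if j: "j \<in> Obj J" for j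
      proof (rule Mod_hom_eqI[OF Md.Cmp_hom[OF t[OF j] w_hom] transpose_hom[OF DO[OF j] v[OF j]]])
        fix a z assume az: "a \<in> Obj L" "z \<in> FObj (FObj D j) a"
        note tz = Mod_hom_app(1)[OF t[OF j] az]
        have "?w a (app (t j) a z) = v j a z"
          using C.Cmp_assoc[OF leg_hom[OF DO[OF j] az] ext_arr(1)[OF t[OF j]] k] eq j
            ext_arr(2)[OF t[OF j] az] by (simp add: v_def)
        then show "app (Cmp Md (transpose M d ?w) (t j)) a z = app (transpose (FObj D j) d (v j)) a z"
          by (simp add: app_Cmp[OF t[OF j] w_hom az] app_transpose az tz)
      qed
      then have hw: "transpose M d ?w = h" using ex1 h w_hom by blast
      show "\<forall>a z. a \<in> Obj L \<longrightarrow> z \<in> FObj M a \<longrightarrow> ?w a z = x a z"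
      proof (intro allI impI)
        fix a z assume az: "a \<in> Obj L" "z \<in> FObj M a"
        have "enc (hom C (FObj N a) d) (?w a z) = enc (hom C (FObj N a) d) (x a z)"
          using app_transpose[OF az, of d ?w] x(2)[OF az] hw by simp
        then show "?w a z = x a z"
          using enc_eq_iff[OF small_hom_into[OF d az(1)]] wcoconeD(2)[OF w az] wcoconeD(2)[OF x(1) az]
          by simp
      qed
    next
      assume eq: "\<forall>a z. a \<in> Obj L \<longrightarrow> z \<in> FObj M a \<longrightarrow> Cmp C k (leg M a z) = x a z"
      show "\<forall>j\<in>Obj J. Cmp C k (ext_arr (t j)) = s j"
      proof
        fix j assume j: "j \<in> Obj J"
        note e = ext_arr(1)[OF t[OF j]]
        show "Cmp C k (ext_arr (t j)) = s j"
        proof (rule wcolimit_eqI[OF ext_wcolimit[OF DO[OF j]] C.Cmp_hom[OF e k] sj[OF j]])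
          fix a z assume az: "a \<in> Obj L" "z \<in> FObj (FObj D j) a"
          show "Cmp C (Cmp C k (ext_arr (t j))) (leg (FObj D j) a z) = Cmp C (s j) (leg (FObj D j) a z)"
            using C.Cmp_assoc[OF leg_hom[OF DO[OF j] az] e k] ext_arr(2)[OF t[OF j] az] x_t[OF j az]
              eq az(1) Mod_hom_app(1)[OF t[OF j] az] by (simp add: v_def)
        qed
      qed
    qed
    have "\<exists>!k. k \<in> hom C (ext_obj M) d \<and>
        (\<forall>a z. a \<in> Obj L \<longrightarrow> z \<in> FObj M a \<longrightarrow> Cmp C k (leg M a z) = x a z)"
      using ext_wcolimit[OF M] x(1) by (simp add: wcolimit_def)
    then have "\<exists>!k. k \<in> hom C (ext_obj M) d \<and> (\<forall>j\<in>Obj J. Cmp C k (ext_arr (t j)) = s j)"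
      using key by (simp cong: conj_cong)
    moreover have "FArr Ext (t j) = ext_arr (t j)" if "j \<in> Obj J" for j
      by (rule Ext_simps(2)[OF t[OF that]])
    ultimately show "\<exists>!k. k \<in> hom C (FObj Ext M) d \<and> (\<forall>j\<in>Obj J. Cmp C k (FArr Ext (t j)) = s j)"
      using M by simp
  qed
qed

lemma Ext_HomC: "Ext \<in> Obj HomC"
  unfolding HomC_Obj using is_functor_Ext cocontinuous_Ext
  by (auto intro!: functor_objectsI simp: Ext_def)

text \<open>
  By the Yoneda lemma the colimit of \<open>N\<close> weighted by \<open>hom L a\<close> is \<open>N a\<close>: the comparison \<open>e a\<close> is
  induced by the action of \<open>N\<close> on arrows out of \<open>a\<close>, and its inverse \<open>i a\<close> is the leg at
  the identity.
\<close>

lemma restr_Ext_iso: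
  assumes "N \<in> Obj ModC"
  shows "\<exists>e\<in>hom ModC (restr Ext) N. iso ModC e"
proof -
  interpret ModC: category ModC by (rule category_ModC)
  have cocone: "wcocone C N (rep a) (FObj N a) (\<lambda>b g. FArr N (dec (hom L a b) g))" if a: "a \<in> Obj L" for a
  proof (rule wcoconeI)
    fix b g assume "b \<in> Obj L" "g \<in> FObj (rep a) b"
    then obtain f where "f \<in> hom L a b" "g = arr_elem f" using rep_elemE[OF a] by blast
    then show "FArr N (dec (hom L a b) g) \<in> hom C (FObj N b) (FObj N a)" by (simp add: dec_arr_elem N_hom)
  next
    fix b c k g assume k: "k \<in> hom L b c" and "g \<in> FObj (rep a) b"
    then obtain f where f: "f \<in> hom L a b" "g = arr_elem f" using rep_elemE[OF a hom_Obj(1)[OF k]] by blast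
    show "Cmp C (FArr N (dec (hom L a b) g)) (FArr N k) = FArr N (dec (hom L a c) (ap (rep a) k g))"
      by (simp add: f(2) dec_arr_elem[OF f(1)] ap_rep[OF f(1) k] dec_arr_elem[OF Cmp_hom[OF f(1) k]]
          N_Cmp[OF f(1) k])
  qed (rule N_Obj[OF a])
  have "\<exists>h. h \<in> hom C (ext_obj (rep a)) (FObj N a) \<and>
      (\<forall>b f. f \<in> hom L a b \<longrightarrow> Cmp C h (leg (rep a) b (arr_elem f)) = FArr N f)" if a: "a \<in> Obj L" for a
    using wcolimit_desc[OF ext_wcolimit[OF rep_Obj[OF a]] cocone[OF a]] arr_elem_in_rep dec_arr_elem hom_Obj(2) by metis
  then obtain e where e: "\<And>a. a \<in> Obj L \<Longrightarrow> e a \<in> hom C (ext_obj (rep a)) (FObj N a)"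
    and e_leg: "\<And>a b f. f \<in> hom L a b \<Longrightarrow> Cmp C (e a) (leg (rep a) b (arr_elem f)) = FArr N f"
    using hom_Obj(1) by metis
  define i where "i a = leg (rep a) a (arr_elem (Idn L a))" for a
  have i: "i a \<in> hom C (FObj N a) (ext_obj (rep a))" if "a \<in> Obj L" for a
    unfolding i_def by (rule leg_hom[OF rep_Obj[OF that] that Idn_elem[OF that]])
  have i_N: "Cmp C (i a) (FArr N f) = leg (rep a) b (arr_elem f)" if f: "f \<in> hom L a b" for f a b
    unfolding i_def
    using wcoconeD(3)[OF ext_cocone[OF rep_Obj] f Idn_elem] hom_Obj(1)[OF f]
      ap_rep[OF Idn_hom f] Cmp_Idn[OF f] by simp
  have leg_rep: "leg (rep a) b (arr_elem f) \<in> hom C (FObj N b) (ext_obj (rep a))" if "f \<in> hom L a b" for f a b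
    using leg_hom[OF rep_Obj hom_Obj(2)[OF that] arr_elem_in_rep[OF that]] hom_Obj(1)[OF that] by simp
  have ei: "Cmp C (e a) (i a) = Idn C (FObj N a)" if "a \<in> Obj L" for a
    unfolding i_def using e_leg[OF Idn_hom[OF that]] N_Idn[OF that] by simp
  have ie: "Cmp C (i a) (e a) = Idn C (ext_obj (rep a))" if a: "a \<in> Obj L" for a
  proof (rule wcolimit_eqI[OF ext_wcolimit[OF rep_Obj[OF a]] C.Cmp_hom[OF e[OF a] i[OF a]]
        C.Idn_hom[OF ext_obj_Obj[OF rep_Obj[OF a]]]])
    fix b g assume "b \<in> Obj L" "g \<in> FObj (rep a) b"
    then obtain f where f: "f \<in> hom L a b" "g = arr_elem f" using rep_elemE[OF a] by blast
    show "Cmp C (Cmp C (i a) (e a)) (leg (rep a) b g) = Cmp C (Idn C (ext_obj (rep a))) (leg (rep a) b g)"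
      using C.Cmp_assoc[OF leg_rep[OF f(1)] e[OF a] i[OF a]] e_leg[OF f(1)] i_N[OF f(1)]
        C.Idn_Cmp[OF leg_rep[OF f(1)]] by (simp add: f(2))
  qed
  have restr_simps': "FObj (restr Ext) a = ext_obj (rep a)" if "a \<in> Obj L" for a
    using that rep_Obj by simp
  have restr_arr: "FArr (restr Ext) k = ext_arr (rep_arr k)" if "k \<in> hom L a b" for k a b
    using that rep_arr_hom[OF that] by simp
  have i_nat: "Cmp C (ext_arr (rep_arr k)) (i b) = Cmp C (i a) (FArr N k)" if k: "k \<in> hom L a b" for k a b
  proof -
    note ab = hom_Obj[OF k]
    have "app (rep_arr k) b (arr_elem (Idn L b)) = arr_elem k"
      using app_el_Idn[OF rep_Obj[OF ab(1)] ab(2) arr_elem_in_rep[OF k]] rep_arr_eq[OF k] by simp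
    then show ?thesis
      using ext_arr(2)[OF rep_arr_hom[OF k] ab(2) Idn_elem[OF ab(2)]] i_N[OF k] by (simp add: i_def)
  qed
  have e_nat: "Cmp C (e a) (ext_arr (rep_arr k)) = Cmp C (FArr N k) (e b)" if k: "k \<in> hom L a b" for k a b
  proof -
    note ab = hom_Obj[OF k]
    note E = ext_arr(1)[OF rep_arr_hom[OF k]] and eE = C.Cmp_hom[OF ext_arr(1)[OF rep_arr_hom[OF k]] e[OF ab(1)]]
    have "Cmp C (e a) (ext_arr (rep_arr k)) = Cmp C (Cmp C (e a) (ext_arr (rep_arr k))) (Cmp C (i b) (e b))"
      using C.Cmp_Idn[OF eE] ie[OF ab(2)] by simp
    also have "\<dots> = Cmp C (Cmp C (e a) (Cmp C (ext_arr (rep_arr k)) (i b))) (e b)"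
      using C.Cmp_assoc[OF e[OF ab(2)] i[OF ab(2)] eE] C.Cmp_assoc[OF i[OF ab(2)] E e[OF ab(1)]] by simp
    also have "\<dots> = Cmp C (Cmp C (Cmp C (e a) (i a)) (FArr N k)) (e b)"
      using C.Cmp_assoc[OF N_hom[OF k] i[OF ab(1)] e[OF ab(1)]] i_nat[OF k] by simp
    also have "\<dots> = Cmp C (FArr N k) (e b)"
      using ei[OF ab(1)] C.Idn_Cmp[OF N_hom[OF k]] by simp
    finally show ?thesis .
  qed
  have "nat_trans (op_cat L) C (restr Ext) N e"
    by (rule nat_transI) (use e e_nat restr_simps' restr_arr in auto)
  moreover have "nat_trans (op_cat L) C N (restr Ext) i"
    by (rule nat_transI) (use i i_nat restr_simps' restr_arr in auto)
  ultimately have hom: "(restr Ext, N, restrict e (Obj L)) \<in> hom ModC (restr Ext) N"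
      "(N, restr Ext, restrict i (Obj L)) \<in> hom ModC N (restr Ext)"
    using assms restr_ModC[OF Ext_HomC] nat_trans_restrict[OF category_op[OF category_axioms], of C]
    by (auto simp: ModC_hom)
  have "iso ModC (restr Ext, N, restrict e (Obj L))"
    by (rule ModC.isoI[OF hom]) (auto simp: ModC_simps restr_simps' ei ie rep_Obj intro!: restrict_ext)
  then show ?thesis using hom(1) by blast
qed

end

section \<open>The universal property of the category of models\<close>

theorem (in cocomplete_target) Hom_c_equivalent_comodels: "equivalent_categories HomC ModC"
proof (rule equivalent_categoriesI[OF category_HomC category_ModC is_functor_restriction])
  fix N assume NM: "N \<in> Obj ModC"
  interpret comodel U L X C N by (rule comodel_ModC[OF NM])
  interpret comodel_extension U L X C N ..
  show "\<exists>G\<in>Obj HomC. \<exists>e\<in>hom ModC (FObj restriction G) N. iso ModC e"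
    using Ext_HomC restr_Ext_iso[OF NM] by auto
qed (simp add: restriction_fully_faithful)

theorem theorem1p3:
  fixes L :: "('o, 'a) cat" and X :: 'o
  assumes "universe TYPE('u)"
    and "infinitary_Lawvere_theory TYPE('u) L X"
  shows "cocomplete_category TYPE('u) (Mod TYPE('u) L X) \<and>
    (\<forall>C :: ('p, 'b) cat. cocomplete_category TYPE('u) C \<longrightarrow>
       equivalent_categories (Hom_c TYPE('u) (Mod TYPE('u) L X) C) (Mod_op TYPE('u) C L X))"
proof (intro conjI allI impI)
  interpret lawvere_theory "TYPE('u)" L X
    using assms by (intro lawvere_theory.intro small_universe.intro)
  show "cocomplete_category TYPE('u) (Mod TYPE('u) L X)" by (rule cocomplete_Mod)
  fix C :: "('p, 'b) cat" assume "cocomplete_category TYPE('u) C"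
  then interpret cocomplete_target "TYPE('u)" L X C
    by unfold_locales
  show "equivalent_categories (Hom_c TYPE('u) (Mod TYPE('u) L X) C) (Mod_op TYPE('u) C L X)"
    by (rule Hom_c_equivalent_comodels)
qed

end
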